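(* Let $m=0$, $\sigma>0$, $\tau>0$, let $H$ be a complex Hilbert space, let $A$ be a self-adjoint positive definite operator with compact resolvent on $H$, and for parameters $(\alpha,\beta)\in[0,1]^2$ let $e^{\mathcal{A}t}$ be the $C_0$-semigroup of contractions on $\mathcal{H}$ generated by the operator $\mathcal{A}$ (associated with the abstract thermoelastic system of Cattaneo type without inertial term; $\mathcal{A}$, $\mathcal{H}$ and the parameter regions $V_1^*,V_2^*$ are defined in the context). Then: (i) if $(\alpha,\beta)\in V_1^*$, $e^{\mathcal{A}t}$ is polynomially stable of order $k_1^*=\dfrac{\alpha}{2\alpha-\beta}$; (ii) if $(\alpha,\beta)\in V_2^*$, $e^{\mathcal{A}t}$ is polynomially stable of order $k_2^*=\dfrac{1}{2(2-2\alpha-\beta)}$.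
   Context: The abstract system (no inertial term) is $$u_{tt}+\sigma Au-A^\alpha\theta=0,\quad \theta_t-A^{\beta/2}q+A^\alpha u_t=0,\quad \tau q_t+q+A^{\beta/2}\theta=0,$$ with initial data $u(0)=u_0$, $u_t(0)=u_1$, $\theta(0)=\theta_0$, $q(0)=q_0$. $(\cdot,\cdot)$ and $\|\cdot\|$ are the inner product and norm of $H$. Powers $A^s$, $s\in\mathbb{R}$, are defined by the spectral theorem; for $s>0$, $\mathcal{D}(A^{-s})$ denotes the completion of $H$ in the norm $\|A^{-s}\cdot\|$, and $A^s$ is extended to act on this scale of spaces. State space: $\mathcal{H}=\mathcal{D}(A^{1/2})\times H\times H\times H$ with inner product $$\langle U_1,U_2\rangle_{\mathcal{H}}=\sigma(A^{1/2}u_1,A^{1/2}u_2)+(v_1,v_2)+(\theta_1,\theta_2)+\tau(q_1,q_2),$$ for $U_i=(u_i,v_i,\theta_i,q_i)^\top$. Operator (with $v=u_t$, the system reads $\frac{d}{dt}U=\mathcal{A}U$ for $U=(u,v,\theta,q)^\top$): $$\mathcal{A}(u,v,\theta,q)^\top=\Big(v,\ -\sigma Au+A^\alpha\theta,\ -A^\alpha v+A^{\beta/2}q,\ \tfrac1\tau(-q-A^{\beta/2}\theta)\Big)^\top,$$ $$\mathcal{D}(\mathcal{A})=\{(u,v,\theta,q)^\top\in\mathcal{H}: v\in\mathcal{D}(A^{1/2}),\ \sigma Au-A^\alpha\theta\in H,\ -A^\alpha v+A^{\beta/2}q\in H,\ q+A^{\beta/2}\theta\in H\}.$$ When $\beta\ge2\alpha-1$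 (which holds on both regions below), $0\in\rho(\mathcal{A})$ and $\mathcal{A}$ generates a $C_0$-semigroup of contractions $e^{\mathcal{A}t}$ on $\mathcal{H}$. Polynomial stability: $e^{\mathcal{A}t}$ is polynomially stable of order $k>0$ if there is a constant $C>0$ such that $\|e^{\mathcal{A}t}\mathcal{A}^{-1}\|_{\mathcal{L}(\mathcal{H})}\le Ct^{-k}$ for all $t>0$. Parameter regions (subsets of $E^*=[0,1]^2$): $V_1^*=T_1^*\cup F_{12}^*\cup F_{14}^*\cup L_{124}^*$, where $T_1^*=\{\frac12<\alpha<\frac{\beta+1}{2},\ 0<\beta\le1\}$, $F_{12}^*=\{\alpha=\frac12,\ 0<\beta<1\}$, $F_{14}^*=\{\alpha=\frac{\beta+1}{2},\ 0<\beta\le1\}$, $L_{124}^*=\{\alpha=\frac12,\ \beta=0\}$. $V_2^*=T_2^*\cup F_2^*\cup L_{23}^*$, where $T_2^*=\{0\le\alpha<\frac12,\ 0<\beta<1\}$, $F_2^*=\{0\le\alpha<\frac12,\ \beta=0\}$, $L_{23}^*=\{0\le\alpha<\frac12,\ \beta=1\}$. *)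

theory Defs
  imports "HOL-Analysis.Analysis"
begin

section \<open>Complex Hilbert spaces\<close>

class complex_vector = real_vector +
  fixes scaleC :: "complex \<Rightarrow> 'a \<Rightarrow> 'a" (infixr "*\<^sub>C" 75)
  assumes scaleC_add_right: "c *\<^sub>C (x + y) = c *\<^sub>C x + c *\<^sub>C y"
    and scaleC_add_left: "(c + d) *\<^sub>C x = c *\<^sub>C x + d *\<^sub>C x"
    and scaleC_scaleC: "c *\<^sub>C (d *\<^sub>C x) = (c * d) *\<^sub>C x"
    and scaleC_of_real: "complex_of_real r *\<^sub>C x = r *\<^sub>R x"

instantiation prod :: (complex_vector, complex_vector) complex_vector
begin

definition scaleC_prod_def: "c *\<^sub>C p = (c *\<^sub>C fst p, c *\<^sub>C snd p)"

instance
  by standard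
    (auto simp: scaleC_prod_def scaleC_add_right scaleC_add_left scaleC_scaleC scaleC_of_real
      prod_eq_iff)

end

class chilbert_space = complex_vector + banach +
  fixes cinner :: "'a \<Rightarrow> 'a \<Rightarrow> complex"
  assumes cinner_add_left: "cinner (x + y) z = cinner x z + cinner y z"
    and cinner_scaleC_left: "cinner (c *\<^sub>C x) y = c * cinner x y"
    and cinner_commute: "cinner x y = cnj (cinner y x)"
    and cinner_self: "cinner x x = complex_of_real ((norm x)\<^sup>2)"

definition csubspace :: "'a::complex_vector set \<Rightarrow> bool" where
  "csubspace S \<longleftrightarrow> 0 \<in> S \<and> (\<forall>x\<in>S. \<forall>y\<in>S. x + y \<in> S) \<and> (\<forall>c. \<forall>x\<in>S. c *\<^sub>C x \<in> S)"

definition clinear_on :: "'a::complex_vector set \<Rightarrow> ('a \<Rightarrow> 'b::complex_vector) \<Rightarrow> bool" where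
  "clinear_on S f \<longleftrightarrow>
     (\<forall>x\<in>S. \<forall>y\<in>S. f (x + y) = f x + f y) \<and> (\<forall>c. \<forall>x\<in>S. f (c *\<^sub>C x) = c *\<^sub>C f x)"


section \<open>Unbounded operators\<close>

text \<open>
  An unbounded operator on \<open>H\<close> is a pair of a domain \<open>D\<close> and a map \<open>A\<close>; values of \<open>A\<close> outside
  \<open>D\<close> are irrelevant.
\<close>

text \<open>
  The right-hand side of the last equivalence says that \<open>(y, z)\<close> is in the graph of \<open>A\<close>, the
  left-hand side that it is in the graph of the adjoint.
\<close>

definition self_adjoint :: "'h::chilbert_space set \<Rightarrow> ('h \<Rightarrow> 'h) \<Rightarrow> bool" where
  "self_adjoint D A \<longleftrightarrow>
     csubspace D \<and> clinear_on D A \<and> closure D = UNIV \<and>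
     (\<forall>y z. (\<forall>x\<in>D. cinner (A x) y = cinner x z) \<longleftrightarrow> y \<in> D \<and> z = A y)"

definition positive_definite :: "'h::chilbert_space set \<Rightarrow> ('h \<Rightarrow> 'h) \<Rightarrow> bool" where
  "positive_definite D A \<longleftrightarrow>
     (\<forall>x\<in>D. x \<noteq> 0 \<longrightarrow> Im (cinner (A x) x) = 0 \<and> Re (cinner (A x) x) > 0)"

definition compact_operator :: "('h::chilbert_space \<Rightarrow> 'h) \<Rightarrow> bool" where
  "compact_operator K \<longleftrightarrow> clinear_on UNIV K \<and> (\<forall>B. bounded B \<longrightarrow> compact (closure (K ` B)))"

text \<open>
  Boundedness of the inverse is not listed separately: a compact operator is bounded, so \<open>z\<close> is in
  the resolvent set.
\<close>

definition compact_resolvent :: "'h::chilbert_space set \<Rightarrow> ('h \<Rightarrow> 'h) \<Rightarrow> bool" where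
  "compact_resolvent D A \<longleftrightarrow>
     (\<exists>z. bij_betw (\<lambda>x. z *\<^sub>C x - A x) D UNIV \<and>
          compact_operator (inv_into D (\<lambda>x. z *\<^sub>C x - A x)))"


section \<open>Powers of a positive definite self-adjoint operator with compact resolvent\<close>

text \<open>
  The spectrum of such an operator consists of positive eigenvalues \<open>l\<close>, and its spectral measure
  is the sum of the point masses at \<open>l\<close> with values the orthogonal projections \<open>P\<^sub>l\<close> onto the
  eigenspaces. So the spectral theorem gives \<open>A\<^sup>s x = (\<Sum>l. l\<^sup>s P\<^sub>l x)\<close>, with domain the vectors
  such that \<open>(\<Sum>l. l\<^sup>2\<^sup>s \<parallel>P\<^sub>l x\<parallel>\<^sup>2) < \<infinity>\<close>.

  For \<open>s > 0\<close> the completion of \<open>H\<close> in the norm \<open>\<parallel>A\<^sup>-\<^sup>s x\<parallel> = (\<Sum>l. l\<^sup>-\<^sup>2\<^sup>s \<parallel>P\<^sub>l x\<parallel>\<^sup>2)\<^sup>1\<^sup>/\<^sup>2\<close> is realised as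
  the weighted square-summable direct sum of the (closed) eigenspaces, that is, as the complete
  space of the families \<open>c\<close> with \<open>c l\<close> in the eigenspace of \<open>l\<close> and \<open>(\<Sum>l. l\<^sup>-\<^sup>2\<^sup>s \<parallel>c l\<parallel>\<^sup>2) < \<infinity>\<close>. The
  vector \<open>x\<close> of \<open>H\<close> is identified with the family of its components \<open>P\<^sub>l x\<close>; the image of \<open>H\<close> is
  dense because it contains the finitely supported families. All spaces of the scale lie in one
  space of families, on which \<open>A\<^sup>s\<close> acts as multiplication by \<open>l\<^sup>s\<close> for every real \<open>s\<close>:
  \<open>scale_space D A s\<close> is \<open>\<D>(A\<^sup>s)\<close> for every real \<open>s\<close>, and for \<open>s \<ge> 0\<close> \<open>pow_dom D A s\<close> is the same
  space as a set of vectors of \<open>H\<close>.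
\<close>

definition eigenspace :: "'h::chilbert_space set \<Rightarrow> ('h \<Rightarrow> 'h) \<Rightarrow> real \<Rightarrow> 'h set" where
  "eigenspace D A l = {x \<in> D. A x = l *\<^sub>R x}"

definition eigenvalues :: "'h::chilbert_space set \<Rightarrow> ('h \<Rightarrow> 'h) \<Rightarrow> real set" where
  "eigenvalues D A = {l. eigenspace D A l \<noteq> {0}}"

definition spectral_proj :: "'h::chilbert_space set \<Rightarrow> ('h \<Rightarrow> 'h) \<Rightarrow> real \<Rightarrow> 'h \<Rightarrow> 'h" where
  "spectral_proj D A l x =
     (THE y. y \<in> eigenspace D A l \<and> (\<forall>z\<in>eigenspace D A l. cinner (x - y) z = 0))"

definition components :: "'h::chilbert_space set \<Rightarrow> ('h \<Rightarrow> 'h) \<Rightarrow> 'h \<Rightarrow> (real \<Rightarrow> 'h)" where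
  "components D A x = (\<lambda>l. spectral_proj D A l x)"

definition scale_space :: "'h::chilbert_space set \<Rightarrow> ('h \<Rightarrow> 'h) \<Rightarrow> real \<Rightarrow> (real \<Rightarrow> 'h) set" where
  "scale_space D A s =
     {c. (\<forall>l. c l \<in> eigenspace D A l) \<and>
         (\<lambda>l. (l powr s * norm (c l))\<^sup>2) summable_on eigenvalues D A}"

definition pow_dom :: "'h::chilbert_space set \<Rightarrow> ('h \<Rightarrow> 'h) \<Rightarrow> real \<Rightarrow> 'h set" where
  "pow_dom D A s = {x. components D A x \<in> scale_space D A s}"

definition pow_op :: "'h::chilbert_space set \<Rightarrow> ('h \<Rightarrow> 'h) \<Rightarrow> real \<Rightarrow> 'h \<Rightarrow> 'h" where
  "pow_op D A s x = (\<Sum>\<^sub>\<infinity>l\<in>eigenvalues D A. l powr s *\<^sub>R spectral_proj D A l x)"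

definition scale_pow :: "real \<Rightarrow> (real \<Rightarrow> 'h::chilbert_space) \<Rightarrow> (real \<Rightarrow> 'h)" where
  "scale_pow s c = (\<lambda>l. l powr s *\<^sub>R c l)"

definition scale_in_H :: "'h::chilbert_space set \<Rightarrow> ('h \<Rightarrow> 'h) \<Rightarrow> (real \<Rightarrow> 'h) \<Rightarrow> bool" where
  "scale_in_H D A c \<longleftrightarrow> (\<exists>w. components D A w = c)"

definition scale_to_H :: "'h::chilbert_space set \<Rightarrow> ('h \<Rightarrow> 'h) \<Rightarrow> (real \<Rightarrow> 'h) \<Rightarrow> 'h" where
  "scale_to_H D A c = (THE w. components D A w = c)"


section \<open>Contraction semigroups and polynomial stability\<close>

text \<open>
  The Banach space here is a subspace \<open>S\<close> of a type with its own norm \<open>N\<close>. Only the values \<open>T t U\<close>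
  with \<open>t \<ge> 0\<close> and \<open>U \<in> S\<close> matter.
\<close>

definition C0_contraction_semigroup ::
    "'e::complex_vector set \<Rightarrow> ('e \<Rightarrow> real) \<Rightarrow> (real \<Rightarrow> 'e \<Rightarrow> 'e) \<Rightarrow> bool" where
  "C0_contraction_semigroup S N T \<longleftrightarrow>
     (\<forall>t\<ge>0. T t ` S \<subseteq> S \<and> clinear_on S (T t) \<and> (\<forall>U\<in>S. N (T t U) \<le> N U)) \<and>
     (\<forall>U\<in>S. T 0 U = U) \<and>
     (\<forall>s\<ge>0. \<forall>t\<ge>0. \<forall>U\<in>S. T (s + t) U = T s (T t U)) \<and>
     (\<forall>U\<in>S. ((\<lambda>t. N (T t U - U)) \<longlongrightarrow> 0) (at_right 0))"

definition has_generator ::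
    "'e::complex_vector set \<Rightarrow> ('e \<Rightarrow> real) \<Rightarrow> (real \<Rightarrow> 'e \<Rightarrow> 'e) \<Rightarrow> 'e set \<Rightarrow> ('e \<Rightarrow> 'e) \<Rightarrow> bool" where
  "has_generator S N T G_dom G \<longleftrightarrow>
     (\<forall>U\<in>S. \<forall>V\<in>S. ((\<lambda>h. N ((1 / h) *\<^sub>R (T h U - U) - V)) \<longlongrightarrow> 0) (at_right 0)
                   \<longleftrightarrow> U \<in> G_dom \<and> V = G U)"

definition operator_norm_on :: "'e set \<Rightarrow> ('e \<Rightarrow> real) \<Rightarrow> ('e \<Rightarrow> 'e) \<Rightarrow> ennreal" where
  "operator_norm_on S N L = (SUP F\<in>{F \<in> S. N F \<le> 1}. ennreal (N (L F)))"

definition zero_in_resolvent_set ::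
    "'e set \<Rightarrow> ('e \<Rightarrow> real) \<Rightarrow> 'e set \<Rightarrow> ('e \<Rightarrow> 'e) \<Rightarrow> bool" where
  "zero_in_resolvent_set S N G_dom G \<longleftrightarrow>
     bij_betw G G_dom S \<and> operator_norm_on S N (inv_into G_dom G) < \<infinity>"

text \<open>
  The conjunct on the resolvent set makes the inverse of \<open>G\<close> meaningful.
\<close>

definition polynomially_stable ::
    "'e set \<Rightarrow> ('e \<Rightarrow> real) \<Rightarrow> (real \<Rightarrow> 'e \<Rightarrow> 'e) \<Rightarrow> 'e set \<Rightarrow> ('e \<Rightarrow> 'e) \<Rightarrow> real \<Rightarrow> bool" where
  "polynomially_stable S N T G_dom G k \<longleftrightarrow>
     k > 0 \<and> zero_in_resolvent_set S N G_dom G \<and>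
     (\<exists>C>0. \<forall>t>0. operator_norm_on S N (T t \<circ> inv_into G_dom G) \<le> ennreal (C * t powr (- k)))"


section \<open>The thermoelastic system of Cattaneo type\<close>

type_synonym 'h state = "'h \<times> 'h \<times> 'h \<times> 'h"

definition state_space :: "'h::chilbert_space set \<Rightarrow> ('h \<Rightarrow> 'h) \<Rightarrow> 'h state set" where
  "state_space D A = pow_dom D A (1/2) \<times> UNIV \<times> UNIV \<times> UNIV"

definition state_inner ::
    "'h::chilbert_space set \<Rightarrow> ('h \<Rightarrow> 'h) \<Rightarrow> real \<Rightarrow> real \<Rightarrow> 'h state \<Rightarrow> 'h state \<Rightarrow> complex" where
  "state_inner D A \<sigma> \<tau> = (\<lambda>(u\<^sub>1, v\<^sub>1, \<theta>\<^sub>1, q\<^sub>1) (u\<^sub>2, v\<^sub>2, \<theta>\<^sub>2, q\<^sub>2).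
     of_real \<sigma> * cinner (pow_op D A (1/2) u\<^sub>1) (pow_op D A (1/2) u\<^sub>2)
     + cinner v\<^sub>1 v\<^sub>2 + cinner \<theta>\<^sub>1 \<theta>\<^sub>2 + of_real \<tau> * cinner q\<^sub>1 q\<^sub>2)"

definition state_norm ::
    "'h::chilbert_space set \<Rightarrow> ('h \<Rightarrow> 'h) \<Rightarrow> real \<Rightarrow> real \<Rightarrow> 'h state \<Rightarrow> real" where
  "state_norm D A \<sigma> \<tau> U = sqrt (Re (state_inner D A \<sigma> \<tau> U U))"

text \<open>
  The second, third and fourth components of the system operator, up to the factor \<open>1/\<tau>\<close>, as
  elements of the scale: \<open>-\<sigma>Au + A\<^sup>\<alpha>\<theta>\<close>, \<open>-A\<^sup>\<alpha>v + A\<^sup>\<beta>\<^sup>/\<^sup>2q\<close> and \<open>-q - A\<^sup>\<beta>\<^sup>/\<^sup>2\<theta>\<close>.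
\<close>

definition momentum_part ::
    "'h::chilbert_space set \<Rightarrow> ('h \<Rightarrow> 'h) \<Rightarrow> real \<Rightarrow> real \<Rightarrow> 'h \<Rightarrow> 'h \<Rightarrow> (real \<Rightarrow> 'h)" where
  "momentum_part D A \<sigma> \<alpha> u \<theta> =
     (\<lambda>l. - (\<sigma> *\<^sub>R scale_pow 1 (components D A u) l) + scale_pow \<alpha> (components D A \<theta>) l)"

definition heat_part ::
    "'h::chilbert_space set \<Rightarrow> ('h \<Rightarrow> 'h) \<Rightarrow> real \<Rightarrow> real \<Rightarrow> 'h \<Rightarrow> 'h \<Rightarrow> (real \<Rightarrow> 'h)" where
  "heat_part D A \<alpha> \<beta> v q =
     (\<lambda>l. - scale_pow \<alpha> (components D A v) l + scale_pow (\<beta>/2) (components D A q) l)"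

definition flux_part ::
    "'h::chilbert_space set \<Rightarrow> ('h \<Rightarrow> 'h) \<Rightarrow> real \<Rightarrow> 'h \<Rightarrow> 'h \<Rightarrow> (real \<Rightarrow> 'h)" where
  "flux_part D A \<beta> \<theta> q =
     (\<lambda>l. - components D A q l - scale_pow (\<beta>/2) (components D A \<theta>) l)"

definition system_dom ::
    "'h::chilbert_space set \<Rightarrow> ('h \<Rightarrow> 'h) \<Rightarrow> real \<Rightarrow> real \<Rightarrow> real \<Rightarrow> 'h state set" where
  "system_dom D A \<sigma> \<alpha> \<beta> =
     {(u, v, \<theta>, q). (u, v, \<theta>, q) \<in> state_space D A \<and> v \<in> pow_dom D A (1/2) \<and>
        scale_in_H D A (momentum_part D A \<sigma> \<alpha> u \<theta>) \<and>
        scale_in_H D A (heat_part D A \<alpha> \<beta> v q) \<and>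
        scale_in_H D A (flux_part D A \<beta> \<theta> q)}"

definition system_op ::
    "'h::chilbert_space set \<Rightarrow> ('h \<Rightarrow> 'h) \<Rightarrow> real \<Rightarrow> real \<Rightarrow> real \<Rightarrow> real \<Rightarrow> 'h state \<Rightarrow> 'h state" where
  "system_op D A \<sigma> \<tau> \<alpha> \<beta> = (\<lambda>(u, v, \<theta>, q).
     (v,
      scale_to_H D A (momentum_part D A \<sigma> \<alpha> u \<theta>),
      scale_to_H D A (heat_part D A \<alpha> \<beta> v q),
      (1 / \<tau>) *\<^sub>R scale_to_H D A (flux_part D A \<beta> \<theta> q)))"


section \<open>Parameter regions\<close>

definition T1_star :: "(real \<times> real) set" where
  "T1_star = {(\<alpha>, \<beta>). 1/2 < \<alpha> \<and> \<alpha> < (\<beta> + 1) / 2 \<and> 0 < \<beta> \<and> \<beta> \<le> 1}"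

definition F12_star :: "(real \<times> real) set" where
  "F12_star = {(\<alpha>, \<beta>). \<alpha> = 1/2 \<and> 0 < \<beta> \<and> \<beta> < 1}"

definition F14_star :: "(real \<times> real) set" where
  "F14_star = {(\<alpha>, \<beta>). \<alpha> = (\<beta> + 1) / 2 \<and> 0 < \<beta> \<and> \<beta> \<le> 1}"

definition L124_star :: "(real \<times> real) set" where
  "L124_star = {(\<alpha>, \<beta>). \<alpha> = 1/2 \<and> \<beta> = 0}"

definition V1_star :: "(real \<times> real) set" where
  "V1_star = T1_star \<union> F12_star \<union> F14_star \<union> L124_star"

definition T2_star :: "(real \<times> real) set" where
  "T2_star = {(\<alpha>, \<beta>). 0 \<le> \<alpha> \<and> \<alpha> < 1/2 \<and> 0 < \<beta> \<and> \<beta> < 1}"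

definition F2_star :: "(real \<times> real) set" where
  "F2_star = {(\<alpha>, \<beta>). 0 \<le> \<alpha> \<and> \<alpha> < 1/2 \<and> \<beta> = 0}"

definition L23_star :: "(real \<times> real) set" where
  "L23_star = {(\<alpha>, \<beta>). 0 \<le> \<alpha> \<and> \<alpha> < 1/2 \<and> \<beta> = 1}"

definition V2_star :: "(real \<times> real) set" where
  "V2_star = T2_star \<union> F2_star \<union> L23_star"

end

theory Submission
  imports Defs
begin

text \<open>
  The system decouples over the eigenspaces of \<open>A\<close>. On the eigenspace of \<open>l\<close>, the pair of scaled
  displacement and temperature is rotated so that one component oscillates against the velocity
  with the high frequency \<open>r = (\<sigma>l + l\<^sup>2\<^sup>\<alpha>)\<^sup>1\<^sup>/\<^sup>2\<close>, while the other one and the flux are slow. A Lyapunov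
  functional shows that the slow part is damped at a rate bounded below, and the fast part at least
  at the rate \<open>y\<^sup>2\<close>, where \<open>y = l\<^sup>\<beta>\<^sup>/\<^sup>2 l\<^sup>\<alpha> / r\<^sup>2\<close>; but the energy of the fast part is bounded by
  \<open>r\<^sup>-\<^sup>2\<close> times that of \<open>\<A>U\<close>, up to the slow part. As \<open>y\<^sup>2 \<ge> c r\<^sup>-\<^sup>1\<^sup>/\<^sup>k\<close> with \<open>k\<close> the claimed order,
  interpolation gives the differential inequality \<open>L' \<le> -c L\<^sup>1\<^sup>+\<^sup>s K\<^sup>-\<^sup>s\<close>, \<open>s = 1/(2k)\<close>, for the
  Lyapunov functional, \<open>K\<close> being the energy of \<open>\<A>U(0)\<close>; hence \<open>L \<le> C t\<^sup>-\<^sup>2\<^sup>k K\<close> uniformly in \<open>l\<close>, and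
  Parseval's identity sums this over the spectrum.
\<close>

section \<open>Complex Hilbert spaces\<close>

text \<open>The obstacle is uniformity in \<open>l\<close>. In the original variables the couplings
  \<open>sqrt (\<sigma> * l)\<close>, \<open>l powr \<alpha>\<close> and
  \<open>l powr (\<beta>/2)\<close> scale with unrelated powers of \<open>l\<close>. After the
  rotation the estimates see only that \<open>r\<close> and the slow coupling
  \<open>a = l powr (\<beta>/2) * sqrt (\<sigma> * l) / r\<close> are bounded below, where
  \<open>2 * \<alpha> \<le> 1 + \<beta>\<close> enters, and that \<open>a / r\<close> and
  \<open>y\<close> are bounded above, where \<open>\<beta> \<le> 1\<close> enters. Comparing powers
  of \<open>l\<close> requires a spectrum bounded away from 0; positive definiteness is only strict
  positivity, so this gap comes from compactness of the resolvent.

  The two orders reflect which term dominates \<open>r^2\<close>. For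
  \<open>2 * \<alpha> \<ge> 1\<close> it is comparable to \<open>l powr (2 * \<alpha>)\<close>, so
  \<open>y^2\<close> behaves like \<open>l powr (\<beta> - 2 * \<alpha>)\<close>, a power
  \<open>- s\<close> of \<open>r^2\<close> with
  \<open>s = (2 * \<alpha> - \<beta>) / (2 * \<alpha>)\<close>. For \<open>2 * \<alpha> < 1\<close>
  it is comparable to \<open>l\<close>, and \<open>s = 2 - 2 * \<alpha> - \<beta>\<close>. Both
  times \<open>1 / (2 * s)\<close> is the claimed order.\<close>

lemma scaleR_eq_scaleC: "r *\<^sub>R x = complex_of_real r *\<^sub>C x"
  by (simp add: scaleC_of_real)

lemma scaleC_one [simp]: "1 *\<^sub>C x = x"
  using scaleC_of_real[of 1 x] by simp

lemma scaleC_zero_left [simp]: "0 *\<^sub>C x = 0"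
  using scaleC_of_real[of 0 x] by simp

lemma scaleC_zero_right [simp]: "c *\<^sub>C 0 = 0"
  using scaleC_scaleC[of c 0 0] by simp

lemma scaleC_minus_left: "(- c) *\<^sub>C x = - (c *\<^sub>C x)"
  using scaleC_add_left[of "- c" c x] by (simp add: eq_neg_iff_add_eq_0)

lemma scaleC_minus_right: "c *\<^sub>C (- x) = - (c *\<^sub>C x)"
  using scaleC_add_right[of c "- x" x] by (simp add: eq_neg_iff_add_eq_0)

lemma scaleC_diff_left: "(c - d) *\<^sub>C x = c *\<^sub>C x - d *\<^sub>C x"
  using scaleC_add_left[of c "- d" x] by (simp add: scaleC_minus_left)

lemma scaleC_diff_right: "c *\<^sub>C (x - y) = c *\<^sub>C x - c *\<^sub>C y"
  using scaleC_add_right[of c x "- y"] by (simp add: scaleC_minus_right)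

lemma scaleC_scaleR_commute: "c *\<^sub>C (r *\<^sub>R x) = r *\<^sub>R (c *\<^sub>C x)"
  by (simp add: scaleR_eq_scaleC scaleC_scaleC mult.commute)

lemma cinner_add_right: "cinner x (y + z) = cinner x y + cinner x z"
  by (metis cinner_add_left cinner_commute complex_cnj_add)

lemma cinner_scaleC_right: "cinner x (c *\<^sub>C y) = cnj c * cinner x y"
  by (metis cinner_scaleC_left cinner_commute complex_cnj_mult)

lemma cinner_zero_left [simp]: "cinner 0 x = 0"
  using cinner_add_left[of 0 0 x] by simp

lemma cinner_zero_right [simp]: "cinner x 0 = 0"
  using cinner_add_right[of x 0 0] by simp

lemma cinner_minus_left: "cinner (- x) y = - cinner x y"
  using cinner_add_left[of "- x" x y] by (simp add: eq_neg_iff_add_eq_0)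

lemma cinner_minus_right: "cinner x (- y) = - cinner x y"
  using cinner_add_right[of x "- y" y] by (simp add: eq_neg_iff_add_eq_0)

lemma cinner_diff_left: "cinner (x - y) z = cinner x z - cinner y z"
  using cinner_add_left[of x "- y" z] by (simp add: cinner_minus_left)

lemma cinner_diff_right: "cinner x (y - z) = cinner x y - cinner x z"
  using cinner_add_right[of x y "- z"] by (simp add: cinner_minus_right)

lemma cinner_scaleR_left: "cinner (r *\<^sub>R x) y = of_real r * cinner x y"
  by (simp add: scaleR_eq_scaleC cinner_scaleC_left)

lemma cinner_scaleR_right: "cinner x (r *\<^sub>R y) = of_real r * cinner x y"
  by (simp add: scaleR_eq_scaleC cinner_scaleC_right)

lemma cinner_sum_left: "cinner (sum f F) y = (\<Sum>i\<in>F. cinner (f i) y)"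
  by (induction F rule: infinite_finite_induct) (auto simp: cinner_add_left)

lemma cinner_self_eq_0: "cinner x x = 0 \<longleftrightarrow> x = 0"
  by (simp add: cinner_self)

lemma cinner_eq_zero_commute: "cinner x y = 0 \<longleftrightarrow> cinner y x = 0"
  by (metis cinner_commute complex_cnj_zero)

lemma Re_cinner_commute: "Re (cinner x y) = Re (cinner y x)"
  by (subst cinner_commute) simp

lemma norm_scaleC: "norm (c *\<^sub>C x) = cmod c * norm (x :: 'a::chilbert_space)"
proof -
  have "complex_of_real ((norm (c *\<^sub>C x))\<^sup>2) = c * cnj c * cinner x x"
    by (simp only: cinner_self[symmetric] cinner_scaleC_left cinner_scaleC_right) simp
  also have "\<dots> = complex_of_real ((cmod c * norm x)\<^sup>2)"
    by (simp only: complex_norm_square[symmetric] cinner_self of_real_mult power_mult_distrib of_real_power)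
  finally have "(norm (c *\<^sub>C x))\<^sup>2 = (cmod c * norm x)\<^sup>2"
    using of_real_eq_iff by blast
  then show ?thesis
    by (simp add: power2_eq_iff_nonneg)
qed

lemma norm_add_sq: "(norm (x + y))\<^sup>2 = (norm x)\<^sup>2 + 2 * Re (cinner x y) + (norm y)\<^sup>2"
proof -
  have "complex_of_real ((norm (x + y))\<^sup>2) =
      of_real ((norm x)\<^sup>2) + (cinner x y + cnj (cinner x y)) + of_real ((norm y)\<^sup>2)"
    by (simp only: cinner_self[symmetric] cinner_add_left cinner_add_right
        cinner_commute[of y x, symmetric] cinner_commute[of x y]) (simp add: algebra_simps)
  also have "\<dots> = of_real ((norm x)\<^sup>2 + 2 * Re (cinner x y) + (norm y)\<^sup>2)"
    by (simp add: complex_add_cnj)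
  finally show ?thesis
    using of_real_eq_iff by blast
qed

lemma norm_diff_sq: "(norm (x - y))\<^sup>2 = (norm x)\<^sup>2 - 2 * Re (cinner x y) + (norm y)\<^sup>2"
  using norm_add_sq[of x "- y"] by (simp add: cinner_minus_right)

lemma norm_add_sq_orthogonal:
  "cinner x y = 0 \<Longrightarrow> (norm (x + y))\<^sup>2 = (norm x)\<^sup>2 + (norm y)\<^sup>2"
  by (simp add: norm_add_sq)

lemma parallelogram:
  fixes x y :: "'a::chilbert_space"
  shows "(norm (x + y))\<^sup>2 + (norm (x - y))\<^sup>2 = 2 * (norm x)\<^sup>2 + 2 * (norm y)\<^sup>2"
  by (simp add: norm_add_sq norm_diff_sq)

section \<open>Cauchy-Schwarz and the real inner product\<close>

lemma Re_cinner_le: "Re (cinner x y) \<le> norm x * norm y"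
proof (cases "x = 0 \<or> y = 0")
  case False
  let ?a = "norm x" and ?b = "norm y"
  have "0 \<le> (norm (?b *\<^sub>R x - ?a *\<^sub>R y))\<^sup>2"
    by simp
  also have "\<dots> = 2 * (?a * ?b) * (?a * ?b - Re (cinner x y))"
    unfolding norm_diff_sq cinner_scaleR_left cinner_scaleR_right
    by (simp add: power_mult_distrib algebra_simps power2_eq_square)
  finally show ?thesis
    using False by (auto simp: zero_le_mult_iff mult_le_0_iff)
qed auto

lemma cmod_cinner_le: "cmod (cinner x y) \<le> norm x * norm y"
proof (cases "cinner x y = 0")
  case False
  let ?c = "cnj (sgn (cinner x y))"
  have "of_real (cmod (cinner x y)) = cinner (?c *\<^sub>C x) y"
    using False by (simp add: cinner_scaleC_left sgn_eq complex_norm_square[symmetric]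
        field_simps power2_eq_square)
  then have "cmod (cinner x y) = Re (cinner (?c *\<^sub>C x) y)"
    by (metis Re_complex_of_real)
  also have "\<dots> \<le> norm (?c *\<^sub>C x) * norm y"
    by (rule Re_cinner_le)
  also have "norm (?c *\<^sub>C x) = norm x"
    using False by (simp add: norm_scaleC norm_sgn)
  finally show ?thesis .
qed simp

lemma bounded_bilinear_cinner: "bounded_bilinear (cinner :: 'a::chilbert_space \<Rightarrow> 'a \<Rightarrow> complex)"
proof
  show "\<exists>K. \<forall>a b :: 'a. norm (cinner a b) \<le> norm a * norm b * K"
    by (rule exI[of _ 1]) (simp add: cmod_cinner_le)
qed (auto simp: cinner_add_left cinner_add_right cinner_scaleR_left cinner_scaleR_right scaleR_conv_of_real)

text \<open>The inner product of the underlying real Hilbert space. Being symmetric and real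
  bilinear, it lets energies and cross terms be differentiated by the product rule without
  conjugates.\<close>

definition rinner :: "'a::chilbert_space \<Rightarrow> 'a \<Rightarrow> real" where
  "rinner x y = Re (cinner x y)"

lemma rinner_add_left: "rinner (x + y) z = rinner x z + rinner y z"
  and rinner_add_right: "rinner x (y + z) = rinner x y + rinner x z"
  and rinner_diff_left: "rinner (x - y) z = rinner x z - rinner y z"
  and rinner_diff_right: "rinner x (y - z) = rinner x y - rinner x z"
  and rinner_scaleR_left: "rinner (c *\<^sub>R x) z = c * rinner x z"
  and rinner_scaleR_right: "rinner x (c *\<^sub>R z) = c * rinner x z"
  and rinner_self: "rinner x x = (norm x)\<^sup>2"
  and rinner_commute: "rinner x y = rinner y x"
  by (simp_all add: rinner_def cinner_add_left cinner_add_right cinner_diff_left cinner_diff_right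
      cinner_minus_left cinner_minus_right cinner_scaleR_left cinner_scaleR_right cinner_self
      Re_cinner_commute)

lemma abs_rinner_le: "\<bar>rinner x y\<bar> \<le> norm x * norm y"
  unfolding rinner_def using abs_Re_le_cmod cmod_cinner_le order_trans by blast

lemma bounded_bilinear_rinner: "bounded_bilinear (rinner :: 'a::chilbert_space \<Rightarrow> 'a \<Rightarrow> real)"
proof
  show "\<exists>K. \<forall>a b :: 'a. norm (rinner a b) \<le> norm a * norm b * K"
    by (rule exI[of _ 1]) (simp add: abs_rinner_le)
qed (auto simp: rinner_add_left rinner_add_right rinner_scaleR_left rinner_scaleR_right)

section \<open>Complex subspaces and linear maps on them\<close>

lemma csubspace_0: "csubspace S \<Longrightarrow> 0 \<in> S"
  and csubspace_add: "csubspace S \<Longrightarrow> x \<in> S \<Longrightarrow> y \<in> S \<Longrightarrow> x + y \<in> S"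
  and csubspace_scaleC: "csubspace S \<Longrightarrow> x \<in> S \<Longrightarrow> c *\<^sub>C x \<in> S"
  by (auto simp: csubspace_def)

lemma csubspace_scaleR: "csubspace S \<Longrightarrow> x \<in> S \<Longrightarrow> r *\<^sub>R x \<in> S"
  by (simp add: scaleR_eq_scaleC csubspace_scaleC)

lemma csubspace_diff: "csubspace S \<Longrightarrow> x \<in> S \<Longrightarrow> y \<in> S \<Longrightarrow> x - y \<in> S"
  using csubspace_add[of S x "(-1) *\<^sub>C y"] csubspace_scaleC[of S y "-1"]
  by (simp add: scaleC_minus_left)

lemma clinear_on_add: "clinear_on S f \<Longrightarrow> x \<in> S \<Longrightarrow> y \<in> S \<Longrightarrow> f (x + y) = f x + f y"
  and clinear_on_scaleC: "clinear_on S f \<Longrightarrow> x \<in> S \<Longrightarrow> f (c *\<^sub>C x) = c *\<^sub>C f x"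
  by (auto simp: clinear_on_def)

lemma clinear_on_scaleR: "clinear_on S f \<Longrightarrow> x \<in> S \<Longrightarrow> f (r *\<^sub>R x) = r *\<^sub>R f x"
  by (simp add: scaleR_eq_scaleC clinear_on_scaleC)

lemma clinear_on_diff:
  assumes "clinear_on S f" "csubspace S" "x \<in> S" "y \<in> S"
  shows "f (x - y) = f x - f y"
proof -
  have "f (x + (-1) *\<^sub>C y) = f x + (-1) *\<^sub>C f y"
    using assms by (simp only: clinear_on_add clinear_on_scaleC csubspace_scaleC)
  then show ?thesis by (simp add: scaleC_minus_left)
qed

text \<open>A minimising sequence for the distance is Cauchy by the parallelogram law.\<close>

lemma orthogonal_projection_exists:
  fixes x :: "'a::chilbert_space"
  assumes S: "csubspace S" "closed S"
  shows "\<exists>y\<in>S. \<forall>z\<in>S. cinner (x - y) z = 0"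
proof -
  define d where "d = (INF y\<in>S. (norm (x - y))\<^sup>2)"
  have ne: "S \<noteq> {}" using csubspace_0[OF S(1)] by auto
  have bdd: "bdd_below ((\<lambda>y. (norm (x - y))\<^sup>2) ` S)"
    by (rule bdd_belowI[of _ 0]) auto
  have dle: "d \<le> (norm (x - y))\<^sup>2" if "y \<in> S" for y
    unfolding d_def using bdd that by (rule cINF_lower)
  have "\<exists>y\<in>S. (norm (x - y))\<^sup>2 < d + 1 / real (Suc n)" for n
  proof (rule ccontr)
    assume "\<not> ?thesis"
    then have "d + 1 / real (Suc n) \<le> d"
      by (subst (2) d_def, intro cINF_greatest ne) (auto simp: not_less)
    then show False by simp
  qed
  then obtain y where yS: "\<And>n. y n \<in> S" and yd: "\<And>n. (norm (x - y n))\<^sup>2 < d + 1 / real (Suc n)"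
    by metis
  have close: "(norm (y m - y n))\<^sup>2 \<le> 2 / real (Suc m) + 2 / real (Suc n)" for m n
  proof -
    \<comment> \<open>The midpoint of \<open>y m\<close> and \<open>y n\<close> lies in
      \<open>S\<close>, so it is no closer to \<open>x\<close> than the infimum allows.\<close>
    have "d \<le> (norm (x - (1/2) *\<^sub>R (y m + y n)))\<^sup>2"
      by (intro dle csubspace_scaleR csubspace_add S yS)
    also have "x - (1/2) *\<^sub>R (y m + y n) = (1/2) *\<^sub>R ((x - y m) + (x - y n))"
      by (simp add: algebra_simps) (metis scaleR_add_left scaleR_one field_sum_of_halves)
    also have "(norm \<dots>)\<^sup>2 = (norm ((x - y m) + (x - y n)))\<^sup>2 / 4"
      by (simp add: power_divide)
    finally have "4 * d \<le> (norm ((x - y m) + (x - y n)))\<^sup>2" by simp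
    moreover have "(norm (y m - y n))\<^sup>2 = (norm ((x - y m) - (x - y n)))\<^sup>2"
      by (simp add: norm_minus_commute)
    ultimately show ?thesis
      using parallelogram[of "x - y m" "x - y n"] yd[of m] yd[of n] by linarith
  qed
  have "Cauchy y"
  proof (rule metric_CauchyI)
    fix e :: real assume "e > 0"
    then obtain M where M: "4 / real (Suc M) < e\<^sup>2"
      using reals_Archimedean[of "e\<^sup>2 / 4"] by (auto simp: field_simps)
    show "\<exists>M. \<forall>m\<ge>M. \<forall>n\<ge>M. dist (y m) (y n) < e"
    proof (intro exI allI impI)
      fix m n assume "M \<le> m" "M \<le> n"
      then have "2 / real (Suc m) \<le> 2 / real (Suc M)" "2 / real (Suc n) \<le> 2 / real (Suc M)"
        by (auto intro!: divide_left_mono)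
      then have "(norm (y m - y n))\<^sup>2 < e\<^sup>2"
        using close[of m n] M by simp
      then show "dist (y m) (y n) < e"
        using \<open>e > 0\<close> by (simp add: dist_norm power_less_imp_less_base)
    qed
  qed
  then obtain p where p: "y \<longlonglongrightarrow> p"
    using Cauchy_convergent_iff convergent_def by blast
  have pS: "p \<in> S"
    using closed_sequentially[OF S(2) _ p] yS by auto
  have "(\<lambda>n. (norm (x - y n))\<^sup>2) \<longlonglongrightarrow> (norm (x - p))\<^sup>2"
    by (intro tendsto_intros p)
  moreover have "(\<lambda>n. d + 1 / real (Suc n)) \<longlonglongrightarrow> d + 0"
    by (intro tendsto_add tendsto_const LIMSEQ_Suc[OF lim_1_over_n])
  ultimately have pd: "(norm (x - p))\<^sup>2 \<le> d"
    using LIMSEQ_le yd by (metis (no_types, lifting) add.right_neutral less_imp_le)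
  have "cinner (x - p) z = 0" if z: "z \<in> S" for z
  proof (cases "z = 0")
    case False
    \<comment> \<open>The multiple of \<open>z\<close> closest to \<open>x - p\<close>. Moving
      \<open>p\<close> by it lowers the squared distance by \<open>(cmod c * norm z)^2\<close>, so
      minimality forces \<open>c = 0\<close>.\<close>
    define c where "c = cinner (x - p) z / of_real ((norm z)\<^sup>2)"
    have "(norm (x - p))\<^sup>2 \<le> (norm (x - (p + c *\<^sub>C z)))\<^sup>2"
      using pd dle[OF csubspace_add[OF S(1) pS csubspace_scaleC[OF S(1) z, of c]]] by linarith
    also have "x - (p + c *\<^sub>C z) = (x - p) - c *\<^sub>C z" by simp
    also have "(norm \<dots>)\<^sup>2 = (norm (x - p))\<^sup>2 - 2 * Re (cnj c * cinner (x - p) z) + (cmod c * norm z)\<^sup>2"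
      by (simp only: norm_diff_sq cinner_scaleC_right norm_scaleC)
    also have "cnj c * cinner (x - p) z = of_real ((cmod c * norm z)\<^sup>2)"
    proof -
      have "cinner (x - p) z = c * of_real ((norm z)\<^sup>2)"
        using False by (simp add: c_def)
      then have "cnj c * cinner (x - p) z = (c * cnj c) * of_real ((norm z)\<^sup>2)" by simp
      also have "c * cnj c = of_real ((cmod c)\<^sup>2)" by (simp only: complex_norm_square)
      finally show ?thesis by (simp add: power_mult_distrib)
    qed
    finally have "(cmod c * norm z)\<^sup>2 \<le> 0" by simp
    then show ?thesis using False by (simp add: c_def)
  qed simp
  with pS show ?thesis by blast
qed

section \<open>Riesz representation and adjoints of bounded operators\<close>

lemma riesz_representation:
  fixes f :: "'a::chilbert_space \<Rightarrow> complex"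
  assumes add: "\<And>x y. f (x + y) = f x + f y" and scale: "\<And>c x. f (c *\<^sub>C x) = c * f x"
    and bdd: "\<And>x. cmod (f x) \<le> B * norm x"
  shows "\<exists>k. \<forall>x. f x = cinner x k"
proof (cases "\<forall>x. f x = 0")
  case True
  then show ?thesis by (intro exI[of _ 0]) simp
next
  case False
  then obtain x where x: "f x \<noteq> 0" by blast
  interpret f: bounded_linear f
    by (rule bounded_linear_intro[where K = B])
      (auto simp: add scale scaleR_eq_scaleC scaleR_conv_of_real mult.commute bdd)
  define S where "S = {x. f x = 0}"
  have "csubspace S" by (auto simp: S_def csubspace_def add scale f.zero)
  moreover have "closed S"
    unfolding S_def by (intro closed_Collect_eq continuous_intros f.continuous_on)
  ultimately obtain y where y: "y \<in> S" "\<And>z. z \<in> S \<Longrightarrow> cinner (x - y) z = 0"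
    using orthogonal_projection_exists by blast
  define e where "e = x - y"
  have fe: "f e \<noteq> 0" using x y(1) by (simp add: e_def f.diff S_def)
  then have e0: "e \<noteq> 0" by (auto simp: f.zero)
  have "f v = cinner v ((cnj (f e) / of_real ((norm e)\<^sup>2)) *\<^sub>C e)" for v
  proof -
    have "v - (f v / f e) *\<^sub>C e \<in> S"
      using fe by (simp add: S_def f.diff scale)
    then have "cinner (v - (f v / f e) *\<^sub>C e) e = 0"
      using y(2) by (simp add: e_def cinner_eq_zero_commute)
    then have "cinner v e = f v / f e * of_real ((norm e)\<^sup>2)"
      by (simp add: cinner_diff_left cinner_scaleC_left cinner_self)
    then show ?thesis
      using fe e0 by (simp add: cinner_scaleC_right)
  qed
  then show ?thesis by blast
qed

lemma bounded_operator_adjoint_exists: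
  fixes K :: "'a::chilbert_space \<Rightarrow> 'a"
  assumes "clinear_on UNIV K" and "\<And>x. norm (K x) \<le> B * norm x"
  shows "\<exists>K'. \<forall>x y. cinner (K x) y = cinner x (K' y)"
proof -
  have "\<exists>k. \<forall>x. cinner (K x) y = cinner x k" for y
  proof (rule riesz_representation)
    show "cmod (cinner (K x) y) \<le> (B * norm y) * norm x" for x
    proof -
      have "cmod (cinner (K x) y) \<le> norm (K x) * norm y" by (rule cmod_cinner_le)
      also have "\<dots> \<le> (B * norm x) * norm y" by (intro mult_right_mono assms) auto
      finally show ?thesis by (simp add: mult_ac)
    qed
  qed (use assms(1) in \<open>auto simp: clinear_on_def cinner_add_left cinner_scaleC_left\<close>)
  then show ?thesis by metis
qed


section \<open>Orthogonal series\<close>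

lemma norm_sum_sq_orthogonal:
  fixes f :: "'i \<Rightarrow> 'a::chilbert_space"
  assumes "finite F" "\<And>i j. i \<in> F \<Longrightarrow> j \<in> F \<Longrightarrow> i \<noteq> j \<Longrightarrow> cinner (f i) (f j) = 0"
  shows "(norm (sum f F))\<^sup>2 = (\<Sum>i\<in>F. (norm (f i))\<^sup>2)"
  using assms
proof (induction F rule: finite_induct)
  case (insert i F)
  have "cinner (f i) (sum f F) = 0"
    using insert.hyps insert.prems
    by (subst cinner_eq_zero_commute, subst cinner_sum_left) (auto intro!: sum.neutral)
  then show ?case
    using insert by (simp add: norm_add_sq_orthogonal)
qed simp

text \<open>The difference of two finite partial sums is, up to signs, a sum over the symmetric
  difference of the index sets. Pythagoras turns its norm into a sum of squares, so the net of
  partial sums is Cauchy.\<close>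

lemma orthogonal_summable:
  fixes f :: "'i \<Rightarrow> 'a::chilbert_space"
  assumes orth: "\<And>i j. i \<in> I \<Longrightarrow> j \<in> I \<Longrightarrow> i \<noteq> j \<Longrightarrow> cinner (f i) (f j) = 0"
    and summ: "(\<lambda>i. (norm (f i))\<^sup>2) summable_on I"
  shows "f summable_on I" and "(norm (infsum f I))\<^sup>2 = (\<Sum>\<^sub>\<infinity>i\<in>I. (norm (f i))\<^sup>2)"
proof -
  let ?g = "\<lambda>i. (norm (f i))\<^sup>2"
  define L where "L = infsum ?g I"
  have lim: "(sum ?g \<longlongrightarrow> L) (finite_subsets_at_top I)"
    unfolding L_def using has_sum_infsum[OF summ] by (simp add: has_sum_def)
  have "\<exists>P. eventually P (finite_subsets_at_top I) \<and>
              (\<forall>F F'. P F \<and> P F' \<longrightarrow> dist (sum f F) (sum f F') < e)" if "e > 0" for e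
  proof (intro exI conjI allI impI)
    let ?P = "\<lambda>F. finite F \<and> F \<subseteq> I \<and> L - e\<^sup>2 / 2 < sum ?g F"
    show "eventually ?P (finite_subsets_at_top I)"
      using order_tendstoD(1)[OF lim, of "L - e\<^sup>2 / 2"] that
      by (auto simp: eventually_conj_iff eventually_finite_subsets_at_top_weakI)
    fix F F' assume FF: "?P F \<and> ?P F'"
    have split: "sum f F - sum f F' = sum f (F - F') + sum (\<lambda>i. - f i) (F' - F)"
    proof -
      have "sum f F = sum f (F - F') + sum f (F \<inter> F')" "sum f F' = sum f (F' - F) + sum f (F \<inter> F')"
        using FF by (metis sum.Int_Diff add.commute, metis sum.Int_Diff add.commute Int_commute)
      then show ?thesis by (simp add: sum_negf)
    qed
    have "sum f (F - F') + sum (\<lambda>i. - f i) (F' - F)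
        = (\<Sum>i\<in>(F - F') \<union> (F' - F). if i \<in> F then f i else - f i)" (is "_ = sum ?h _")
    proof -
      have "sum ?h ((F - F') \<union> (F' - F)) = sum ?h (F - F') + sum ?h (F' - F)"
        using FF by (intro sum.union_disjoint) auto
      also have "sum ?h (F - F') = sum f (F - F')" by (intro sum.cong) auto
      also have "sum ?h (F' - F) = sum (\<lambda>i. - f i) (F' - F)" by (intro sum.cong) auto
      finally show ?thesis by simp
    qed
    then have "(norm (sum f F - sum f F'))\<^sup>2 = (\<Sum>i\<in>(F - F') \<union> (F' - F). (norm (?h i))\<^sup>2)"
      unfolding split using FF orth
      by (simp only:, intro norm_sum_sq_orthogonal)
        (auto simp: cinner_minus_left cinner_minus_right subset_iff)
    also have "\<dots> = sum ?g ((F - F') \<union> (F' - F))"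
      by (intro sum.cong) auto
    also have "\<dots> = sum ?g (F - F') + sum ?g (F' - F)"
      using FF by (intro sum.union_disjoint) auto
    \<comment> \<open>The sums over \<open>F\<close> and \<open>F'\<close> both exceed
      \<open>L - e^2 / 2\<close>, while the sum over the union is at most \<open>L\<close>; the
      total is therefore below \<open>e^2\<close>.\<close>
    also have "\<dots> = 2 * sum ?g (F \<union> F') - sum ?g F - sum ?g F'"
    proof -
      have "sum ?g (F \<union> F') = sum ?g (F - F') + sum ?g F'" "sum ?g (F \<union> F') = sum ?g (F' - F) + sum ?g F"
        using FF sum.union_disjoint[of "F - F'" F' ?g] sum.union_disjoint[of "F' - F" F ?g]
        by (auto simp: Un_commute)
      then show ?thesis by simp
    qed
    also have "sum ?g (F \<union> F') \<le> L"
      unfolding L_def using FF by (intro finite_sum_le_infsum summ) auto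
    finally have "(norm (sum f F - sum f F'))\<^sup>2 < e\<^sup>2"
      using FF by auto
    then show "dist (sum f F) (sum f F') < e"
      using that by (simp add: dist_norm power_less_imp_less_base)
  qed
  then have "cauchy_filter (filtermap (sum f) (finite_subsets_at_top I))"
    by (simp add: cauchy_filter_metric_filtermap)
  moreover have "complete (UNIV :: 'a set)"
    by (meson Cauchy_convergent UNIV_I complete_def convergent_def)
  ultimately obtain s where s: "(sum f \<longlongrightarrow> s) (finite_subsets_at_top I)"
    using complete_uniform[where S = UNIV] by (force simp add: filterlim_def)
  then have hs: "(f has_sum s) I"
    by (simp add: has_sum_def)
  then show "f summable_on I"
    using summable_on_def by blast
  have "((\<lambda>F. (norm (sum f F))\<^sup>2) \<longlongrightarrow> (norm s)\<^sup>2) (finite_subsets_at_top I)"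
    by (intro tendsto_intros s)
  moreover have "\<forall>\<^sub>F F in finite_subsets_at_top I. (norm (sum f F))\<^sup>2 = sum ?g F"
    using orth by (intro eventually_finite_subsets_at_top_weakI norm_sum_sq_orthogonal) auto
  ultimately have "(sum ?g \<longlongrightarrow> (norm s)\<^sup>2) (finite_subsets_at_top I)"
    using tendsto_cong by fast
  then show "(norm (infsum f I))\<^sup>2 = infsum ?g I"
    using tendsto_unique[OF _ lim] infsumI[OF hs] by (simp add: L_def)
qed


section \<open>The spectral theorem for positive operators with compact resolvent\<close>

lemma compact_operator_bounded:
  assumes "compact_operator (K :: 'a::chilbert_space \<Rightarrow> 'a)"
  shows "\<exists>B. \<forall>x. norm (K x) \<le> B * norm x"
proof -
  have lin: "clinear_on UNIV K" and "compact (closure (K ` cball 0 1))"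
    using assms by (auto simp: compact_operator_def)
  then have "bounded (K ` cball 0 1)"
    by (intro bounded_subset[OF compact_imp_bounded closure_subset])
  then obtain B where B: "\<And>x. norm x \<le> 1 \<Longrightarrow> norm (K x) \<le> B"
    unfolding bounded_iff by (metis image_eqI mem_cball_0)
  have "norm (K x) \<le> B * norm x" for x
  proof (cases "x = 0")
    case True
    then show ?thesis
      using clinear_on_scaleR[OF lin, of 0 0] by simp
  next
    case False
    have "norm (K ((1 / norm x) *\<^sub>R x)) \<le> B"
      using False by (intro B) simp
    then show ?thesis
      using False by (simp add: clinear_on_scaleR[OF lin] divide_simps mult.commute)
  qed
  then show ?thesis by blast
qed

lemma compact_operator_subsequence:
  assumes "compact_operator (K :: 'a::chilbert_space \<Rightarrow> 'a)" and "\<And>n. norm (x n) \<le> B"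
  shows "\<exists>l r. strict_mono (r :: nat \<Rightarrow> nat) \<and> (\<lambda>n. K (x (r n))) \<longlonglongrightarrow> l"
proof -
  have "bounded (range x)"
    using assms(2) by (auto simp: bounded_iff)
  then have "compact (closure (K ` range x))"
    using assms(1) by (auto simp: compact_operator_def)
  then have "seq_compact (closure (K ` range x))"
    by (rule compact_imp_seq_compact)
  moreover have "\<forall>n. (\<lambda>n. K (x n)) n \<in> closure (K ` range x)"
    by (simp add: closure_subset[THEN subsetD])
  ultimately obtain l r where "strict_mono (r :: nat \<Rightarrow> nat)" "((\<lambda>n. K (x n)) \<circ> r) \<longlonglongrightarrow> l"
    by (rule seq_compactE)
  then show ?thesis
    by (auto simp: o_def)
qed

locale positive_discrete_operator =
  fixes D :: "'h::chilbert_space set" and A :: "'h \<Rightarrow> 'h"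
  assumes sa: "self_adjoint D A" and pd: "positive_definite D A" and cr: "compact_resolvent D A"
begin

abbreviation "E \<equiv> eigenspace D A"
abbreviation "ev \<equiv> eigenvalues D A"
abbreviation "P \<equiv> spectral_proj D A"

section \<open>Eigenspaces and eigenvalues\<close>

lemma D_csubspace: "csubspace D" and A_linear: "clinear_on D A"
  and symmetric: "x \<in> D \<Longrightarrow> y \<in> D \<Longrightarrow> cinner (A x) y = cinner x (A y)"
  using sa by (auto simp: self_adjoint_def)

lemma adjointI:
  assumes "\<And>x. x \<in> D \<Longrightarrow> cinner (A x) y = cinner x z"
  shows "y \<in> D \<and> A y = z"
proof -
  have "(\<forall>x\<in>D. cinner (A x) y = cinner x z) \<longleftrightarrow> y \<in> D \<and> z = A y"
    using sa by (simp only: self_adjoint_def)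
  then show ?thesis using assms by simp
qed

lemma eigenspaceD: "x \<in> E l \<Longrightarrow> x \<in> D" "x \<in> E l \<Longrightarrow> A x = l *\<^sub>R x"
  by (auto simp: eigenspace_def)

text \<open>Self-adjointness replaces the unbounded equation \<open>A x = l *\<^sub>R x\<close> by
  scalar equations tested against \<open>D\<close>. Each of them is continuous in \<open>x\<close>,
  which is what makes the eigenspaces closed.\<close>

lemma eigenspace_eq: "E l = {x. \<forall>y\<in>D. cinner (A y) x = cinner y (l *\<^sub>R x)}"
proof (intro set_eqI iffI; clarsimp)
  fix x y assume "x \<in> E l" "y \<in> D"
  then show "cinner (A y) x = cinner y (l *\<^sub>R x)"
    by (simp add: symmetric eigenspace_def)
next
  fix x assume "\<forall>y\<in>D. cinner (A y) x = cinner y (l *\<^sub>R x)"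
  then show "x \<in> E l"
    using adjointI[of x "l *\<^sub>R x"] by (auto simp: eigenspace_def)
qed

lemma eigenspace_closed: "closed (E l)"
proof -
  have "E l = (\<Inter>y\<in>D. {x. cinner (A y) x = cinner y (l *\<^sub>R x)})"
    by (auto simp: eigenspace_eq)
  also have "closed \<dots>"
    by (intro closed_INT ballI closed_Collect_eq continuous_intros
        bounded_bilinear.continuous_on[OF bounded_bilinear_cinner])
  finally show ?thesis .
qed

lemma eigenspace_csubspace: "csubspace (E l)"
proof -
  have "A 0 = 0"
    using clinear_on_scaleR[OF A_linear csubspace_0[OF D_csubspace], of 0] by simp
  then show ?thesis
    using D_csubspace A_linear
    by (auto simp: csubspace_def eigenspace_def clinear_on_def scaleC_scaleR_commute scaleR_add_right)
qed

lemma eigenspace_orthogonal: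
  assumes "x \<in> E l" "y \<in> E m" "l \<noteq> m"
  shows "cinner x y = 0"
proof -
  have "of_real l * cinner x y = of_real m * cinner x y"
    using symmetric[of x y] assms
    by (simp add: eigenspace_def cinner_scaleR_left cinner_scaleR_right)
  then show ?thesis using assms(3) by simp
qed

lemma kernel_trivial: "x \<in> D \<Longrightarrow> A x = 0 \<Longrightarrow> x = 0"
  using pd unfolding positive_definite_def by (metis cinner_zero_left less_irrefl zero_complex.simps(1))

lemma eigenvector_exists: "l \<in> ev \<Longrightarrow> \<exists>x. x \<in> E l \<and> norm x = 1"
proof -
  assume "l \<in> ev"
  then obtain x where "x \<in> E l" "x \<noteq> 0"
    using csubspace_0[OF eigenspace_csubspace, of l] by (auto simp: eigenvalues_def)
  then show ?thesis
    using csubspace_scaleR[OF eigenspace_csubspace, of x l "1 / norm x"]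
    by (intro exI[of _ "(1 / norm x) *\<^sub>R x"]) auto
qed

lemma eigenvalue_pos:
  assumes "l \<in> ev"
  shows "l > 0"
proof -
  obtain x where x: "x \<in> E l" "norm x = 1"
    using eigenvector_exists[OF assms] by blast
  then have "x \<noteq> 0" by auto
  then have "Re (cinner (A x) x) > 0"
    using pd x by (auto simp: positive_definite_def eigenspace_def)
  then show ?thesis
    using x by (simp add: eigenspaceD cinner_scaleR_left cinner_self)
qed

lemma not_eigenvalue: "l \<notin> ev \<Longrightarrow> x \<in> E l \<Longrightarrow> x = 0"
  by (simp add: eigenvalues_def)

section \<open>The compact resolvent, totality of the eigenvectors and the spectral gap\<close>

text \<open>Nothing is known about the resolvent point \<open>z\<close>; it may be non-real, and
  then \<open>K\<close> is not self-adjoint. This is why the search for eigenvectors below goes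
  through the composition of \<open>K\<close> with its adjoint.\<close>

lemma resolvent_exists:
  "\<exists>z K B. compact_operator K \<and> clinear_on UNIV K \<and> bounded_linear K \<and> (\<forall>f. K f \<in> D) \<and>
    (\<forall>f. A (K f) = z *\<^sub>C K f - f) \<and> (\<forall>x\<in>D. K (z *\<^sub>C x - A x) = x) \<and>
    (\<forall>x. norm (K x) \<le> B * norm x)"
proof -
  obtain z where bij: "bij_betw (\<lambda>x. z *\<^sub>C x - A x) D UNIV"
    and K: "compact_operator (inv_into D (\<lambda>x. z *\<^sub>C x - A x))" (is "compact_operator ?K")
    using cr by (auto simp: compact_resolvent_def)
  obtain B where B: "\<And>x. norm (?K x) \<le> B * norm x"
    using compact_operator_bounded[OF K] by blast
  have lin: "clinear_on UNIV ?K"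
    using K by (simp add: compact_operator_def)
  have swap: "a - b = c \<Longrightarrow> b = a - c" for a b c :: 'h
    by auto
  have 1: "A (?K f) = z *\<^sub>C ?K f - f" for f
    by (rule swap) (rule bij_betw_inv_into_right[OF bij UNIV_I])
  have "?K f \<in> D" for f
    by (rule inv_into_into) (simp add: bij_betw_imp_surj_on[OF bij])
  moreover have "?K (z *\<^sub>C x - A x) = x" if "x \<in> D" for x
    using bij_betw_inv_into_left[OF bij that] .
  moreover have "bounded_linear ?K"
    by (rule bounded_linear_intro[where K = B])
      (use lin B in \<open>auto simp: clinear_on_add clinear_on_scaleR mult.commute\<close>)
  ultimately show ?thesis
    using K lin 1 B by blast
qed

text \<open>
  A maximiser \<open>x\<close> of \<open>\<parallel>Kx\<parallel>\<close> over unit vectors orthogonal to all eigenvectors, \<open>K = (z - A)\<^sup>-\<^sup>1\<close>,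
  satisfies \<open>K\<^sup>*Kx = s\<^sup>2x\<close>, that is \<open>(A - Re z)\<^sup>2x = \<kappa>\<^sup>2x\<close>; factoring this produces an
  eigenvector in the span of \<open>x\<close> and \<open>Kx\<close>.
\<close>

lemma eigenvectors_total:
  assumes "\<And>l e. e \<in> E l \<Longrightarrow> cinner x0 e = 0"
  shows "x0 = 0"
proof (rule ccontr)
  assume x0: "x0 \<noteq> 0"
  define V where "V = {x. \<forall>l. \<forall>e\<in>E l. cinner x e = 0}"
  have V_sub: "csubspace V"
    by (auto simp: V_def csubspace_def cinner_add_left cinner_scaleC_left)
  have V_closed: "closed V"
  proof -
    have "V = (\<Inter>l. \<Inter>e\<in>E l. {x. cinner x e = 0})" by (auto simp: V_def)
    also have "closed \<dots>"
      by (intro closed_INT ballI closed_Collect_eq continuous_intros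
        bounded_bilinear.continuous_on[OF bounded_bilinear_cinner])
    finally show ?thesis .
  qed
  have VE: "x = 0" if "x \<in> V" "x \<in> E l" for x l
    using that cinner_self_eq_0 by (auto simp: V_def)
  obtain z K B where K: "compact_operator K" "clinear_on UNIV K" "bounded_linear K"
    "\<And>f. K f \<in> D" "\<And>f. A (K f) = z *\<^sub>C K f - f" "\<And>x. x \<in> D \<Longrightarrow> K (z *\<^sub>C x - A x) = x"
    "\<And>x. norm (K x) \<le> B * norm x"
    using resolvent_exists by blast
  interpret K: bounded_linear K by (rule K(3))
  have K_eig: "e = (z - of_real l) *\<^sub>C K e" if "e \<in> E l" for e l
  proof -
    have "K (z *\<^sub>C e - A e) = e" using that K(6) eigenspaceD(1) by blast
    also have "z *\<^sub>C e - A e = (z - of_real l) *\<^sub>C e"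
      using that by (simp add: eigenspaceD scaleC_diff_left scaleC_of_real)
    finally show ?thesis
      using clinear_on_scaleC[OF K(2), of e] by simp
  qed
  have KV: "K f \<in> V" if "f \<in> V" for f
  proof -
    have "cinner (K f) e = 0" if e: "e \<in> E l" for e l
    proof (cases "z = of_real l")
      case True
      then show ?thesis using K_eig[OF e] by simp
    next
      case False
      have "f = z *\<^sub>C K f - A (K f)" using K(5)[of f] by simp
      then have "cinner f e = z * cinner (K f) e - cinner (K f) (A e)"
        using symmetric[OF K(4) eigenspaceD(1)[OF e]]
        by (metis cinner_diff_left cinner_scaleC_left)
      then have "cinner f e = (z - of_real l) * cinner (K f) e"
        using e by (simp add: eigenspaceD cinner_scaleR_right algebra_simps)
      moreover have "cinner f e = 0" using \<open>f \<in> V\<close> e by (auto simp: V_def)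
      ultimately show ?thesis using False by simp
    qed
    then show ?thesis by (auto simp: V_def)
  qed
  obtain K' where K': "\<And>x y. cinner (K x) y = cinner x (K' y)"
    using bounded_operator_adjoint_exists[OF K(2,7)] by blast
  have K'V: "K' f \<in> V" if f: "f \<in> V" for f
  proof -
    have "cinner e (K' f) = 0" if e: "e \<in> E l" for e l
    proof (cases "z = of_real l")
      case True
      then show ?thesis using K_eig[OF e] by simp
    next
      case False
      have "cinner e f = (z - of_real l) * cinner (K e) f"
        using K_eig[OF e] by (metis cinner_scaleC_left)
      moreover have "cinner e f = 0" using f e by (auto simp: V_def cinner_eq_zero_commute)
      ultimately show ?thesis using False K' by simp
    qed
    then show ?thesis by (auto simp: V_def cinner_eq_zero_commute)
  qed
  \<comment> \<open>The adjoint of the resolvent at \<open>z\<close> is the resolvent at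
    \<open>cnj z\<close>. That \<open>K' y\<close> lies in \<open>D\<close> at all is read off from
    the adjoint graph of \<open>A\<close>.\<close>
  have K'D: "K' y \<in> D \<and> A (K' y) = cnj z *\<^sub>C K' y - y" for y
  proof (rule adjointI)
    fix x assume "x \<in> D"
    then have "cinner x y = cinner (z *\<^sub>C x - A x) (K' y)"
      using K' K(6) by metis
    then show "cinner (A x) (K' y) = cinner x (cnj z *\<^sub>C K' y - y)"
      by (simp add: cinner_diff_left cinner_diff_right cinner_scaleC_left cinner_scaleC_right)
  qed

  define X where "X = {x \<in> V. norm x = 1}"
  define s where "s = (SUP x\<in>X. norm (K x))"
  have X_ne: "X \<noteq> {}"
  proof -
    have "x0 \<in> V" using assms by (auto simp: V_def)
    then have "(1 / norm x0) *\<^sub>R x0 \<in> X"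
      using x0 csubspace_scaleR[OF V_sub] by (auto simp: X_def)
    then show ?thesis by auto
  qed
  have bdd: "bdd_above ((\<lambda>x. norm (K x)) ` X)"
  proof (rule bdd_aboveI, clarify)
    fix x assume "x \<in> X"
    then show "norm (K x) \<le> B" using K(7)[of x] by (simp add: X_def)
  qed
  have s_pos: "s > 0"
  proof -
    obtain x where x: "x \<in> X" using X_ne by blast
    have "A 0 = 0"
      using clinear_on_scaleR[OF A_linear csubspace_0[OF D_csubspace], of 0] by simp
    moreover have "x \<noteq> 0" using x by (auto simp: X_def)
    ultimately have "K x \<noteq> 0" using K(5)[of x] by auto
    then have "0 < norm (K x)" by simp
    also have "\<dots> \<le> s" unfolding s_def by (rule cSUP_upper[OF x bdd])
    finally show ?thesis .
  qed
  have Ks: "norm (K u) \<le> s * norm u" if u: "u \<in> V" for u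
  proof (cases "u = 0")
    case False
    have "(1 / norm u) *\<^sub>R u \<in> X"
      using False u csubspace_scaleR[OF V_sub] by (auto simp: X_def)
    then have "norm (K ((1 / norm u) *\<^sub>R u)) \<le> s"
      unfolding s_def by (rule cSUP_upper[OF _ bdd])
    then show ?thesis using False by (simp add: K.scaleR divide_simps mult.commute)
  qed simp
  have K's: "norm (K' u) \<le> s * norm u" if u: "u \<in> V" for u
  proof (cases "K' u = 0")
    case False
    have "complex_of_real ((norm (K' u))\<^sup>2) = cinner (K (K' u)) u"
      by (simp add: K' cinner_self)
    then have "(norm (K' u))\<^sup>2 = Re (cinner (K (K' u)) u)"
      by (metis Re_complex_of_real)
    also have "\<dots> \<le> norm (K (K' u)) * norm u" by (rule Re_cinner_le)
    also have "\<dots> \<le> (s * norm (K' u)) * norm u" by (intro mult_right_mono Ks K'V u) simp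
    finally show ?thesis using False by (simp add: power2_eq_square)
  qed (use s_pos in simp)

  have "\<exists>x\<in>X. s - 1 / real (Suc n) < norm (K x)" for n
    using less_cSUP_iff[OF X_ne bdd, of "s - 1 / real (Suc n)"] by (simp add: s_def)
  then obtain xs where xs: "\<And>n. xs n \<in> X" "\<And>n. s - 1 / real (Suc n) < norm (K (xs n))"
    by metis
  obtain y r where r: "strict_mono r" and y: "(\<lambda>n. K (xs (r n))) \<longlonglongrightarrow> y"
    using compact_operator_subsequence[OF K(1), of xs 1] xs(1) by (auto simp: X_def)
  have lims: "(\<lambda>n. norm (K (xs n))) \<longlonglongrightarrow> s"
  proof (rule tendsto_sandwich)
    show "(\<lambda>n. s - 1 / real (Suc n)) \<longlonglongrightarrow> s"
      using tendsto_diff[OF tendsto_const LIMSEQ_Suc[OF lim_1_over_n], of s] by simp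
    show "\<forall>\<^sub>F n in sequentially. s - 1 / real (Suc n) \<le> norm (K (xs n))"
      using xs(2) by (intro always_eventually allI less_imp_le)
    show "\<forall>\<^sub>F n in sequentially. norm (K (xs n)) \<le> s"
      using xs(1) by (intro always_eventually allI) (auto simp: s_def intro!: cSUP_upper bdd)
  qed auto
  \<comment> \<open>Expanding the square gives
    \<open>norm (K' (K u))^2 - 2 * s^2 * norm (K u)^2 + s^4\<close>, whose first term is at most
    \<open>s^2 * norm (K u)^2\<close>. Hence near-maximisers of \<open>norm (K u)\<close> are
    approximate eigenvectors of \<open>K'\<close> after \<open>K\<close>.\<close>
  have defect: "(norm (K' (K u) - s\<^sup>2 *\<^sub>R u))\<^sup>2 \<le> s\<^sup>2 * (s\<^sup>2 - (norm (K u))\<^sup>2)" if u: "u \<in> X" for u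
  proof -
    have "(norm (K' (K u)))\<^sup>2 \<le> (s * norm (K u))\<^sup>2"
      using u by (intro power_mono K's KV) (auto simp: X_def)
    moreover have "Re (cinner (K' (K u)) (s\<^sup>2 *\<^sub>R u)) = s\<^sup>2 * (norm (K u))\<^sup>2"
    proof -
      have "cinner (K' (K u)) u = cnj (cinner (K u) (K u))"
        by (subst K', subst cinner_commute) simp
      then show ?thesis by (simp add: cinner_scaleR_right cinner_self del: of_real_power)
    qed
    ultimately show ?thesis
      unfolding norm_diff_sq using u
      by (simp add: X_def power_mult_distrib algebra_simps power2_eq_square)
  qed
  have "(\<lambda>n. K' (K (xs n)) - s\<^sup>2 *\<^sub>R xs n) \<longlonglongrightarrow> 0"
  proof -
    have "(\<lambda>n. s\<^sup>2 * (s\<^sup>2 - (norm (K (xs n)))\<^sup>2)) \<longlonglongrightarrow> s\<^sup>2 * (s\<^sup>2 - s\<^sup>2)"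
      by (intro tendsto_intros lims)
    then have 0: "(\<lambda>n. s\<^sup>2 * (s\<^sup>2 - (norm (K (xs n)))\<^sup>2)) \<longlonglongrightarrow> 0"
      by simp
    have "(\<lambda>n. (norm (K' (K (xs n)) - s\<^sup>2 *\<^sub>R xs n))\<^sup>2) \<longlonglongrightarrow> 0"
      by (rule tendsto_sandwich[OF always_eventually always_eventually tendsto_const 0])
        (simp_all only: defect[OF xs(1)] zero_le_power2 simp_thms)
    then have "(\<lambda>n. sqrt ((norm (K' (K (xs n)) - s\<^sup>2 *\<^sub>R xs n))\<^sup>2)) \<longlonglongrightarrow> sqrt 0"
      by (rule tendsto_real_sqrt)
    then show ?thesis by (simp add: tendsto_norm_zero_iff)
  qed
  then have def_lim: "(\<lambda>n. K' (K (xs (r n))) - s\<^sup>2 *\<^sub>R xs (r n)) \<longlonglongrightarrow> 0"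
    using LIMSEQ_subseq_LIMSEQ[OF _ r] by (auto simp: o_def)
  have yV: "y \<in> V"
    using closed_sequentially[OF V_closed _ y] KV xs(1) by (auto simp: X_def)
  have K'y: "(\<lambda>n. K' (K (xs (r n)))) \<longlonglongrightarrow> K' y"
  proof -
    have K'diff: "K' (u - v) = K' u - K' v" for u v
    proof -
      have "cinner w (K' (u - v) - (K' u - K' v)) = 0" for w
        by (simp add: cinner_diff_right K'[symmetric])
      from this[of "K' (u - v) - (K' u - K' v)"] show ?thesis
        by (simp add: cinner_self_eq_0)
    qed
    have "(\<lambda>n. norm (K (xs (r n)) - y)) \<longlonglongrightarrow> 0"
      by (intro tendsto_norm_zero LIM_zero y)
    then have lim: "(\<lambda>n. s * norm (K (xs (r n)) - y)) \<longlonglongrightarrow> 0"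
      by (rule tendsto_mult_right_zero)
    have le: "norm (K' (K (xs (r n))) - K' y) \<le> s * norm (K (xs (r n)) - y)" for n
    proof -
      have "K (xs (r n)) \<in> V" using xs(1)[of "r n"] by (intro KV) (simp add: X_def)
      then show ?thesis
        unfolding K'diff[symmetric] by (intro K's csubspace_diff V_sub yV)
    qed
    have "(\<lambda>n. K' (K (xs (r n))) - K' y) \<longlonglongrightarrow> 0"
      by (rule Lim_null_comparison[OF always_eventually[OF allI[OF le]] lim])
    then show ?thesis by (rule LIM_zero_cancel)
  qed
  define x where "x = (1 / s\<^sup>2) *\<^sub>R K' y"
  \<comment> \<open>Compactness only makes \<open>K (xs (r n))\<close> converge. The vectors
    themselves converge because \<open>s^2\<close> times them differs from
    \<open>K' (K (xs (r n)))\<close> by the vanishing defect.\<close>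
  have xlim: "(\<lambda>n. xs (r n)) \<longlonglongrightarrow> x"
  proof -
    have "(\<lambda>n. (1 / s\<^sup>2) *\<^sub>R (K' (K (xs (r n))) - (K' (K (xs (r n))) - s\<^sup>2 *\<^sub>R xs (r n))))
        \<longlonglongrightarrow> (1 / s\<^sup>2) *\<^sub>R (K' y - 0)"
      by (intro tendsto_intros K'y def_lim)
    then show ?thesis using s_pos by (simp add: x_def)
  qed
  have "norm x = 1"
    using LIMSEQ_unique[OF tendsto_norm[OF xlim]] xs(1) by (auto simp: X_def)
  have xV: "x \<in> V"
    using closed_sequentially[OF V_closed _ xlim] xs(1) by (auto simp: X_def)
  have yx: "y = K x"
    using LIMSEQ_unique[OF y K.tendsto[OF xlim]] .
  define a b p where "a = Re z" and "b = Im z" and "p = 1 / s\<^sup>2"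
  have z: "z = Complex a b" by (simp add: a_def b_def)
  have xD: "x \<in> D"
    unfolding x_def using K'D by (intro csubspace_scaleR D_csubspace) blast
  have yD: "y \<in> D"
    unfolding yx by (rule K(4))
  have Ax: "A x = cnj z *\<^sub>C x - p *\<^sub>R y"
  proof -
    have "A x = p *\<^sub>R (cnj z *\<^sub>C K' y - y)"
      using K'D[of y] clinear_on_scaleR[OF A_linear, of "K' y" p] by (simp add: x_def p_def)
    then show ?thesis
      by (simp add: x_def p_def scaleR_diff_right scaleC_scaleR_commute)
  qed
  have Ay: "A y = z *\<^sub>C y - x"
    using K(5)[of x] by (simp only: yx[symmetric])
  \<comment> \<open>By \<open>Ax\<close> and \<open>Ay\<close>, the operator \<open>A - a\<close>
    acts on the span of \<open>x\<close> and \<open>y\<close> through a trace-free 2 by 2 matrix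
    with determinant \<open>b^2 - p\<close>, so its square is multiplication by
    \<open>p - b^2\<close>.\<close>
  define g where "g = A x - a *\<^sub>R x"
  have g_eq: "g = (- \<i> * of_real b) *\<^sub>C x - p *\<^sub>R y"
  proof -
    have "- \<i> * of_real b = cnj z - of_real a" by (simp add: z complex_eq_iff)
    then show ?thesis
      by (simp only: g_def Ax scaleC_diff_left scaleC_of_real) simp
  qed
  have gD: "g \<in> D"
    unfolding g_eq by (intro csubspace_diff csubspace_scaleC csubspace_scaleR D_csubspace xD yD)
  have gV: "g \<in> V"
    unfolding g_eq by (intro csubspace_diff csubspace_scaleC csubspace_scaleR V_sub xV yV)
  have Ag: "A g - a *\<^sub>R g = (p - b\<^sup>2) *\<^sub>R x"
  proof -
    have "A g = (- \<i> * of_real b) *\<^sub>C A x - p *\<^sub>R A y"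
      unfolding g_eq
      by (simp only: clinear_on_diff[OF A_linear D_csubspace] clinear_on_scaleC[OF A_linear]
          clinear_on_scaleR[OF A_linear] csubspace_scaleC csubspace_scaleR D_csubspace xD yD)
    then have "A g - a *\<^sub>R g =
       ((- \<i> * of_real b) * cnj z - of_real a * (- \<i> * of_real b) + of_real p) *\<^sub>C x
       + ((- \<i> * of_real b) * (- of_real p) - of_real p * z + of_real a * of_real p) *\<^sub>C y"
      unfolding Ax Ay g_eq scaleR_eq_scaleC
      by (simp only: scaleC_diff_right scaleC_diff_left scaleC_add_left scaleC_scaleC)
        (simp add: scaleC_minus_left)
    also have "(- \<i> * of_real b) * cnj z - of_real a * (- \<i> * of_real b) + of_real p = of_real (p - b\<^sup>2)"
      by (simp add: Complex_eq z complex_eq_iff power2_eq_square algebra_simps)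
    also have "(- \<i> * of_real b) * (- of_real p) - of_real p * z + of_real a * of_real p = 0"
      by (simp add: z complex_eq_iff)
    finally show ?thesis by (simp add: scaleR_eq_scaleC)
  qed
  \<comment> \<open>Symmetry moves one factor \<open>A - a\<close> across the inner product:
    \<open>p - b^2\<close> equals \<open>(norm g)^2\<close>. So it has a real square root and can be
    split into real eigenvalue equations.\<close>
  have "p - b\<^sup>2 \<ge> 0"
  proof -
    have "cinner g g = cinner (A g - a *\<^sub>R g) x"
      using symmetric[OF gD xD]
      by (subst (2) g_def) (simp add: cinner_diff_left cinner_diff_right cinner_scaleR_left cinner_scaleR_right)
    then have "complex_of_real ((norm g)\<^sup>2) = of_real (p - b\<^sup>2)"
      unfolding Ag using \<open>norm x = 1\<close> by (simp only: cinner_scaleR_left cinner_self) simp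
    then have "(norm g)\<^sup>2 = p - b\<^sup>2" using of_real_eq_iff by blast
    then show ?thesis by (metis zero_le_power2)
  qed
  define k where "k = sqrt (p - b\<^sup>2)"
  have k2: "p - b\<^sup>2 = k * k" using \<open>p - b\<^sup>2 \<ge> 0\<close> by (simp add: k_def)
  \<comment> \<open>Factor \<open>(A - a)^2 - k^2\<close>: the vector \<open>w\<close> is
    \<open>A - a + k\<close> applied to \<open>x\<close>, and \<open>A - a - k\<close> kills it.
    Either \<open>w\<close> is an eigenvector in \<open>V\<close>, or \<open>w = 0\<close> and
    \<open>x\<close> is one; \<open>V\<close> contains neither.\<close>
  define w where "w = g + k *\<^sub>R x"
  have wD: "w \<in> D" and wV: "w \<in> V"
    unfolding w_def by (intro csubspace_add csubspace_scaleR D_csubspace V_sub xD gD xV gV)+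
  have "A w = A g + k *\<^sub>R A x"
    unfolding w_def
    by (simp only: clinear_on_add[OF A_linear] clinear_on_scaleR[OF A_linear] csubspace_scaleR D_csubspace xD gD)
  also have "A g = a *\<^sub>R g + (k * k) *\<^sub>R x" using Ag k2 by (simp add: algebra_simps)
  also have "A x = g + a *\<^sub>R x" by (simp add: g_def)
  finally have "A w = (a + k) *\<^sub>R w"
    by (simp add: w_def algebra_simps)
  then have "w = 0"
    using VE[of w "a + k"] wV wD by (auto simp: eigenspace_def)
  then have "A x = (a - k) *\<^sub>R x"
    by (simp add: w_def g_def algebra_simps)
  then have "x = 0"
    using VE[of x "a - k"] xV xD by (auto simp: eigenspace_def)
  then show False using \<open>norm x = 1\<close> by simp
qed

text \<open>\<open>positive_definite\<close> excludes the eigenvalue 0 but not eigenvalues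
  accumulating there. Compactness does: unit eigenvectors for eigenvalues tending to 0 would
  subconverge to a unit vector in the kernel of \<open>A\<close>.\<close>

lemma eigenvalues_bounded_below: "\<exists>m>0. \<forall>l\<in>ev. m \<le> l"
proof (rule ccontr)
  assume "\<not> ?thesis"
  then have neg: "\<forall>m>0. \<exists>l\<in>ev. l < m"
    by (meson not_le)
  have "\<exists>l e. l \<in> ev \<and> l < 1 / real (Suc n) \<and> e \<in> E l \<and> norm e = 1" for n
    using neg[rule_format, of "1 / real (Suc n)"] eigenvector_exists by fastforce
  then obtain l e where l: "\<And>n. l n \<in> ev" "\<And>n. l n < 1 / real (Suc n)"
    and e: "\<And>n. e n \<in> E (l n)" "\<And>n. norm (e n) = 1"
    by metis
  have l0: "l \<longlonglongrightarrow> 0"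
  proof (rule tendsto_sandwich[where f = "\<lambda>_. 0"])
    show "(\<lambda>n. 1 / real (Suc n)) \<longlonglongrightarrow> 0" by (rule LIMSEQ_Suc[OF lim_1_over_n])
    show "\<forall>\<^sub>F n in sequentially. 0 \<le> l n" using eigenvalue_pos l(1) by (simp add: less_imp_le)
    show "\<forall>\<^sub>F n in sequentially. l n \<le> 1 / real (Suc n)"
      using l(2) by (intro always_eventually allI less_imp_le)
  qed auto
  obtain z K B where K: "compact_operator K" "clinear_on UNIV K" "bounded_linear K"
    "\<And>f. K f \<in> D" "\<And>f. A (K f) = z *\<^sub>C K f - f" "\<And>x. x \<in> D \<Longrightarrow> K (z *\<^sub>C x - A x) = x"
    "\<And>x. norm (K x) \<le> B * norm x"
    using resolvent_exists by blast
  interpret K: bounded_linear K by (rule K(3))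
  obtain k r where r: "strict_mono r" and k: "(\<lambda>n. K (e (r n))) \<longlonglongrightarrow> k"
    using compact_operator_subsequence[OF K(1), of e 1] e(2) by auto
  \<comment> \<open>The eigenvalue equation recovers \<open>e n\<close> from \<open>K (e n)\<close>,
    so convergence of the latter along a subsequence carries over to the eigenvectors.\<close>
  have eK: "e n = z *\<^sub>C K (e n) - l n *\<^sub>R K (e n)" for n
  proof -
    have "e n = K (z *\<^sub>C e n - A (e n))" using K(6)[OF eigenspaceD(1)[OF e(1)]] by simp
    also have "A (e n) = l n *\<^sub>R e n" using e(1) by (simp add: eigenspaceD)
    finally show ?thesis
      using clinear_on_scaleC[OF K(2), of "e n" z] by (simp add: K.diff K.scaleR)
  qed
  have bl: "bounded_linear (\<lambda>x. z *\<^sub>C (x :: 'h))"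
    by (rule bounded_linear_intro[where K = "cmod z"])
      (auto simp: scaleC_add_right scaleC_scaleR_commute norm_scaleC mult.commute)
  have lr: "(\<lambda>n. l (r n)) \<longlonglongrightarrow> 0"
    using LIMSEQ_subseq_LIMSEQ[OF l0 r] by (simp add: o_def)
  have "(\<lambda>n. z *\<^sub>C K (e (r n)) - l (r n) *\<^sub>R K (e (r n))) \<longlonglongrightarrow> z *\<^sub>C k - 0 *\<^sub>R k"
    by (intro tendsto_diff tendsto_scaleR lr k bounded_linear.tendsto[OF bl])
  then have elim: "(\<lambda>n. e (r n)) \<longlonglongrightarrow> z *\<^sub>C k"
    using eK by simp
  have "norm (z *\<^sub>C k) = 1"
    using LIMSEQ_unique[OF tendsto_norm[OF elim]] e(2) by auto
  moreover have "K (z *\<^sub>C k) = k"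
    using LIMSEQ_unique[OF K.tendsto[OF elim] k] .
  then have "k \<in> D" "A k = 0"
    using K(4)[of "z *\<^sub>C k"] K(5)[of "z *\<^sub>C k"] by auto
  then have "k = 0" by (rule kernel_trivial)
  ultimately show False by simp
qed

section \<open>Spectral projections and the Parseval identity\<close>

lemma spectral_proj_unique: "\<exists>!y. y \<in> E l \<and> (\<forall>z\<in>E l. cinner (x - y) z = 0)"
proof (rule ex_ex1I)
  show "\<exists>y. y \<in> E l \<and> (\<forall>z\<in>E l. cinner (x - y) z = 0)"
    using orthogonal_projection_exists[OF eigenspace_csubspace eigenspace_closed] by blast
  fix y y' assume "y \<in> E l \<and> (\<forall>z\<in>E l. cinner (x - y) z = 0)" "y' \<in> E l \<and> (\<forall>z\<in>E l. cinner (x - y') z = 0)"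
  moreover from this have "y - y' \<in> E l"
    by (intro csubspace_diff eigenspace_csubspace) auto
  ultimately have "cinner (x - y') (y - y') - cinner (x - y) (y - y') = 0" by simp
  then have "cinner (y - y') (y - y') = 0" by (simp add: cinner_diff_left)
  then show "y = y'" by (simp add: cinner_self_eq_0)
qed

lemma spectral_proj_in: "P l x \<in> E l"
  and spectral_proj_orth: "z \<in> E l \<Longrightarrow> cinner (x - P l x) z = 0"
  using theI'[OF spectral_proj_unique, of l x] by (auto simp: spectral_proj_def)

lemma spectral_projI: "y \<in> E l \<Longrightarrow> (\<And>z. z \<in> E l \<Longrightarrow> cinner (x - y) z = 0) \<Longrightarrow> P l x = y"
  unfolding spectral_proj_def by (rule the1_equality[OF spectral_proj_unique]) auto

lemma spectral_proj_add: "P l (x + y) = P l x + P l y"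
proof (rule spectral_projI)
  show "P l x + P l y \<in> E l"
    by (intro csubspace_add eigenspace_csubspace spectral_proj_in)
  fix z assume "z \<in> E l"
  then have "cinner (x - P l x) z + cinner (y - P l y) z = 0"
    by (simp add: spectral_proj_orth)
  then show "cinner (x + y - (P l x + P l y)) z = 0"
    by (simp add: cinner_diff_left cinner_add_left) (simp add: algebra_simps)
qed

lemma spectral_proj_scaleC: "P l (c *\<^sub>C x) = c *\<^sub>C P l x"
proof (rule spectral_projI)
  show "c *\<^sub>C P l x \<in> E l"
    by (intro csubspace_scaleC eigenspace_csubspace spectral_proj_in)
  fix z assume "z \<in> E l"
  then show "cinner (c *\<^sub>C x - c *\<^sub>C P l x) z = 0"
    by (simp add: spectral_proj_orth cinner_scaleC_left flip: scaleC_diff_right)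
qed

lemma spectral_proj_norm_le: "norm (P l x) \<le> norm x"
proof -
  have "cinner (x - P l x) (P l x) = 0"
    by (intro spectral_proj_orth spectral_proj_in)
  from norm_add_sq_orthogonal[OF this] have "(norm (P l x))\<^sup>2 \<le> (norm x)\<^sup>2" by simp
  then show ?thesis by (rule power2_le_imp_le) simp
qed

lemma bounded_linear_spectral_proj: "bounded_linear (P l)"
  by (rule bounded_linear_intro[where K = 1])
    (auto simp: spectral_proj_add spectral_proj_scaleC scaleR_eq_scaleC spectral_proj_norm_le)

lemma orthogonal_family:
  assumes "\<And>l. c l \<in> E l" "i \<noteq> j"
  shows "cinner (c i) (c j) = 0"
  by (rule eigenspace_orthogonal[OF assms(1,1,2)])

text \<open>\<open>P l\<close> is continuous, so it may be applied termwise, and orthogonality of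
  the eigenspaces leaves a single term. For \<open>l\<close> outside \<open>ev\<close> the identity
  persists because \<open>c l\<close> then lies in the zero space.\<close>

lemma riesz_fischer:
  assumes c: "\<And>l. c l \<in> E l" and summ: "(\<lambda>l. (norm (c l))\<^sup>2) summable_on ev"
  shows "P l (infsum c ev) = c l" and "(norm (infsum c ev))\<^sup>2 = (\<Sum>\<^sub>\<infinity>l\<in>ev. (norm (c l))\<^sup>2)"
proof -
  have cs: "c summable_on ev" and
    eq: "(norm (infsum c ev))\<^sup>2 = (\<Sum>\<^sub>\<infinity>l\<in>ev. (norm (c l))\<^sup>2)"
    by (intro orthogonal_summable summ orthogonal_family c; assumption)+
  show "(norm (infsum c ev))\<^sup>2 = (\<Sum>\<^sub>\<infinity>l\<in>ev. (norm (c l))\<^sup>2)" by (fact eq)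
  have "((\<lambda>j. P l (c j)) has_sum P l (infsum c ev)) ev"
    by (intro has_sum_bounded_linear[OF bounded_linear_spectral_proj] has_sum_infsum cs)
  moreover have "P l (c j) = (if j = l then c l else 0)" for j
    by (cases "j = l", use c in \<open>auto intro!: spectral_projI csubspace_0 eigenspace_csubspace\<close>)
       (use c eigenspace_orthogonal in blast)
  ultimately have "((\<lambda>j. if j = l then c l else 0) has_sum P l (infsum c ev)) ev" by simp
  moreover have "((\<lambda>j. if j = l then c l else 0) has_sum c l) ev"
  proof (cases "l \<in> ev")
    case True
    have "((\<lambda>j. if j = l then c l else 0) has_sum c l) {l}"
      by (rule has_sum_finiteI) auto
    then show ?thesis
      by (rule has_sum_cong_neutral[THEN iffD1, rotated -1]) (use True in auto)
  next
    case False
    then show ?thesis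
      using not_eigenvalue[OF False c] by (auto intro!: has_sum_0)
  qed
  ultimately show "P l (infsum c ev) = c l"
    using has_sum_unique by blast
qed

lemma bessel: "(\<lambda>l. (norm (P l x))\<^sup>2) summable_on ev"
proof (rule nonneg_bdd_above_summable_on)
  show "bdd_above (sum (\<lambda>l. (norm (P l x))\<^sup>2) ` {F. F \<subseteq> ev \<and> finite F})"
  proof (rule bdd_aboveI[of _ "(norm x)\<^sup>2"], clarify)
    fix F assume F: "F \<subseteq> ev" "finite F"
    let ?s = "\<Sum>l\<in>F. P l x"
    have ns: "(norm ?s)\<^sup>2 = (\<Sum>l\<in>F. (norm (P l x))\<^sup>2)"
      by (intro norm_sum_sq_orthogonal F orthogonal_family spectral_proj_in)
    have "cinner (x - ?s) (P l x) = 0" if "l \<in> F" for l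
    proof -
      have "cinner ?s (P l x) = (\<Sum>j\<in>F. if j = l then cinner (P l x) (P l x) else 0)"
        unfolding cinner_sum_left
        by (intro sum.cong refl) (auto intro: orthogonal_family spectral_proj_in)
      then have "cinner ?s (P l x) = cinner (P l x) (P l x)" using that F by simp
      then show ?thesis
        using spectral_proj_orth[OF spectral_proj_in, of x l] by (simp add: cinner_diff_left)
    qed
    then have "cinner (x - ?s) ?s = 0"
      by (subst cinner_eq_zero_commute, subst cinner_sum_left)
         (auto intro!: sum.neutral simp: cinner_eq_zero_commute)
    from norm_add_sq_orthogonal[OF this] have "(norm ?s)\<^sup>2 \<le> (norm x)\<^sup>2" by simp
    then show "(\<Sum>l\<in>F. (norm (P l x))\<^sup>2) \<le> (norm x)\<^sup>2" by (simp add: ns)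
  qed
qed simp

lemma eq_from_components:
  assumes "\<And>l. l \<in> ev \<Longrightarrow> P l x = P l y"
  shows "x = y"
proof -
  have "x - y = 0"
  proof (rule eigenvectors_total)
    fix l e assume e: "e \<in> E l"
    show "cinner (x - y) e = 0"
    proof (cases "l \<in> ev")
      case True
      then have "cinner (x - y) e = cinner (x - P l x) e - cinner (y - P l y) e"
        by (simp add: assms cinner_diff_left)
      then show ?thesis using e by (simp add: spectral_proj_orth)
    next
      case False
      then show ?thesis using e not_eigenvalue[of l e] by simp
    qed
  qed
  then show ?thesis by simp
qed

text \<open>By Bessel's inequality the series of projections converges, and its sum has the same
  components as \<open>x\<close>. Totality of the eigenvectors identifies the two.\<close>

lemma parseval: "((\<lambda>l. (norm (P l x))\<^sup>2) has_sum (norm x)\<^sup>2) ev"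
proof -
  have "infsum (\<lambda>l. P l x) ev = x"
    by (rule eq_from_components) (simp add: riesz_fischer(1) spectral_proj_in bessel)
  then show ?thesis
    using riesz_fischer(2)[of "\<lambda>l. P l x"] bessel[of x] has_sum_infsum[OF bessel[of x]]
    by (simp add: spectral_proj_in)
qed

end


section \<open>Decay of a single mode\<close>

lemma nonincreasing_from_derivative:
  fixes f :: "real \<Rightarrow> real"
  assumes "\<And>t. t \<ge> 0 \<Longrightarrow> (f has_real_derivative f' t) (at t within {0..})"
    and "\<And>t. t \<ge> 0 \<Longrightarrow> f' t \<le> 0" and "0 \<le> s" "s \<le> t"
  shows "f t \<le> f s"
proof -
  have "\<exists>x\<in>{s..t}. f t - f s = (\<lambda>h. f' x * h) (t - s)"
  proof (rule mvt_very_simple[OF \<open>s \<le> t\<close>])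
    fix x assume "s \<le> x" "x \<le> t"
    then have "(f has_real_derivative f' x) (at x within {s..t})"
      using assms(1)[of x] \<open>0 \<le> s\<close> by (auto intro: DERIV_subset)
    then show "(f has_derivative (\<lambda>h. f' x * h)) (at x within {s..t})"
      by (simp add: has_field_derivative_def)
  qed
  then obtain x where "x \<in> {s..t}" "f t - f s = f' x * (t - s)"
    by auto
  moreover have "f' x * (t - s) \<le> 0"
    using assms \<open>x \<in> {s..t}\<close> by (intro mult_nonpos_nonneg) auto
  ultimately show ?thesis by simp
qed

text \<open>The derivative of \<open>L powr (- s)\<close> is at least \<open>s * k\<close>, so this
  power is at least \<open>s * k * t\<close> at time \<open>t\<close>; taking the power
  \<open>- (1 / s)\<close> reverses the inequality.\<close>

lemma polynomial_decay_from_derivative: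
  fixes L :: "real \<Rightarrow> real"
  assumes der: "\<And>t. t \<ge> 0 \<Longrightarrow> (L has_real_derivative L' t) (at t within {0..})"
    and L': "\<And>t. t \<ge> 0 \<Longrightarrow> L' t \<le> - (k * L t powr (1 + s))"
    and nonneg: "\<And>t. t \<ge> 0 \<Longrightarrow> L t \<ge> 0" and "k > 0" "s > 0" "t > 0"
  shows "L t \<le> (s * k * t) powr (- (1 / s))"
proof (cases "L t = 0")
  case False
  have L'0: "L' x \<le> 0" if "x \<ge> 0" for x
  proof -
    have "0 \<le> k * L x powr (1 + s)" using \<open>k > 0\<close> by simp
    then show ?thesis using L'[OF that] by linarith
  qed
  \<comment> \<open>Monotonicity and \<open>L t \<noteq> 0\<close> keep \<open>L\<close> positive on
    the whole interval, so that the negative power can be differentiated there.\<close>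
  have pos: "L x > 0" if "0 \<le> x" "x \<le> t" for x
    using nonincreasing_from_derivative[of L L' x t] der L'0 that nonneg[of t] False by fastforce
  have "\<exists>x\<in>{0..t}. L t powr (- s) - L 0 powr (- s) = (\<lambda>h. (- s * L x powr (- s - 1) * L' x) * h) (t - 0)"
  proof (rule mvt_very_simple)
    fix x assume x: "0 \<le> x" "x \<le> t"
    have "(L has_real_derivative L' x) (at x within {0..t})"
      using der[of x] x by (auto intro: DERIV_subset)
    then have "((\<lambda>x. L x powr (- s)) has_real_derivative (- s * L x powr (- s - 1) * L' x)) (at x within {0..t})"
      using pos[OF x] by (auto intro!: derivative_eq_intros simp: powr_diff)
    then show "((\<lambda>x. L x powr (- s)) has_derivative (\<lambda>h. (- s * L x powr (- s - 1) * L' x) * h)) (at x within {0..t})"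
      by (simp only: has_field_derivative_def)
  qed (use \<open>t > 0\<close> in simp)
  then obtain x where x: "x \<in> {0..t}" and
    eq: "L t powr (- s) - L 0 powr (- s) = (- s * L x powr (- s - 1) * L' x) * t"
    by auto
  have "s * k = s * L x powr (- s - 1) * (k * L x powr (1 + s))"
    using pos[of x] x by (simp flip: powr_add)
  also have "\<dots> \<le> s * L x powr (- s - 1) * (- L' x)"
    using L'[of x] x \<open>s > 0\<close> by (intro mult_left_mono) auto
  finally have "s * k * t \<le> (- s * L x powr (- s - 1) * L' x) * t"
    using \<open>t > 0\<close> by (intro mult_right_mono) auto
  \<comment> \<open>Discarding \<open>L 0 powr (- s)\<close> makes the bound independent of the
    initial value; in the application the data enter only through \<open>k\<close>.\<close>
  also have "\<dots> \<le> L t powr (- s)"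
    using eq by (metis diff_ge_0_iff_ge diff_diff_eq2 add_diff_cancel_left' powr_ge_zero)
  finally have "(L t powr (- s)) powr (- (1 / s)) \<le> (s * k * t) powr (- (1 / s))"
    using assms by (intro powr_mono2') auto
  moreover have "(L t powr (- s)) powr (- (1 / s)) = L t"
    using pos[of t] assms by (simp add: powr_powr)
  ultimately show ?thesis by simp
qed simp

text \<open>The whole constant is placed on \<open>y\<close>. In the application \<open>y\<close> is
  the norm of the flux, whose damping coefficient can be made as large as desired.\<close>

lemma young_ineq:
  fixes x y w c :: real
  assumes "\<bar>w\<bar> \<le> x * y" and "c\<^sup>2 \<le> M"
  shows "c * w \<le> x\<^sup>2 / 2 + M / 2 * y\<^sup>2"
proof -
  have "c * w \<le> \<bar>c\<bar> * \<bar>w\<bar>" by (metis abs_ge_self abs_mult)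
  also have "\<dots> \<le> \<bar>c\<bar> * (x * y)" using assms(1) by (intro mult_left_mono) auto
  also have "\<dots> \<le> x\<^sup>2 / 2 + \<bar>c\<bar>\<^sup>2 / 2 * y\<^sup>2"
    using zero_le_power2[of "x - \<bar>c\<bar> * y"] by (simp add: power2_eq_square algebra_simps)
  also have "\<dots> \<le> x\<^sup>2 / 2 + M / 2 * y\<^sup>2"
    using assms(2) by (intro add_left_mono mult_right_mono) auto
  finally show ?thesis .
qed

text \<open>
  In one eigenspace of \<open>A\<close>, let \<open>w\<close> be the displacement scaled so that the energy is
  \<open>\<parallel>w\<parallel>\<^sup>2 + \<parallel>v\<parallel>\<^sup>2 + \<parallel>\<theta>\<parallel>\<^sup>2 + \<tau>\<parallel>q\<parallel>\<^sup>2\<close>. Rotating \<open>(w, \<theta>)\<close> into \<open>(p, z)\<close> decouples the fast oscillation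
  of \<open>(v, z)\<close> with frequency \<open>r\<close> from the slow pair \<open>(p, q)\<close>; the remaining couplings are \<open>a\<close>
  between \<open>p\<close> and \<open>q\<close>, and \<open>r * y\<close> between \<open>z\<close> and \<open>q\<close>.
\<close>

definition rot_flow ::
    "real \<Rightarrow> real \<Rightarrow> real \<Rightarrow> real \<Rightarrow> (real \<Rightarrow> 'a::chilbert_space) \<Rightarrow> (real \<Rightarrow> 'a) \<Rightarrow> (real \<Rightarrow> 'a) \<Rightarrow> (real \<Rightarrow> 'a) \<Rightarrow> bool" where
  "rot_flow \<tau> a r y p v z q \<longleftrightarrow> (\<forall>t\<ge>0.
     (p has_vector_derivative a *\<^sub>R q t) (at t within {0..}) \<and>
     (v has_vector_derivative r *\<^sub>R z t) (at t within {0..}) \<and>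
     (z has_vector_derivative r *\<^sub>R (y *\<^sub>R q t - v t)) (at t within {0..}) \<and>
     (q has_vector_derivative (- (1 / \<tau>)) *\<^sub>R (q t + (r * y) *\<^sub>R z t + a *\<^sub>R p t)) (at t within {0..}))"

section \<open>Energies and the Lyapunov functional of a rotated mode\<close>

definition rot_energy :: "real \<Rightarrow> 'a::chilbert_space \<Rightarrow> 'a \<Rightarrow> 'a \<Rightarrow> 'a \<Rightarrow> real" where
  "rot_energy \<tau> p v z q = (norm p)\<^sup>2 + (norm v)\<^sup>2 + (norm z)\<^sup>2 + \<tau> * (norm q)\<^sup>2"

text \<open>The energy of the right-hand side of \<open>rot_flow\<close>, hence of the time
  derivative along a solution. Undoing the rotation, it is one mode of the energy of the generator
  applied to the state.\<close>

definition rot_energy1 ::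
    "real \<Rightarrow> real \<Rightarrow> real \<Rightarrow> real \<Rightarrow> 'a::chilbert_space \<Rightarrow> 'a \<Rightarrow> 'a \<Rightarrow> 'a \<Rightarrow> real" where
  "rot_energy1 \<tau> a r y p v z q =
     rot_energy \<tau> (a *\<^sub>R q) (r *\<^sub>R z) (r *\<^sub>R (y *\<^sub>R q - v)) ((- (1 / \<tau>)) *\<^sub>R (q + (r * y) *\<^sub>R z + a *\<^sub>R p))"

text \<open>The energy dissipates only \<open>q\<close>; the cross terms pass the damping on.
  Differentiating the \<open>rinner p q\<close> term yields \<open>- (norm p)^2\<close> and a
  multiple of \<open>rinner p z\<close>, which the part \<open>y / a\<close> of the next coefficient
  cancels. The \<open>rinner q z\<close> term yields \<open>- 2 * y^2 * (norm z)^2\<close> and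
  another multiple of \<open>rinner p z\<close>, cancelled by the part
  \<open>2 * a * y / r^2\<close>. The \<open>rinner v z\<close> term trades half of the damping of
  \<open>z\<close> for damping of \<open>v\<close>. Every cross term left in the derivative contains
  \<open>q\<close>.\<close>

definition rot_lyap ::
    "real \<Rightarrow> real \<Rightarrow> real \<Rightarrow> real \<Rightarrow> real \<Rightarrow> 'a::chilbert_space \<Rightarrow> 'a \<Rightarrow> 'a \<Rightarrow> 'a \<Rightarrow> real" where
  "rot_lyap N \<tau> a r y p v z q =
     N * rot_energy \<tau> p v z q + (\<tau> / a) * rinner p q + (y / a + 2 * a * y / r\<^sup>2) * rinner p v
     + (2 * \<tau> * y / r) * rinner q z + (y\<^sup>2 / r) * rinner v z"

lemma rot_energy_nonneg: "\<tau> > 0 \<Longrightarrow> rot_energy \<tau> p v z q \<ge> 0"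
  by (simp add: rot_energy_def)

lemma has_real_derivative_rinner:
  assumes "(f has_vector_derivative f') (at x within S)" "(g has_vector_derivative g') (at x within S)"
  shows "((\<lambda>x. rinner (f x) (g x)) has_real_derivative rinner (f x) g' + rinner f' (g x)) (at x within S)"
  unfolding has_real_derivative_iff_has_vector_derivative
  using assms by (rule bounded_bilinear.has_vector_derivative[OF bounded_bilinear_rinner])

lemma rot_flowD:
  assumes "rot_flow \<tau> a r y p v z q" "t \<ge> 0"
  shows "(p has_vector_derivative a *\<^sub>R q t) (at t within {0..})"
    and "(v has_vector_derivative r *\<^sub>R z t) (at t within {0..})"
    and "(z has_vector_derivative r *\<^sub>R (y *\<^sub>R q t - v t)) (at t within {0..})"
    and "(q has_vector_derivative (- (1 / \<tau>)) *\<^sub>R (q t + (r * y) *\<^sub>R z t + a *\<^sub>R p t)) (at t within {0..})"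
  using assms by (auto simp: rot_flow_def)

lemma rot_energy_derivative:
  assumes flow: "rot_flow \<tau> a r y p v z q" and "t \<ge> 0" "\<tau> > 0"
  shows "((\<lambda>t. rot_energy \<tau> (p t) (v t) (z t) (q t)) has_real_derivative - 2 * (norm (q t))\<^sup>2)
    (at t within {0..})"
  unfolding rot_energy_def rinner_self[symmetric]
proof (rule DERIV_cong)
  note d = rot_flowD[OF flow \<open>t \<ge> 0\<close>]
  show "((\<lambda>t. rinner (p t) (p t) + rinner (v t) (v t) + rinner (z t) (z t) + \<tau> * rinner (q t) (q t))
      has_real_derivative
      (rinner (p t) (a *\<^sub>R q t) + rinner (a *\<^sub>R q t) (p t)) + (rinner (v t) (r *\<^sub>R z t) + rinner (r *\<^sub>R z t) (v t))
      + (rinner (z t) (r *\<^sub>R (y *\<^sub>R q t - v t)) + rinner (r *\<^sub>R (y *\<^sub>R q t - v t)) (z t))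
      + \<tau> * (rinner (q t) ((- (1 / \<tau>)) *\<^sub>R (q t + (r * y) *\<^sub>R z t + a *\<^sub>R p t))
           + rinner ((- (1 / \<tau>)) *\<^sub>R (q t + (r * y) *\<^sub>R z t + a *\<^sub>R p t)) (q t)))
      (at t within {0..})"
    by (intro DERIV_add DERIV_cmult has_real_derivative_rinner d)
  show "(rinner (p t) (a *\<^sub>R q t) + rinner (a *\<^sub>R q t) (p t)) + (rinner (v t) (r *\<^sub>R z t) + rinner (r *\<^sub>R z t) (v t))
      + (rinner (z t) (r *\<^sub>R (y *\<^sub>R q t - v t)) + rinner (r *\<^sub>R (y *\<^sub>R q t - v t)) (z t))
      + \<tau> * (rinner (q t) ((- (1 / \<tau>)) *\<^sub>R (q t + (r * y) *\<^sub>R z t + a *\<^sub>R p t))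
           + rinner ((- (1 / \<tau>)) *\<^sub>R (q t + (r * y) *\<^sub>R z t + a *\<^sub>R p t)) (q t))
      = - 2 * rinner (q t) (q t)"
    unfolding rinner_add_left rinner_add_right rinner_diff_left rinner_diff_right
      rinner_scaleR_left rinner_scaleR_right
      rinner_commute[of "q t" "z t"] rinner_commute[of "q t" "p t"] rinner_commute[of "z t" "v t"]
    using \<open>\<tau> > 0\<close> by (simp add: field_simps)
qed

lemma rot_lyap_derivative:
  assumes flow: "rot_flow \<tau> a r y p v z q" and "t \<ge> 0" "\<tau> > 0" "a > 0" "r > 0"
  shows "((\<lambda>t. rot_lyap N \<tau> a r y (p t) (v t) (z t) (q t)) has_real_derivative
      - (norm (p t))\<^sup>2 - y\<^sup>2 * ((norm (z t))\<^sup>2 + (norm (v t))\<^sup>2) + (\<tau> + 2 * \<tau> * y\<^sup>2 - 2 * N) * (norm (q t))\<^sup>2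
      + (- (1 / a)) * rinner (p t) (q t)
      + (1 - 2 * \<tau> + 2 * (a / r)\<^sup>2 + y\<^sup>2) * (y * rinner (v t) (q t)) + (- (2 / r)) * (y * rinner (z t) (q t)))
    (at t within {0..})"
  unfolding rot_lyap_def
proof (rule DERIV_cong)
  note d = rot_flowD[OF flow \<open>t \<ge> 0\<close>]
  show "((\<lambda>t. N * rot_energy \<tau> (p t) (v t) (z t) (q t) + (\<tau> / a) * rinner (p t) (q t)
       + (y / a + 2 * a * y / r\<^sup>2) * rinner (p t) (v t)
       + (2 * \<tau> * y / r) * rinner (q t) (z t) + (y\<^sup>2 / r) * rinner (v t) (z t))
      has_real_derivative
       N * (- 2 * (norm (q t))\<^sup>2)
       + (\<tau> / a) * (rinner (p t) ((- (1 / \<tau>)) *\<^sub>R (q t + (r * y) *\<^sub>R z t + a *\<^sub>R p t)) + rinner (a *\<^sub>R q t) (q t))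
       + (y / a + 2 * a * y / r\<^sup>2) * (rinner (p t) (r *\<^sub>R z t) + rinner (a *\<^sub>R q t) (v t))
       + (2 * \<tau> * y / r) * (rinner (q t) (r *\<^sub>R (y *\<^sub>R q t - v t))
            + rinner ((- (1 / \<tau>)) *\<^sub>R (q t + (r * y) *\<^sub>R z t + a *\<^sub>R p t)) (z t))
       + (y\<^sup>2 / r) * (rinner (v t) (r *\<^sub>R (y *\<^sub>R q t - v t)) + rinner (r *\<^sub>R z t) (z t)))
      (at t within {0..})"
    by (intro DERIV_add DERIV_cmult has_real_derivative_rinner d rot_energy_derivative[OF flow \<open>t \<ge> 0\<close> \<open>\<tau> > 0\<close>])
  show "N * (- 2 * (norm (q t))\<^sup>2)
       + (\<tau> / a) * (rinner (p t) ((- (1 / \<tau>)) *\<^sub>R (q t + (r * y) *\<^sub>R z t + a *\<^sub>R p t)) + rinner (a *\<^sub>R q t) (q t))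
       + (y / a + 2 * a * y / r\<^sup>2) * (rinner (p t) (r *\<^sub>R z t) + rinner (a *\<^sub>R q t) (v t))
       + (2 * \<tau> * y / r) * (rinner (q t) (r *\<^sub>R (y *\<^sub>R q t - v t))
            + rinner ((- (1 / \<tau>)) *\<^sub>R (q t + (r * y) *\<^sub>R z t + a *\<^sub>R p t)) (z t))
       + (y\<^sup>2 / r) * (rinner (v t) (r *\<^sub>R (y *\<^sub>R q t - v t)) + rinner (r *\<^sub>R z t) (z t))
    = - (norm (p t))\<^sup>2 - y\<^sup>2 * ((norm (z t))\<^sup>2 + (norm (v t))\<^sup>2) + (\<tau> + 2 * \<tau> * y\<^sup>2 - 2 * N) * (norm (q t))\<^sup>2
      + (- (1 / a)) * rinner (p t) (q t)
      + (1 - 2 * \<tau> + 2 * (a / r)\<^sup>2 + y\<^sup>2) * (y * rinner (v t) (q t)) + (- (2 / r)) * (y * rinner (z t) (q t))"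
    unfolding rinner_add_left rinner_add_right rinner_diff_left rinner_diff_right
      rinner_scaleR_left rinner_scaleR_right rinner_self rinner_commute[of "q t" "v t"]
      rinner_commute[of "q t" "z t"] rinner_commute[of "q t" "p t"]
      rinner_commute[of "z t" "v t"] rinner_commute[of "v t" "p t"] rinner_commute[of "z t" "p t"]
    using assms(3-) by (simp add: field_simps power2_eq_square)
qed

text \<open>Each cross coefficient has a bound in \<open>\<tau>\<close>, \<open>a0\<close>,
  \<open>r0\<close> and \<open>C\<close> alone, which is what lets one \<open>N\<close> serve all
  modes. The factor \<open>1 + 1 / \<tau>\<close> passes from the unweighted sum of squares to the
  energy, where \<open>q\<close> carries the weight \<open>\<tau>\<close>.\<close>

lemma rot_lyap_equiv:
  assumes "\<tau> > 0" "a0 > 0" "r0 > 0" "a0 \<le> a" "r0 \<le> r" "a \<le> C * r" "0 \<le> y" "y \<le> C"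
  shows "\<bar>rot_lyap N \<tau> a r y p v z q - N * rot_energy \<tau> p v z q\<bar>
    \<le> (\<tau> / a0 + (C / a0 + 2 * C * C / r0) + 2 * \<tau> * C / r0 + C\<^sup>2 / r0) * ((1 + 1 / \<tau>) * rot_energy \<tau> p v z q)"
proof -
  define e where "e = (1 + 1 / \<tau>) * rot_energy \<tau> p v z q"
  have C: "C \<ge> 0" using assms by linarith
  have ar: "a > 0" "r > 0" using assms by auto
  have sq: "(norm p)\<^sup>2 + (norm v)\<^sup>2 + (norm z)\<^sup>2 + (norm q)\<^sup>2 \<le> e"
    using assms(1) by (simp add: e_def rot_energy_def field_simps)
  have ip: "\<bar>rinner f g\<bar> \<le> ((norm f)\<^sup>2 + (norm g)\<^sup>2) / 2" for f g :: 'a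
  proof -
    have "\<bar>rinner f g\<bar> \<le> norm f * norm g" by (rule abs_rinner_le)
    also have "\<dots> \<le> ((norm f)\<^sup>2 + (norm g)\<^sup>2) / 2"
      using sum_squares_bound[of "norm f" "norm g"] by simp
    finally show ?thesis .
  qed
  have nn: "(norm p)\<^sup>2 \<ge> 0" "(norm v)\<^sup>2 \<ge> 0" "(norm z)\<^sup>2 \<ge> 0" "(norm q)\<^sup>2 \<ge> 0" by auto
  have i: "\<bar>rinner p q\<bar> \<le> e" "\<bar>rinner p v\<bar> \<le> e" "\<bar>rinner q z\<bar> \<le> e" "\<bar>rinner v z\<bar> \<le> e"
    using ip[of p q] ip[of p v] ip[of q z] ip[of v z] sq nn by (simp_all add: add_divide_distrib)
  have e0: "e \<ge> 0" using i(1) by linarith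
  have bnd: "\<bar>c * w\<bar> \<le> K * e" if "0 \<le> c" "c \<le> K" "\<bar>w\<bar> \<le> e" for c w K
    unfolding abs_mult using that e0 by (intro mult_mono) auto
  have "2 * a * y / r\<^sup>2 = 2 * (a / r) * y / r" by (simp add: power2_eq_square)
  also have "\<dots> \<le> 2 * C * C / r0"
    using assms C ar by (intro frac_le mult_mono) (auto simp: field_simps)
  finally have c2: "2 * a * y / r\<^sup>2 \<le> 2 * C * C / r0" .
  have c1: "\<tau> / a \<le> \<tau> / a0" "y / a \<le> C / a0" "2 * \<tau> * y / r \<le> 2 * \<tau> * C / r0" "y\<^sup>2 / r \<le> C\<^sup>2 / r0"
    using assms C ar by (auto intro!: frac_le mult_mono power_mono)
  have "\<bar>(\<tau> / a) * rinner p q\<bar> \<le> (\<tau> / a0) * e"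
    by (rule bnd[OF _ c1(1) i(1)]) (use assms ar in auto)
  moreover have "\<bar>(y / a + 2 * a * y / r\<^sup>2) * rinner p v\<bar> \<le> (C / a0 + 2 * C * C / r0) * e"
    by (rule bnd[OF _ add_mono[OF c1(2) c2] i(2)]) (use assms ar in auto)
  moreover have "\<bar>(2 * \<tau> * y / r) * rinner q z\<bar> \<le> (2 * \<tau> * C / r0) * e"
    by (rule bnd[OF _ c1(3) i(3)]) (use assms ar in auto)
  moreover have "\<bar>(y\<^sup>2 / r) * rinner v z\<bar> \<le> (C\<^sup>2 / r0) * e"
    by (rule bnd[OF _ c1(4) i(4)]) (use assms ar in auto)
  moreover have "(\<tau> / a0 + (C / a0 + 2 * C * C / r0) + 2 * \<tau> * C / r0 + C\<^sup>2 / r0) * e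
     = (\<tau> / a0) * e + (C / a0 + 2 * C * C / r0) * e + (2 * \<tau> * C / r0) * e + (C\<^sup>2 / r0) * e"
    by (simp only: distrib_right)
  ultimately show ?thesis
    unfolding rot_lyap_def e_def[symmetric] by linarith
qed

text \<open>Each remaining cross term pairs \<open>q\<close> with \<open>p\<close>,
  \<open>y * v\<close> or \<open>y * z\<close>. Young's inequality spends half of their damping and
  charges the rest to \<open>q\<close>. The summands demanded of \<open>2 * N\<close> are these
  charges, the positive \<open>q\<close> terms of the derivative, and \<open>\<tau> / 2\<close> as
  damping left over for \<open>q\<close>.\<close>

lemma rot_dissipation:
  assumes "\<tau> > 0" "a0 > 0" "r0 > 0" "a0 \<le> a" "r0 \<le> r" "a \<le> C * r" "0 \<le> y" "y \<le> C"
    and N: "2 * N \<ge> \<tau> / 2 + \<tau> + 2 * \<tau> * C\<^sup>2 + (1 / a0)\<^sup>2 / 2 + (1 + 2 * \<tau> + 3 * C\<^sup>2)\<^sup>2 / 2 + (2 / r0)\<^sup>2 / 2"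
  shows "- (norm p)\<^sup>2 - y\<^sup>2 * ((norm z)\<^sup>2 + (norm v)\<^sup>2) + (\<tau> + 2 * \<tau> * y\<^sup>2 - 2 * N) * (norm q)\<^sup>2
      + (- (1 / a)) * rinner p q
      + (1 - 2 * \<tau> + 2 * (a / r)\<^sup>2 + y\<^sup>2) * (y * rinner v q) + (- (2 / r)) * (y * rinner z q)
    \<le> - (1 / 2) * ((norm p)\<^sup>2 + \<tau> * (norm q)\<^sup>2 + y\<^sup>2 * ((norm v)\<^sup>2 + (norm z)\<^sup>2))"
proof -
  have ar: "a > 0" "r > 0" using assms by auto
  have y2: "y\<^sup>2 \<le> C\<^sup>2" using assms by (intro power_mono) auto
  have ar2: "(a / r)\<^sup>2 \<le> C\<^sup>2" using assms ar by (intro power_mono) (auto simp: field_simps)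
  have "(- (1 / a)) * rinner p q \<le> (norm p)\<^sup>2 / 2 + (1 / a0)\<^sup>2 / 2 * (norm q)\<^sup>2"
    by (rule young_ineq[OF abs_rinner_le])
       (use assms ar in \<open>auto simp only: power2_minus intro!: power_mono divide_left_mono\<close>, auto)
  moreover have "(1 - 2 * \<tau> + 2 * (a / r)\<^sup>2 + y\<^sup>2) * (y * rinner v q)
      \<le> (y * norm v)\<^sup>2 / 2 + (1 + 2 * \<tau> + 3 * C\<^sup>2)\<^sup>2 / 2 * (norm q)\<^sup>2"
  proof (rule young_ineq)
    show "\<bar>y * rinner v q\<bar> \<le> y * norm v * norm q"
      using mult_left_mono[OF abs_rinner_le[of v q] \<open>0 \<le> y\<close>] \<open>0 \<le> y\<close> by (simp add: abs_mult mult.assoc)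
    have "\<bar>1 - 2 * \<tau> + 2 * (a / r)\<^sup>2 + y\<^sup>2\<bar> \<le> 1 + 2 * \<tau> + 3 * C\<^sup>2"
      using y2 ar2 assms(1) zero_le_power2[of y] zero_le_power2[of "a / r"] unfolding abs_le_iff by linarith
    then show "(1 - 2 * \<tau> + 2 * (a / r)\<^sup>2 + y\<^sup>2)\<^sup>2 \<le> (1 + 2 * \<tau> + 3 * C\<^sup>2)\<^sup>2"
      using abs_le_square_iff by fastforce
  qed
  moreover have "(- (2 / r)) * (y * rinner z q) \<le> (y * norm z)\<^sup>2 / 2 + (2 / r0)\<^sup>2 / 2 * (norm q)\<^sup>2"
  proof (rule young_ineq)
    show "\<bar>y * rinner z q\<bar> \<le> y * norm z * norm q"
      using mult_left_mono[OF abs_rinner_le[of z q] \<open>0 \<le> y\<close>] \<open>0 \<le> y\<close> by (simp add: abs_mult mult.assoc)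
    show "(- (2 / r))\<^sup>2 \<le> (2 / r0)\<^sup>2"
      unfolding power2_minus using assms ar by (intro power_mono divide_left_mono) auto
  qed
  moreover have "(\<tau> + 2 * \<tau> * y\<^sup>2 - 2 * N) * (norm q)\<^sup>2
     \<le> (- (\<tau> / 2) - (1 / a0)\<^sup>2 / 2 - (1 + 2 * \<tau> + 3 * C\<^sup>2)\<^sup>2 / 2 - (2 / r0)\<^sup>2 / 2) * (norm q)\<^sup>2"
  proof (rule mult_right_mono)
    have "2 * \<tau> * y\<^sup>2 \<le> 2 * \<tau> * C\<^sup>2" using y2 assms(1) by simp
    then show "\<tau> + 2 * \<tau> * y\<^sup>2 - 2 * N \<le> - (\<tau> / 2) - (1 / a0)\<^sup>2 / 2 - (1 + 2 * \<tau> + 3 * C\<^sup>2)\<^sup>2 / 2 - (2 / r0)\<^sup>2 / 2"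
      using N by linarith
  qed simp
  moreover have "(- (\<tau> / 2) - (1 / a0)\<^sup>2 / 2 - (1 + 2 * \<tau> + 3 * C\<^sup>2)\<^sup>2 / 2 - (2 / r0)\<^sup>2 / 2) * (norm q)\<^sup>2
     = - (1 / 2) * (\<tau> * (norm q)\<^sup>2) - (1 / a0)\<^sup>2 / 2 * (norm q)\<^sup>2 - (1 + 2 * \<tau> + 3 * C\<^sup>2)\<^sup>2 / 2 * (norm q)\<^sup>2
       - (2 / r0)\<^sup>2 / 2 * (norm q)\<^sup>2"
    by (simp add: left_diff_distrib)
  moreover have "(y * norm z)\<^sup>2 = y\<^sup>2 * (norm z)\<^sup>2" "(y * norm v)\<^sup>2 = y\<^sup>2 * (norm v)\<^sup>2"
    by (simp_all add: power_mult_distrib)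
  ultimately show ?thesis
    by (simp add: algebra_simps)
qed

text \<open>The state can be read off from its derivative: \<open>q\<close> from
  \<open>a *\<^sub>R q\<close>, \<open>z\<close> from \<open>r *\<^sub>R z\<close>, then
  \<open>v\<close> from \<open>y *\<^sub>R q - v\<close>, and finally \<open>p\<close> from the flux
  equation. Only lower bounds on \<open>a\<close> and \<open>r\<close> and the upper bound on
  \<open>y\<close> are divided or multiplied in.\<close>

lemma rot_energy_le_energy1:
  assumes "\<tau> > 0" "a0 > 0" "r0 > 0" "C > 0"
  shows "\<exists>K>0. \<forall>a r y. \<forall>p v z q :: 'a::chilbert_space. a0 \<le> a \<longrightarrow> r0 \<le> r \<longrightarrow> 0 \<le> y \<longrightarrow> y \<le> C \<longrightarrow>
    rot_energy \<tau> p v z q \<le> K * rot_energy1 \<tau> a r y p v z q"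
proof -
  \<comment> \<open>In units of the square root of the higher energy, \<open>k1\<close>,
    \<open>k2\<close>, \<open>k3\<close>, \<open>k4\<close> will bound the norms of
    \<open>q\<close>, \<open>z\<close>, \<open>v\<close>, \<open>p\<close>.\<close>
  define k1 k2 where "k1 = 1 / a0" and "k2 = 1 / r0"
  define k3 where "k3 = C * k1 + k2"
  define k4 where "k4 = (sqrt \<tau> + k1 + C) * k1"
  define K where "K = k4\<^sup>2 + k3\<^sup>2 + k2\<^sup>2 + \<tau> * k1\<^sup>2"
  have kpos: "k1 > 0" "k2 > 0" using assms by (auto simp: k1_def k2_def)
  have "K > 0" unfolding K_def using kpos assms by (intro add_nonneg_pos) auto
  moreover have "rot_energy \<tau> p v z q \<le> K * rot_energy1 \<tau> a r y p v z q"
    if "a0 \<le> a" "r0 \<le> r" "0 \<le> y" "y \<le> C" for a r y and p v z q :: 'a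
  proof -
    have ar: "a > 0" "r > 0" using that assms by auto
    define g where "g = q + (r * y) *\<^sub>R z + a *\<^sub>R p"
    define E1 where "E1 = rot_energy1 \<tau> a r y p v z q"
    have E1: "E1 = (norm (a *\<^sub>R q))\<^sup>2 + (norm (r *\<^sub>R z))\<^sup>2 + (norm (r *\<^sub>R (y *\<^sub>R q - v)))\<^sup>2 + (norm g)\<^sup>2 / \<tau>"
      using assms(1) unfolding E1_def rot_energy1_def rot_energy_def g_def[symmetric]
      by (simp add: power_mult_distrib power2_eq_square)
    define e where "e = sqrt E1"
    have e0: "e \<ge> 0" and ee: "e\<^sup>2 = E1"
      unfolding e_def using assms(1) by (auto simp: E1)
    have le: "norm h \<le> e" if "(norm h)\<^sup>2 \<le> E1" for h :: 'a
      using that e0 by (metis ee power2_le_imp_le)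
    have nn: "0 \<le> (norm g)\<^sup>2 / \<tau>" "0 \<le> (norm (r *\<^sub>R z))\<^sup>2" "0 \<le> (norm (r *\<^sub>R (y *\<^sub>R q - v)))\<^sup>2"
      "0 \<le> (norm (a *\<^sub>R q))\<^sup>2"
      using assms(1) by auto
    have aq: "norm (a *\<^sub>R q) \<le> e" and rz: "norm (r *\<^sub>R z) \<le> e" and rv: "norm (r *\<^sub>R (y *\<^sub>R q - v)) \<le> e"
      by (rule le, use E1 nn in linarith)+
    have gle: "norm g \<le> sqrt \<tau> * e"
    proof (rule power2_le_imp_le)
      have "(norm g)\<^sup>2 / \<tau> \<le> E1" using E1 nn by linarith
      then show "(norm g)\<^sup>2 \<le> (sqrt \<tau> * e)\<^sup>2"
        using assms(1) by (simp add: power_mult_distrib ee field_simps)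
    qed (use assms e0 in simp)
    have q: "norm q \<le> k1 * e"
    proof -
      have "a0 * norm q \<le> e" using aq ar that mult_right_mono[OF \<open>a0 \<le> a\<close>, of "norm q"] by simp
      then show ?thesis using assms by (simp add: k1_def field_simps)
    qed
    have z: "norm z \<le> k2 * e"
    proof -
      have "r0 * norm z \<le> e" using rz ar that mult_right_mono[OF \<open>r0 \<le> r\<close>, of "norm z"] by simp
      then show ?thesis using assms by (simp add: k2_def field_simps)
    qed
    have v: "norm v \<le> k3 * e"
    proof -
      have "r0 * norm (y *\<^sub>R q - v) \<le> e"
        using rv ar that mult_right_mono[OF \<open>r0 \<le> r\<close>, of "norm (y *\<^sub>R q - v)"] by simp
      then have "norm (y *\<^sub>R q - v) \<le> k2 * e" using assms by (simp add: k2_def field_simps)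
      moreover have "norm v \<le> norm (y *\<^sub>R q) + norm (y *\<^sub>R q - v)"
        by (metis norm_triangle_sub norm_minus_commute add.commute)
      moreover have "norm (y *\<^sub>R q) \<le> C * (k1 * e)"
        using that q by (auto intro!: mult_mono)
      ultimately show ?thesis by (simp add: k3_def algebra_simps)
    qed
    have p: "norm p \<le> k4 * e"
    proof -
      have "a *\<^sub>R p = g - q - (r * y) *\<^sub>R z" by (simp add: g_def)
      then have "norm (a *\<^sub>R p) \<le> norm g + norm q + norm ((r * y) *\<^sub>R z)"
        by (metis norm_triangle_ineq4 add_right_mono order_trans)
      also have "norm ((r * y) *\<^sub>R z) = y * norm (r *\<^sub>R z)" using ar that by simp
      also have "\<dots> \<le> C * e" using that rz by (intro mult_mono) auto
      finally have "norm (a *\<^sub>R p) \<le> sqrt \<tau> * e + k1 * e + C * e"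
        using gle q by linarith
      then have "a0 * norm p \<le> (sqrt \<tau> + k1 + C) * e"
        using ar mult_right_mono[OF \<open>a0 \<le> a\<close>, of "norm p"] by (simp add: algebra_simps)
      then show ?thesis using assms by (simp add: k4_def k1_def field_simps)
    qed
    have "(norm p)\<^sup>2 \<le> (k4 * e)\<^sup>2" "(norm v)\<^sup>2 \<le> (k3 * e)\<^sup>2" "(norm z)\<^sup>2 \<le> (k2 * e)\<^sup>2" "(norm q)\<^sup>2 \<le> (k1 * e)\<^sup>2"
      using p v z q by (auto intro: power_mono)
    moreover from this(4) have "\<tau> * (norm q)\<^sup>2 \<le> \<tau> * (k1 * e)\<^sup>2" using assms(1) by simp
    ultimately have "rot_energy \<tau> p v z q \<le> K * e\<^sup>2"
      unfolding rot_energy_def K_def by (simp add: power_mult_distrib distrib_right mult.assoc)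
    then show ?thesis by (simp add: ee E1_def)
  qed
  ultimately show ?thesis by blast
qed

text \<open>
  The dissipation controls the slow variables without loss, and the fast ones only with the factor
  \<open>y\<^sup>2\<close>, which is compensated by the gain \<open>r\<^sup>2\<close> in the higher energy.
\<close>

lemma rot_interpolation:
  assumes "\<tau> > 0" "s > 0" "C > 0" "K > 0" "c > 0"
  shows "\<exists>k>0. \<forall>a r y. \<forall>p v z q :: 'a::chilbert_space.
     r > 0 \<longrightarrow> 0 \<le> y \<longrightarrow> y \<le> C \<longrightarrow> c * (r\<^sup>2) powr (- s) \<le> y\<^sup>2 \<longrightarrow>
     0 < rot_energy \<tau> p v z q \<longrightarrow>
     rot_energy \<tau> p v z q \<le> K * rot_energy1 \<tau> a r y p v z q \<longrightarrow>
     k * rot_energy \<tau> p v z q * (rot_energy \<tau> p v z q / rot_energy1 \<tau> a r y p v z q) powr s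
       \<le> (norm p)\<^sup>2 + \<tau> * (norm q)\<^sup>2 + y\<^sup>2 * ((norm v)\<^sup>2 + (norm z)\<^sup>2)"
proof -
  \<comment> \<open>\<open>c3\<close> is the price of replacing \<open>y *\<^sub>R q - v\<close> by
    \<open>v\<close>; \<open>\<epsilon>\<close> solves \<open>(1 + c3) * \<epsilon> = 1 / 2\<close>,
    so that a small slow energy can be absorbed together with this price; \<open>k\<close> is the
    smaller of the constants from the two cases below.\<close>
  define c3 where "c3 = 2 * C\<^sup>2 / \<tau>"
  define \<epsilon> where "\<epsilon> = 1 / (2 * (1 + c3))"
  define k where "k = min (\<epsilon> / K powr s) (c / 4 powr s / 2)"
  have c3: "c3 > 0" using assms by (simp add: c3_def)
  then have eps: "\<epsilon> > 0" "\<epsilon> \<le> 1 / 2" by (auto simp: \<epsilon>_def field_simps)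
  have "k > 0" using eps assms by (simp add: k_def)
  moreover have "k * E0 * (E0 / E1) powr s \<le> (norm p)\<^sup>2 + \<tau> * (norm q)\<^sup>2 + y\<^sup>2 * ((norm v)\<^sup>2 + (norm z)\<^sup>2)"
    if r: "r > 0" and y: "0 \<le> y" "y \<le> C" and cy: "c * (r\<^sup>2) powr (- s) \<le> y\<^sup>2" and E0: "0 < E0"
      and le: "E0 \<le> K * E1" and E0_def: "E0 = rot_energy \<tau> p v z q"
      and E1_def: "E1 = rot_energy1 \<tau> a r y p v z q"
    for a r y E0 E1 and p v z q :: 'a
  proof -
    define low hi where "low = (norm p)\<^sup>2 + \<tau> * (norm q)\<^sup>2" and "hi = (norm v)\<^sup>2 + (norm z)\<^sup>2"
    have E0_eq: "E0 = low + hi" by (simp add: E0_def rot_energy_def low_def hi_def)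
    have nn: "low \<ge> 0" "hi \<ge> 0" using assms(1) by (auto simp: low_def hi_def)
    have E1: "E1 > 0" using E0 le assms by (smt (verit) mult_nonneg_nonpos)
    \<comment> \<open>If the slow variables hold a fixed fraction of the energy, the dissipation is
      comparable to \<open>E0\<close> outright. Otherwise the fast ones hold at least half, and the
      factor \<open>y^2\<close> must be compared with \<open>E0 / E1\<close>.\<close>
    have "k * E0 * (E0 / E1) powr s \<le> low + y\<^sup>2 * hi"
    proof (cases "\<epsilon> * E0 \<le> low")
      case True
      have "(E0 / E1) powr s \<le> K powr s"
        using le E1 E0 assms by (intro powr_mono2) (auto simp: field_simps)
      then have "k * (E0 / E1) powr s \<le> (\<epsilon> / K powr s) * K powr s"
        using \<open>k > 0\<close> eps assms by (intro mult_mono) (auto simp: k_def)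
      then have "k * (E0 / E1) powr s \<le> \<epsilon>" using assms by simp
      then have "(k * (E0 / E1) powr s) * E0 \<le> \<epsilon> * E0" using E0 by (intro mult_right_mono) auto
      also have "\<dots> \<le> low + y\<^sup>2 * hi" using True mult_nonneg_nonneg[OF zero_le_power2[of y] nn(2)] by linarith
      finally show ?thesis by (simp add: mult_ac)
    next
      case False
      have rhi: "r\<^sup>2 * hi \<le> 2 * E1 + c3 * r\<^sup>2 * low"
      proof -
        have "r *\<^sub>R v = (r * y) *\<^sub>R q - r *\<^sub>R (y *\<^sub>R q - v)"
          by (simp add: scaleR_diff_right)
        then have "(norm (r *\<^sub>R v))\<^sup>2 \<le> 2 * (norm ((r * y) *\<^sub>R q))\<^sup>2 + 2 * (norm (r *\<^sub>R (y *\<^sub>R q - v)))\<^sup>2"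
          by (metis parallelogram le_add_same_cancel2 zero_le_power2)
        moreover have "(norm (r *\<^sub>R (y *\<^sub>R q - v)))\<^sup>2 + (norm (r *\<^sub>R z))\<^sup>2 \<le> E1"
          using assms(1) by (simp add: E1_def rot_energy1_def rot_energy_def)
        moreover have "2 * (norm ((r * y) *\<^sub>R q))\<^sup>2 \<le> c3 * r\<^sup>2 * low"
        proof -
          have "2 * (norm ((r * y) *\<^sub>R q))\<^sup>2 = 2 * r\<^sup>2 * (y\<^sup>2 * (norm q)\<^sup>2)"
            by (simp add: power_mult_distrib)
          also have "\<dots> \<le> 2 * r\<^sup>2 * (C\<^sup>2 * (norm q)\<^sup>2)"
            using y by (intro mult_left_mono mult_right_mono power_mono) auto
          also have "\<dots> = c3 * r\<^sup>2 * (\<tau> * (norm q)\<^sup>2)"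
            using assms(1) by (simp add: c3_def)
          also have "\<dots> \<le> c3 * r\<^sup>2 * low"
            using c3 by (intro mult_left_mono) (auto simp: low_def)
          finally show ?thesis .
        qed
        moreover have "r\<^sup>2 * hi = (norm (r *\<^sub>R v))\<^sup>2 + (norm (r *\<^sub>R z))\<^sup>2"
          by (simp add: hi_def power_mult_distrib distrib_left)
        moreover have "0 \<le> (norm (r *\<^sub>R z))\<^sup>2" by simp
        ultimately show ?thesis by linarith
      qed
      have "(1 + c3) * low \<le> (1 + c3) * (\<epsilon> * E0)"
        using False c3 by (intro mult_left_mono) auto
      also have "\<dots> = E0 / 2" using c3 by (simp add: \<epsilon>_def field_simps)
      finally have "low + c3 * low \<le> E0 / 2" by (simp add: distrib_right)
      then have "r\<^sup>2 * (low + c3 * low) \<le> r\<^sup>2 * (E0 / 2)" by (intro mult_left_mono) auto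
      moreover have "r\<^sup>2 * E0 \<le> 2 * E1 + r\<^sup>2 * (low + c3 * low)"
        using rhi by (simp add: E0_eq algebra_simps)
      ultimately have "r\<^sup>2 * E0 \<le> 4 * E1" by (simp add: algebra_simps)
      \<comment> \<open>Energy in the fast variables forces \<open>E1\<close> to be at least of size
        \<open>r^2 * E0\<close>. This upper bound on the frequency turns the assumed lower bound on
        \<open>y^2\<close> into one in terms of \<open>E0 / E1\<close>.\<close>
      then have r2: "r\<^sup>2 \<le> 4 / (E0 / E1)"
        using E0 E1 by (simp add: field_simps)
      have "(E0 / E1) powr s / 4 powr s = (4 / (E0 / E1)) powr (- s)"
        using E0 E1 by (simp add: powr_minus_divide powr_divide powr_mult)
      also have "\<dots> \<le> (r\<^sup>2) powr (- s)"
        using r r2 assms by (intro powr_mono2') auto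
      finally have "c * ((E0 / E1) powr s / 4 powr s) \<le> c * (r\<^sup>2) powr (- s)"
        using assms by (intro mult_left_mono) auto
      also note cy
      finally have cy': "c * ((E0 / E1) powr s / 4 powr s) \<le> y\<^sup>2" .
      have "k * (E0 / E1) powr s \<le> (c / 4 powr s / 2) * (E0 / E1) powr s"
        by (intro mult_right_mono) (auto simp: k_def)
      also have "\<dots> \<le> y\<^sup>2 / 2" using cy' by (simp add: field_simps)
      finally have "(k * (E0 / E1) powr s) * E0 \<le> y\<^sup>2 / 2 * E0"
        using E0 by (intro mult_right_mono) auto
      also have "\<dots> = y\<^sup>2 * (E0 / 2)" by simp
      also have "\<dots> \<le> y\<^sup>2 * hi"
      proof (intro mult_left_mono)
        have "\<epsilon> * E0 \<le> 1 / 2 * E0" using eps E0 by (intro mult_right_mono) auto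
        then show "E0 / 2 \<le> hi" using False E0_eq by linarith
      qed simp
      finally show ?thesis using nn by (simp add: mult_ac)
    qed
    then show ?thesis by (simp add: low_def hi_def)
  qed
  ultimately show ?thesis by blast
qed

section \<open>Decay along the modal flow\<close>

lemma rot_flow_decreasing:
  assumes "rot_flow \<tau> a r y p v z q" "\<tau> > 0" "t \<ge> 0"
  shows "rot_energy \<tau> (p t) (v t) (z t) (q t) \<le> rot_energy \<tau> (p 0) (v 0) (z 0) (q 0)"
  by (rule nonincreasing_from_derivative[OF rot_energy_derivative[OF assms(1)]]) (use assms in auto)

text \<open>The system is linear with constant coefficients, so the time derivative of a solution is
  again a solution, and its energy decreases as well.\<close>

lemma rot_flow_decreasing1:
  assumes flow: "rot_flow \<tau> a r y p v z q" and "\<tau> > 0" "t \<ge> 0"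
  shows "rot_energy1 \<tau> a r y (p t) (v t) (z t) (q t) \<le> rot_energy1 \<tau> a r y (p 0) (v 0) (z 0) (q 0)"
proof -
  have "rot_flow \<tau> a r y (\<lambda>t. a *\<^sub>R q t) (\<lambda>t. r *\<^sub>R z t) (\<lambda>t. r *\<^sub>R (y *\<^sub>R q t - v t))
     (\<lambda>t. (- (1 / \<tau>)) *\<^sub>R (q t + (r * y) *\<^sub>R z t + a *\<^sub>R p t))"
    unfolding rot_flow_def
    by (intro allI impI conjI bounded_linear.has_vector_derivative[OF bounded_linear_scaleR_right]
      has_vector_derivative_add has_vector_derivative_diff)
      (use flow in \<open>auto simp: rot_flow_def\<close>)
  from rot_flow_decreasing[OF this assms(2,3)] show ?thesis
    by (simp add: rot_energy1_def)
qed

text \<open>\<open>M\<close> is chosen before \<open>a\<close>, \<open>r\<close> and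
  \<open>y\<close>, hence independently of the mode. Since the higher energy decreases, replacing it
  by its initial value leaves a scalar inequality for the Lyapunov functional alone.\<close>

proposition rot_flow_decay:
  assumes "\<tau> > 0" "s > 0" "a0 > 0" "r0 > 0" "C > 0" "c > 0"
  shows "\<exists>M>0. \<forall>a r y. \<forall>p v z q :: real \<Rightarrow> 'a::chilbert_space. \<forall>t>0.
     rot_flow \<tau> a r y p v z q \<longrightarrow> a0 \<le> a \<longrightarrow> r0 \<le> r \<longrightarrow> a \<le> C * r \<longrightarrow> 0 \<le> y \<longrightarrow> y \<le> C \<longrightarrow>
     c * (r\<^sup>2) powr (- s) \<le> y\<^sup>2 \<longrightarrow>
     rot_energy \<tau> (p t) (v t) (z t) (q t)
       \<le> M * t powr (- (1 / s)) * rot_energy1 \<tau> a r y (p 0) (v 0) (z 0) (q 0)"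
proof -
  obtain K where K: "K > 0" and E01: "\<And>a r y. \<And>p v z q :: 'a. a0 \<le> a \<Longrightarrow> r0 \<le> r \<Longrightarrow> 0 \<le> y \<Longrightarrow> y \<le> C \<Longrightarrow>
      rot_energy \<tau> p v z q \<le> K * rot_energy1 \<tau> a r y p v z q"
    using rot_energy_le_energy1[OF assms(1,3,4,5)] by blast
  obtain k where k: "k > 0" and interp: "\<And>a r y. \<And>p v z q :: 'a. r > 0 \<Longrightarrow> 0 \<le> y \<Longrightarrow> y \<le> C \<Longrightarrow>
      c * (r\<^sup>2) powr (- s) \<le> y\<^sup>2 \<Longrightarrow> 0 < rot_energy \<tau> p v z q \<Longrightarrow>
      rot_energy \<tau> p v z q \<le> K * rot_energy1 \<tau> a r y p v z q \<Longrightarrow>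
      k * rot_energy \<tau> p v z q * (rot_energy \<tau> p v z q / rot_energy1 \<tau> a r y p v z q) powr s
       \<le> (norm p)\<^sup>2 + \<tau> * (norm q)\<^sup>2 + y\<^sup>2 * ((norm v)\<^sup>2 + (norm z)\<^sup>2)"
    using rot_interpolation[OF assms(1,2,5) K assms(6)] by blast
  define B where "B = (\<tau> / a0 + (C / a0 + 2 * C * C / r0) + 2 * \<tau> * C / r0 + C\<^sup>2 / r0) * (1 + 1 / \<tau>)"
  define R where "R = \<tau> / 2 + \<tau> + 2 * \<tau> * C\<^sup>2 + (1 / a0)\<^sup>2 / 2 + (1 + 2 * \<tau> + 3 * C\<^sup>2)\<^sup>2 / 2 + (2 / r0)\<^sup>2 / 2"
  \<comment> \<open>\<open>B + 1\<close> makes the Lyapunov functional dominate the energy, and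
    \<open>R\<close> is the amount needed to absorb the cross terms in the dissipation.\<close>
  define N where "N = B + 1 + R"
  have B: "B \<ge> 0" unfolding B_def using assms by (intro mult_nonneg_nonneg add_nonneg_nonneg) auto
  have rest: "R \<ge> 0"
    unfolding R_def using assms by (intro add_nonneg_nonneg) auto
  then have N1: "N \<ge> B + 1" by (simp add: N_def)
  have N2: "2 * N \<ge> \<tau> / 2 + \<tau> + 2 * \<tau> * C\<^sup>2 + (1 / a0)\<^sup>2 / 2 + (1 + 2 * \<tau> + 3 * C\<^sup>2)\<^sup>2 / 2 + (2 / r0)\<^sup>2 / 2"
    using B rest unfolding N_def R_def[symmetric] by simp
  \<comment> \<open>The factor 1/2 comes from the dissipation estimate; the power of
    \<open>2 * N\<close> comes from returning from \<open>E0\<close> to \<open>L\<close> by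
    \<open>L t \<le> 2 * N * E0 t\<close>.\<close>
  define \<kappa> where "\<kappa> = k / 2 / (2 * N) powr (1 + s)"
  have kap: "\<kappa> > 0" using k N1 B by (simp add: \<kappa>_def)
  define M where "M = (s * \<kappa>) powr (- (1 / s))"
  have "M > 0" using assms kap by (simp add: M_def)
  moreover have "rot_energy \<tau> (p t) (v t) (z t) (q t)
       \<le> M * t powr (- (1 / s)) * rot_energy1 \<tau> a r y (p 0) (v 0) (z 0) (q 0)"
    if t: "t > 0" and flow: "rot_flow \<tau> a r y p v z q" and bounds: "a0 \<le> a" "r0 \<le> r" "a \<le> C * r" "0 \<le> y" "y \<le> C"
      and cy: "c * (r\<^sup>2) powr (- s) \<le> y\<^sup>2"
    for a r y t and p v z q :: "real \<Rightarrow> 'a"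
  proof -
    have ar: "a > 0" "r > 0" using bounds assms by auto
    define E0 where "E0 t = rot_energy \<tau> (p t) (v t) (z t) (q t)" for t
    define E1 where "E1 t = rot_energy1 \<tau> a r y (p t) (v t) (z t) (q t)" for t
    define L where "L t = rot_lyap N \<tau> a r y (p t) (v t) (z t) (q t)" for t
    define L' where "L' t = - (norm (p t))\<^sup>2 - y\<^sup>2 * ((norm (z t))\<^sup>2 + (norm (v t))\<^sup>2) + (\<tau> + 2 * \<tau> * y\<^sup>2 - 2 * N) * (norm (q t))\<^sup>2
      + (- (1 / a)) * rinner (p t) (q t)
      + (1 - 2 * \<tau> + 2 * (a / r)\<^sup>2 + y\<^sup>2) * (y * rinner (v t) (q t)) + (- (2 / r)) * (y * rinner (z t) (q t))" for t
    have E0_nn: "E0 t \<ge> 0" for t unfolding E0_def by (rule rot_energy_nonneg[OF assms(1)])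
    have E0E1: "E0 t \<le> K * E1 t" for t unfolding E0_def E1_def using E01 bounds by blast
    have LE: "E0 t \<le> L t" "L t \<le> 2 * N * E0 t" for t
    proof -
      have "\<bar>L t - N * E0 t\<bar> \<le> B * E0 t"
        unfolding L_def E0_def B_def mult.assoc[of _ "1 + 1 / \<tau>"]
        by (rule rot_lyap_equiv) (use assms bounds in auto)
      moreover have "(B + 1) * E0 t \<le> N * E0 t" using N1 E0_nn by (intro mult_right_mono)
      ultimately show "E0 t \<le> L t" "L t \<le> 2 * N * E0 t"
        using E0_nn[of t] by (auto simp: abs_le_iff distrib_right)
    qed
    show ?thesis
    proof (cases "E0 t = 0")
      case True
      have "0 \<le> M * t powr (- (1 / s)) * E1 0"
        using \<open>M > 0\<close> rot_energy_nonneg[OF assms(1)] unfolding E1_def rot_energy1_def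
        by (intro mult_nonneg_nonneg) auto
      then show ?thesis using True by (simp add: E0_def E1_def)
    next
      case False
      have E1le: "E1 x \<le> E1 0" if "x \<ge> 0" for x
        unfolding E1_def by (rule rot_flow_decreasing1[OF flow assms(1) that])
      have "0 < E0 t" using E0_nn[of t] False by simp
      then have "0 < K * E1 0"
        using E0E1[of t] E1le[of t] t K by (smt (verit) mult_left_mono)
      then have G: "E1 0 > 0" using K by (simp add: zero_less_mult_iff)
      have "L t \<le> (s * (\<kappa> / E1 0 powr s) * t) powr (- (1 / s))"
      proof (rule polynomial_decay_from_derivative[where L' = L'])
        fix x :: real assume x: "x \<ge> 0"
        show "(L has_real_derivative L' x) (at x within {0..})"
          unfolding L_def L'_def by (rule rot_lyap_derivative[OF flow x assms(1) ar])
        show "0 \<le> L x" using LE(1) E0_nn order_trans by blast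
        show "L' x \<le> - (\<kappa> / E1 0 powr s * L x powr (1 + s))"
        proof (cases "E0 x = 0")
          \<comment> \<open>At the zero state the quotient \<open>E0 x / E1 x\<close> gives nothing,
            but \<open>L x = 0\<close> and \<open>0 powr (1 + s) = 0\<close>, so it suffices that
            \<open>L\<close> does not increase.\<close>
          case True
          then have "L x = 0" using LE[of x] by simp
          moreover have "L' x \<le> 0"
          proof -
            have "L' x \<le> - (1 / 2) * ((norm (p x))\<^sup>2 + \<tau> * (norm (q x))\<^sup>2 + y\<^sup>2 * ((norm (v x))\<^sup>2 + (norm (z x))\<^sup>2))"
              unfolding L'_def by (rule rot_dissipation[OF assms(1,3,4) bounds N2])
            also have "\<dots> \<le> 0" using assms by simp
            finally show ?thesis .
          qed
          ultimately show ?thesis using assms by simp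
        next
          case False
          then have E0p: "E0 x > 0" using E0_nn[of x] by simp
          have E1p: "E1 x > 0" using E0p E0E1[of x] K by (smt (verit) mult_nonneg_nonpos)
          have "L' x \<le> - (1 / 2) * ((norm (p x))\<^sup>2 + \<tau> * (norm (q x))\<^sup>2 + y\<^sup>2 * ((norm (v x))\<^sup>2 + (norm (z x))\<^sup>2))"
            unfolding L'_def by (rule rot_dissipation[OF assms(1,3,4) bounds N2])
          moreover have "k * E0 x * (E0 x / E1 x) powr s
              \<le> (norm (p x))\<^sup>2 + \<tau> * (norm (q x))\<^sup>2 + y\<^sup>2 * ((norm (v x))\<^sup>2 + (norm (z x))\<^sup>2)"
            unfolding E0_def E1_def
            by (rule interp) (use ar bounds cy E0p E0E1[of x] in \<open>auto simp: E0_def E1_def\<close>)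
          moreover have "\<kappa> / E1 0 powr s * L x powr (1 + s) \<le> 1 / 2 * (k * E0 x * (E0 x / E1 x) powr s)"
          proof -
            have "L x powr (1 + s) \<le> (2 * N * E0 x) powr (1 + s)"
              using LE[of x] E0p assms by (intro powr_mono2) auto
            also have "\<dots> = (2 * N) powr (1 + s) * (E0 x * E0 x powr s)"
              using N1 B E0p by (simp add: powr_mult powr_add)
            finally have "\<kappa> / E1 0 powr s * L x powr (1 + s)
                \<le> \<kappa> / E1 0 powr s * ((2 * N) powr (1 + s) * (E0 x * E0 x powr s))"
              using kap by (intro mult_left_mono) auto
            also have "\<dots> = k / 2 * E0 x * (E0 x powr s / E1 0 powr s)"
              using N1 B by (simp add: \<kappa>_def)
            also have "\<dots> \<le> k / 2 * E0 x * (E0 x powr s / E1 x powr s)"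
              using k E0p E1p E1le[OF x] assms
              by (intro mult_left_mono divide_left_mono powr_mono2) auto
            also have "E0 x powr s / E1 x powr s = (E0 x / E1 x) powr s"
              using E0p E1p by (simp add: powr_divide)
            finally show ?thesis by simp
          qed
          moreover have "l \<le> - (1 / 2) * d \<Longrightarrow> e \<le> d \<Longrightarrow> m \<le> 1 / 2 * e \<Longrightarrow> l \<le> - m" for l d e m :: real
            by simp
          ultimately show ?thesis by blast
        qed
      qed (use kap G assms t in auto)
      \<comment> \<open>The powers \<open>- s\<close> and \<open>- (1 / s)\<close> cancel on
        \<open>E1 0\<close>: the bound is linear in the initial higher energy, as it must be to be
        summed over modes.\<close>
      also have "\<dots> = ((s * \<kappa>) * t * E1 0 powr (- s)) powr (- (1 / s))"
        by (simp add: powr_minus_divide)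
      also have "\<dots> = M * t powr (- (1 / s)) * (E1 0 powr (- s)) powr (- (1 / s))"
        using assms kap t G by (simp add: powr_mult M_def)
      also have "(E1 0 powr (- s)) powr (- (1 / s)) = E1 0"
        using assms G by (simp add: powr_powr)
      finally show ?thesis
        using LE(1)[of t] by (simp add: E0_def E1_def)
    qed
  qed
  ultimately show ?thesis by blast
qed


section \<open>Orbits of contraction semigroups\<close>

locale contraction_semigroup_generator =
  fixes S :: "'e::complex_vector set" and N :: "'e \<Rightarrow> real" and T Gd G
  assumes S: "csubspace S" and N: "\<And>U. N U \<ge> 0"
    and sg: "C0_contraction_semigroup S N T" and gen: "has_generator S N T Gd G"
    and GdS: "Gd \<subseteq> S" and GS: "\<And>U. U \<in> Gd \<Longrightarrow> G U \<in> S"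
begin

lemma T_in: "t \<ge> 0 \<Longrightarrow> U \<in> S \<Longrightarrow> T t U \<in> S"
  and T_lin: "t \<ge> 0 \<Longrightarrow> clinear_on S (T t)"
  and T_contr: "t \<ge> 0 \<Longrightarrow> U \<in> S \<Longrightarrow> N (T t U) \<le> N U"
  and T_0: "U \<in> S \<Longrightarrow> T 0 U = U"
  and T_add: "s \<ge> 0 \<Longrightarrow> t \<ge> 0 \<Longrightarrow> U \<in> S \<Longrightarrow> T (s + t) U = T s (T t U)"
  and T_cont: "U \<in> S \<Longrightarrow> ((\<lambda>t. N (T t U - U)) \<longlongrightarrow> 0) (at_right 0)"
  using sg by (auto simp: C0_contraction_semigroup_def)

lemma T_diff: "t \<ge> 0 \<Longrightarrow> U \<in> S \<Longrightarrow> V \<in> S \<Longrightarrow> T t (U - V) = T t U - T t V"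
  by (rule clinear_on_diff[OF T_lin S])

lemma T_scaleR: "t \<ge> 0 \<Longrightarrow> U \<in> S \<Longrightarrow> T t (c *\<^sub>R U) = c *\<^sub>R T t U"
  by (rule clinear_on_scaleR[OF T_lin])

lemma generator_limit: "U \<in> Gd \<Longrightarrow> ((\<lambda>h. N ((1 / h) *\<^sub>R (T h U - U) - G U)) \<longlongrightarrow> 0) (at_right 0)"
  using gen GdS GS unfolding has_generator_def by blast

text \<open>\<open>T t\<close> commutes with the difference quotients at 0 and contracts their
  error. The limit so obtained identifies domain membership and value at once, because
  \<open>has_generator\<close> is an equivalence.\<close>

lemma generator_commute:
  assumes U: "U \<in> Gd" and t: "t \<ge> 0"
  shows "T t U \<in> Gd" "G (T t U) = T t (G U)"
proof -
  have US: "U \<in> S" "G U \<in> S" using U GdS GS by auto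
  have "((\<lambda>h. N ((1 / h) *\<^sub>R (T h (T t U) - T t U) - T t (G U))) \<longlongrightarrow> 0) (at_right 0)"
  proof (rule tendsto_sandwich[OF _ _ tendsto_const generator_limit[OF U]])
    show "\<forall>\<^sub>F h in at_right 0. N ((1 / h) *\<^sub>R (T h (T t U) - T t U) - T t (G U))
        \<le> N ((1 / h) *\<^sub>R (T h U - U) - G U)"
      unfolding eventually_at_right_field
    proof (intro exI[of _ 1] conjI allI impI)
      fix h :: real assume "0 < h"
      then have h: "h \<ge> 0" by simp
      have ThU: "T h U \<in> S" by (rule T_in[OF h US(1)])
      have "T h (T t U) = T t (T h U)"
        using T_add[OF h t US(1)] T_add[OF t h US(1)] by (simp add: add.commute)
      then have "(1 / h) *\<^sub>R (T h (T t U) - T t U) - T t (G U) = T t ((1 / h) *\<^sub>R (T h U - U) - G U)"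
        using ThU US t by (simp add: T_diff T_scaleR csubspace_diff[OF S] csubspace_scaleR[OF S])
      then show "N ((1 / h) *\<^sub>R (T h (T t U) - T t U) - T t (G U)) \<le> N ((1 / h) *\<^sub>R (T h U - U) - G U)"
        using ThU US t by (simp add: T_contr csubspace_diff[OF S] csubspace_scaleR[OF S])
    qed simp
  qed (simp add: N)
  then have "T t U \<in> Gd \<and> T t (G U) = G (T t U)"
    using gen T_in[OF t] US unfolding has_generator_def by blast
  then show "T t U \<in> Gd" "G (T t U) = T t (G U)" by auto
qed

text \<open>
  The generator only provides right derivatives; the contraction property upgrades them to
  two-sided ones.
\<close>

lemma orbit_has_vector_derivative:
  fixes J :: "'e \<Rightarrow> 'b::real_normed_vector"
  assumes J: "\<And>X Y. J (X - Y) = J X - J Y" "\<And>c X. J (c *\<^sub>R X) = c *\<^sub>R J X"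
    and Jb: "\<And>X. X \<in> S \<Longrightarrow> norm (J X) \<le> C * N X"
    and U: "U \<in> Gd" and t: "t \<ge> 0"
  shows "((\<lambda>t. J (T t U)) has_vector_derivative J (G (T t U))) (at t within {0..})"
proof -
  have US: "U \<in> S" "G U \<in> S" using U GdS GS by auto
  define R where "R h = (1 / h) *\<^sub>R (T h U - U) - G U" for h
  have RS: "R h \<in> S" if "h \<ge> 0" for h
    unfolding R_def by (intro csubspace_diff csubspace_scaleR S US T_in that)
  have R_lim: "(R' \<longlongrightarrow> 0) (at_right 0)" if "R' = (\<lambda>h. \<bar>C\<bar> * (N (R h) + N (T h (G U) - G U)))" for R'
  proof -
    have "((\<lambda>h. \<bar>C\<bar> * (N (R h) + N (T h (G U) - G U))) \<longlongrightarrow> \<bar>C\<bar> * (0 + 0)) (at_right 0)"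
      unfolding R_def by (intro tendsto_intros generator_limit[OF U] T_cont US)
    then show ?thesis using that by simp
  qed
  have Jb': "norm (J X) \<le> \<bar>C\<bar> * N Y" if "X \<in> S" "N X \<le> N Y" for X Y
  proof -
    have "norm (J X) \<le> C * N X" by (rule Jb[OF that(1)])
    also have "\<dots> \<le> \<bar>C\<bar> * N Y" using that(2) N by (intro mult_mono) auto
    finally show ?thesis .
  qed
  have incr: "T h U - U = h *\<^sub>R (R h + G U)" if "h > 0" for h
    using that by (simp add: R_def)
  show ?thesis
    unfolding has_vector_derivative_def has_derivative_within_alt
  proof (intro conjI allI impI)
    show "bounded_linear (\<lambda>x. x *\<^sub>R J (G (T t U)))" by (rule bounded_linear_scaleR_left)
    fix e :: real assume "e > 0"
    have "\<forall>\<^sub>F h in at_right 0. \<bar>C\<bar> * (N (R h) + N (T h (G U) - G U)) < e"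
      using order_tendstoD(2)[OF R_lim[OF refl] \<open>e > 0\<close>] .
    \<comment> \<open>One \<open>d\<close> serves both sides of \<open>t\<close>: the first summand
      controls times after \<open>t\<close>, both together those before.\<close>
    then obtain d where d: "d > 0"
      and small: "\<And>h. 0 < h \<Longrightarrow> h < d \<Longrightarrow> \<bar>C\<bar> * (N (R h) + N (T h (G U) - G U)) < e"
      unfolding eventually_at_right_field by blast
    show "\<exists>d>0. \<forall>x\<in>{0..}. norm (x - t) < d \<longrightarrow>
       norm (J (T x U) - J (T t U) - (x - t) *\<^sub>R J (G (T t U))) \<le> e * norm (x - t)"
    proof (intro exI[of _ d] conjI ballI impI d)
      fix x :: real assume x: "x \<in> {0..}" and xd: "norm (x - t) < d"
      consider "x = t" | "x > t" | "x < t" by linarith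
      then show "norm (J (T x U) - J (T t U) - (x - t) *\<^sub>R J (G (T t U))) \<le> e * norm (x - t)"
      proof cases
        case 1
        then show ?thesis by simp
      next
        case 2
        define h where "h = x - t"
        have h: "h > 0" "h < d" using 2 xd by (auto simp: h_def)
        have "T x U = T t (T h U)" using T_add[OF t _ US(1), of h] h by (simp add: h_def)
        then have "T x U - T t U - h *\<^sub>R G (T t U) = T t (T h U - U - h *\<^sub>R G U)"
          using h t US by (simp add: generator_commute[OF U t] T_diff T_scaleR T_in csubspace_diff[OF S] csubspace_scaleR[OF S])
        also have "T h U - U - h *\<^sub>R G U = h *\<^sub>R R h"
          using incr[OF h(1)] by (simp add: algebra_simps)
        finally have eq: "J (T x U) - J (T t U) - h *\<^sub>R J (G (T t U)) = h *\<^sub>R J (T t (R h))"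
          using h t RS[of h] by (metis J T_scaleR less_imp_le)
        have "norm (J (T t (R h))) \<le> \<bar>C\<bar> * N (R h)"
          using RS[of h] h t by (intro Jb' T_in T_contr) auto
        also have "\<dots> \<le> \<bar>C\<bar> * (N (R h) + N (T h (G U) - G U))"
          using N by (intro mult_left_mono) auto
        also have "\<dots> \<le> e" using small[OF h] by simp
        finally show ?thesis
          using h by (simp add: h_def[symmetric] eq mult.commute)
      next
        case 3
        define h where "h = t - x"
        have h: "h > 0" "h < d" using 3 xd by (auto simp: h_def)
        have x0: "x \<ge> 0" using x by simp
        have ThG: "T h (G U) \<in> S" "T h U \<in> S" using h by (auto intro: T_in US)
        have "T t U = T x (T h U)" "T t (G U) = T x (T h (G U))"
          using T_add[OF x0 _ US(1), of h] T_add[OF x0 _ US(2), of h] h by (simp_all add: h_def)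
        then have "T t U - T x U - h *\<^sub>R G (T t U) = T x (T h U - U - h *\<^sub>R T h (G U))"
          using h x0 ThG US unfolding generator_commute(2)[OF U t]
          by (simp add: T_diff T_scaleR csubspace_diff[OF S] csubspace_scaleR[OF S])
        \<comment> \<open>Seen from the earlier time \<open>x\<close>, the expected derivative is
          \<open>T h (G U)\<close> instead of \<open>G U\<close>. The discrepancy is controlled by
          strong continuity at 0, and \<open>T x\<close> contracts it uniformly in
          \<open>x\<close>.\<close>
        also have "T h U - U - h *\<^sub>R T h (G U) = h *\<^sub>R (R h - (T h (G U) - G U))"
          using incr[OF h(1)] by (simp add: algebra_simps)
        also have "T x \<dots> = h *\<^sub>R (T x (R h) - T x (T h (G U) - G U))"
          using h x0 RS[of h] ThG US by (simp add: T_scaleR T_diff csubspace_diff[OF S])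
        finally have eq: "J (T t U) - J (T x U) - h *\<^sub>R J (G (T t U)) = h *\<^sub>R (J (T x (R h)) - J (T x (T h (G U) - G U)))"
          by (metis J)
        have "norm (J (T x (R h)) - J (T x (T h (G U) - G U)))
            \<le> norm (J (T x (R h))) + norm (J (T x (T h (G U) - G U)))"
          by (rule norm_triangle_ineq4)
        also have "\<dots> \<le> \<bar>C\<bar> * N (R h) + \<bar>C\<bar> * N (T h (G U) - G U)"
          using RS[of h] h x0 ThG US by (intro add_mono Jb' T_in T_contr csubspace_diff[OF S]) auto
        also have "\<dots> = \<bar>C\<bar> * (N (R h) + N (T h (G U) - G U))" by (simp add: distrib_left)
        also have "\<dots> \<le> e" using small[OF h] by simp
        finally have "norm (J (T t U) - J (T x U) - h *\<^sub>R J (G (T t U))) \<le> e * h"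
          unfolding eq using h by (simp add: mult.commute)
        moreover have "J (T x U) - J (T t U) - (x - t) *\<^sub>R J (G (T t U))
            = - (J (T t U) - J (T x U) - h *\<^sub>R J (G (T t U)))"
          by (simp add: h_def algebra_simps)
        then have "norm (J (T x U) - J (T t U) - (x - t) *\<^sub>R J (G (T t U)))
            = norm (J (T t U) - J (T x U) - h *\<^sub>R J (G (T t U)))"
          by (simp only: norm_minus_cancel)
        moreover have "norm (x - t) = h" using h by (simp add: h_def)
        ultimately show ?thesis by simp
      qed
    qed
  qed
qed

end


section \<open>The modes of the Cattaneo system\<close>

lemma summable_on_nonneg_comparison:
  fixes f g :: "'i \<Rightarrow> real"
  assumes "g summable_on I" "\<And>i. i \<in> I \<Longrightarrow> 0 \<le> f i" "\<And>i. i \<in> I \<Longrightarrow> f i \<le> g i"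
  shows "f summable_on I"
proof -
  have "(\<lambda>i. norm (g i)) summable_on I"
    using assms(1) summable_on_iff_abs_summable_on_real by blast
  then have "(\<lambda>i. norm (f i)) summable_on I"
    by (rule Infinite_Sum.abs_summable_on_comparison_test) (use assms in force)
  then show ?thesis using summable_on_iff_abs_summable_on_real by blast
qed

text \<open>With \<open>m\<close> the lower end of the spectrum this is how a lower power of an
  eigenvalue is absorbed into a higher one; the negative power of \<open>m\<close> is the cost when
  \<open>m\<close> is small.\<close>

lemma powr_le_powr_const:
  fixes l m a b :: real
  assumes "0 < m" "m \<le> l" "a \<le> b"
  shows "l powr a \<le> m powr (a - b) * l powr b"
proof -
  have "l powr a = l powr (a - b) * l powr b"
    using assms by (simp flip: powr_add)
  also have "\<dots> \<le> m powr (a - b) * l powr b"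
    using assms by (intro mult_right_mono powr_mono2') auto
  finally show ?thesis .
qed

locale cattaneo_system = positive_discrete_operator D A
  for D :: "'h::chilbert_space set" and A +
  fixes \<sigma> \<tau> \<alpha> \<beta> :: real
  assumes sigma: "\<sigma> > 0" and tau: "\<tau> > 0" and alpha: "0 \<le> \<alpha>" "\<alpha> \<le> 1" and beta: "0 \<le> \<beta>" "\<beta> \<le> 1"
    and ab: "2 * \<alpha> \<le> 1 + \<beta>"
begin

abbreviation "S \<equiv> state_space D A"
abbreviation "N \<equiv> state_norm D A \<sigma> \<tau>"
abbreviation "Gd \<equiv> system_dom D A \<sigma> \<alpha> \<beta>"
abbreviation "G \<equiv> system_op D A \<sigma> \<tau> \<alpha> \<beta>"

section \<open>The state norm in spectral components\<close>

definition mode_energy :: "real \<Rightarrow> 'h \<Rightarrow> 'h \<Rightarrow> 'h \<Rightarrow> 'h \<Rightarrow> real" where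
  "mode_energy l u v \<theta> q = \<sigma> * l * (norm u)\<^sup>2 + (norm v)\<^sup>2 + (norm \<theta>)\<^sup>2 + \<tau> * (norm q)\<^sup>2"

definition state_energy :: "real \<Rightarrow> 'h state \<Rightarrow> real" where
  "state_energy l = (\<lambda>(u, v, \<theta>, q). mode_energy l (P l u) (P l v) (P l \<theta>) (P l q))"

lemma pow_dom_iff: "u \<in> pow_dom D A s \<longleftrightarrow> (\<lambda>l. (l powr s * norm (P l u))\<^sup>2) summable_on ev"
  by (simp add: pow_dom_def scale_space_def components_def spectral_proj_in)

lemma pow_dom_half_iff: "u \<in> pow_dom D A (1/2) \<longleftrightarrow> (\<lambda>l. l * (norm (P l u))\<^sup>2) summable_on ev"
  unfolding pow_dom_iff
proof (rule summable_on_cong)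
  fix l assume "l \<in> ev"
  then have "l > 0" by (rule eigenvalue_pos)
  then show "(l powr (1/2) * norm (P l u))\<^sup>2 = l * (norm (P l u))\<^sup>2"
    by (simp add: powr_half_sqrt power_mult_distrib)
qed

lemma pow_op_half_norm:
  assumes "u \<in> pow_dom D A (1/2)"
  shows "((\<lambda>l. l * (norm (P l u))\<^sup>2) has_sum (norm (pow_op D A (1/2) u))\<^sup>2) ev"
proof -
  have sq: "(norm (l powr (1/2) *\<^sub>R P l u))\<^sup>2 = l * (norm (P l u))\<^sup>2" if "l \<in> ev" for l
    using eigenvalue_pos[OF that] by (simp add: powr_half_sqrt power_mult_distrib)
  have s1: "(\<lambda>l. l * (norm (P l u))\<^sup>2) summable_on ev"
    using assms pow_dom_half_iff by blast
  have "(\<lambda>l. (norm (l powr (1/2) *\<^sub>R P l u))\<^sup>2) summable_on ev \<longleftrightarrow> (\<lambda>l. l * (norm (P l u))\<^sup>2) summable_on ev"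
    by (intro summable_on_cong sq)
  with s1 have s2: "(\<lambda>l. (norm (l powr (1/2) *\<^sub>R P l u))\<^sup>2) summable_on ev"
    by blast
  have "(norm (pow_op D A (1/2) u))\<^sup>2 = (\<Sum>\<^sub>\<infinity>l\<in>ev. (norm (l powr (1/2) *\<^sub>R P l u))\<^sup>2)"
    unfolding pow_op_def
    by (rule riesz_fischer(2)[OF _ s2]) (intro csubspace_scaleR eigenspace_csubspace spectral_proj_in)
  also have "\<dots> = (\<Sum>\<^sub>\<infinity>l\<in>ev. l * (norm (P l u))\<^sup>2)"
    by (intro infsum_cong sq)
  finally show ?thesis using has_sum_infsum[OF s1] by simp
qed

lemma state_norm_eq: "N (u, v, \<theta>, q) =
    sqrt (\<sigma> * (norm (pow_op D A (1/2) u))\<^sup>2 + (norm v)\<^sup>2 + (norm \<theta>)\<^sup>2 + \<tau> * (norm q)\<^sup>2)"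
  by (simp add: state_norm_def state_inner_def cinner_self flip: of_real_mult of_real_power)

lemma state_norm_sq: "(N (u, v, \<theta>, q))\<^sup>2 =
    \<sigma> * (norm (pow_op D A (1/2) u))\<^sup>2 + (norm v)\<^sup>2 + (norm \<theta>)\<^sup>2 + \<tau> * (norm q)\<^sup>2"
  unfolding state_norm_eq using sigma tau by (intro real_sqrt_pow2) simp

lemma state_norm_nonneg: "N U \<ge> 0"
  using sigma tau by (cases U) (simp add: state_norm_eq)

lemma state_energy_has_sum:
  assumes "U \<in> S"
  shows "((\<lambda>l. state_energy l U) has_sum (N U)\<^sup>2) ev"
proof -
  obtain u v \<theta> q where U: "U = (u, v, \<theta>, q)" by (cases U)
  have "((\<lambda>l. \<sigma> * (l * (norm (P l u))\<^sup>2) + (norm (P l v))\<^sup>2 + (norm (P l \<theta>))\<^sup>2 + \<tau> * (norm (P l q))\<^sup>2)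
     has_sum (\<sigma> * (norm (pow_op D A (1/2) u))\<^sup>2 + (norm v)\<^sup>2 + (norm \<theta>)\<^sup>2 + \<tau> * (norm q)\<^sup>2)) ev"
    using assms U
    by (intro has_sum_add has_sum_cmult_right parseval pow_op_half_norm) (simp add: state_space_def)
  then show ?thesis
    by (simp add: U state_norm_sq state_energy_def mode_energy_def mult.assoc)
qed

lemma mode_energy_nonneg: "l \<in> ev \<Longrightarrow> mode_energy l u v \<theta> q \<ge> 0"
  using eigenvalue_pos[of l] sigma tau by (simp add: mode_energy_def)

lemma state_energy_nonneg: "l \<in> ev \<Longrightarrow> state_energy l U \<ge> 0"
  by (cases U) (simp add: state_energy_def mode_energy_nonneg)

lemma state_energy_le_norm: "U \<in> S \<Longrightarrow> l \<in> ev \<Longrightarrow> state_energy l U \<le> (N U)\<^sup>2"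
  using finite_sum_le_has_sum[OF state_energy_has_sum, of U "{l}"] state_energy_nonneg by simp

lemma state_norm_le:
  assumes "U \<in> S" "V \<in> S" "K \<ge> 0" "\<And>l. l \<in> ev \<Longrightarrow> state_energy l U \<le> K * state_energy l V"
  shows "N U \<le> sqrt K * N V"
proof (rule power2_le_imp_le)
  have "(N U)\<^sup>2 \<le> K * (N V)\<^sup>2"
    by (rule has_sum_mono[OF state_energy_has_sum[OF assms(1)] has_sum_cmult_right[OF state_energy_has_sum[OF assms(2)]]])
       (rule assms(4))
  then show "(N U)\<^sup>2 \<le> (sqrt K * N V)\<^sup>2" using assms(3) by (simp add: power_mult_distrib)
  show "0 \<le> sqrt K * N V" using assms(3) state_norm_nonneg by simp
qed

lemma pow_dom_csubspace: "csubspace (pow_dom D A (1/2))"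
proof -
  have "x + y \<in> pow_dom D A (1/2)" if "x \<in> pow_dom D A (1/2)" "y \<in> pow_dom D A (1/2)" for x y
    unfolding pow_dom_half_iff
  proof (rule summable_on_nonneg_comparison)
    show "(\<lambda>l. 2 * (l * (norm (P l x))\<^sup>2) + 2 * (l * (norm (P l y))\<^sup>2)) summable_on ev"
      using that by (intro summable_on_add summable_on_cmult_right) (auto simp: pow_dom_half_iff)
    fix l assume l: "l \<in> ev"
    show "0 \<le> l * (norm (P l (x + y)))\<^sup>2" using eigenvalue_pos[OF l] by simp
    have "(norm (P l x + P l y))\<^sup>2 \<le> 2 * (norm (P l x))\<^sup>2 + 2 * (norm (P l y))\<^sup>2"
      by (metis parallelogram le_add_same_cancel1 zero_le_power2)
    then have "l * (norm (P l x + P l y))\<^sup>2 \<le> l * (2 * (norm (P l x))\<^sup>2 + 2 * (norm (P l y))\<^sup>2)"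
      using eigenvalue_pos[OF l] by (intro mult_left_mono) auto
    then show "l * (norm (P l (x + y)))\<^sup>2 \<le> 2 * (l * (norm (P l x))\<^sup>2) + 2 * (l * (norm (P l y))\<^sup>2)"
      by (simp add: spectral_proj_add algebra_simps)
  qed
  moreover have "c *\<^sub>C x \<in> pow_dom D A (1/2)" if "x \<in> pow_dom D A (1/2)" for c x
  proof -
    have "(\<lambda>l. (cmod c)\<^sup>2 * (l * (norm (P l x))\<^sup>2)) summable_on ev"
      using that by (intro summable_on_cmult_right) (simp add: pow_dom_half_iff)
    then show ?thesis
      by (simp add: pow_dom_half_iff spectral_proj_scaleC norm_scaleC power_mult_distrib mult.left_commute)
  qed
  moreover have "0 \<in> pow_dom D A (1/2)"
    using linear_0[OF bounded_linear.linear[OF bounded_linear_spectral_proj]] by (simp add: pow_dom_half_iff)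
  ultimately show ?thesis by (auto simp: csubspace_def)
qed

lemma state_space_csubspace: "csubspace S"
  using pow_dom_csubspace
  by (auto simp: csubspace_def state_space_def scaleC_prod_def zero_prod_def)

section \<open>The generator in spectral components\<close>

lemma components_inject: "components D A x = components D A y \<Longrightarrow> x = y"
  by (rule eq_from_components) (metis components_def)

lemma spectral_proj_scale_to_H:
  assumes "scale_in_H D A c"
  shows "P l (scale_to_H D A c) = c l"
proof -
  have "\<exists>!w. components D A w = c"
    using assms components_inject by (auto simp: scale_in_H_def)
  then have "components D A (scale_to_H D A c) = c"
    unfolding scale_to_H_def by (rule theI')
  then show ?thesis by (metis components_def)
qed

lemma scale_to_H_components: "scale_to_H D A (components D A w) = w"
  unfolding scale_to_H_def using components_inject by blast

lemma system_dom_subset: "Gd \<subseteq> S"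
  by (auto simp: system_dom_def)

lemma system_op_in: "U \<in> Gd \<Longrightarrow> G U \<in> S"
  by (cases U) (auto simp: system_dom_def system_op_def state_space_def)

lemma spectral_proj_scaleR: "P l (c *\<^sub>R x) = c *\<^sub>R P l x"
  by (simp add: scaleR_eq_scaleC spectral_proj_scaleC)

lemma spectral_proj_diff: "P l (x - y) = P l x - P l y"
  by (rule linear_diff[OF bounded_linear.linear[OF bounded_linear_spectral_proj]])

text \<open>All later arguments use the generator only through these modal equations. They hold for
  every real \<open>l\<close>, not just on the spectrum, which is why \<open>l powr 1\<close> is
  left unsimplified.\<close>

lemma system_op_modes:
  assumes "(u, v, \<theta>, q) \<in> Gd" and "G (u, v, \<theta>, q) = (u', v', \<theta>', q')"
  shows "P l u' = P l v" "P l v' = l powr \<alpha> *\<^sub>R P l \<theta> - (\<sigma> * l powr 1) *\<^sub>R P l u"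
    "P l \<theta>' = l powr (\<beta>/2) *\<^sub>R P l q - l powr \<alpha> *\<^sub>R P l v"
    "P l q' = (- (1 / \<tau>)) *\<^sub>R (P l q + l powr (\<beta>/2) *\<^sub>R P l \<theta>)"
proof -
  have eqs: "u' = v" "v' = scale_to_H D A (momentum_part D A \<sigma> \<alpha> u \<theta>)"
    "\<theta>' = scale_to_H D A (heat_part D A \<alpha> \<beta> v q)" "q' = (1 / \<tau>) *\<^sub>R scale_to_H D A (flux_part D A \<beta> \<theta> q)"
    using assms(2) by (auto simp: system_op_def)
  have sc: "scale_in_H D A (momentum_part D A \<sigma> \<alpha> u \<theta>)" "scale_in_H D A (heat_part D A \<alpha> \<beta> v q)"
    "scale_in_H D A (flux_part D A \<beta> \<theta> q)"
    using assms(1) by (auto simp: system_dom_def)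
  show "P l u' = P l v" by (simp add: eqs)
  show "P l v' = l powr \<alpha> *\<^sub>R P l \<theta> - (\<sigma> * l powr 1) *\<^sub>R P l u"
    unfolding eqs spectral_proj_scale_to_H[OF sc(1)]
    by (simp add: momentum_part_def scale_pow_def components_def)
  show "P l \<theta>' = l powr (\<beta>/2) *\<^sub>R P l q - l powr \<alpha> *\<^sub>R P l v"
    unfolding eqs spectral_proj_scale_to_H[OF sc(2)]
    by (simp add: heat_part_def scale_pow_def components_def)
  show "P l q' = (- (1 / \<tau>)) *\<^sub>R (P l q + l powr (\<beta>/2) *\<^sub>R P l \<theta>)"
    unfolding eqs spectral_proj_scaleR spectral_proj_scale_to_H[OF sc(3)]
    by (simp add: flux_part_def scale_pow_def components_def algebra_simps)
qed

section \<open>The rotation of a mode and its couplings\<close>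

definition freq :: "real \<Rightarrow> real" where
  "freq l = sqrt (\<sigma> * l + l powr (2 * \<alpha>))"

definition slow_coupling :: "real \<Rightarrow> real" where
  "slow_coupling l = l powr (\<beta>/2) * sqrt (\<sigma> * l) / freq l"

definition fast_coupling :: "real \<Rightarrow> real" where
  "fast_coupling l = l powr (\<beta>/2) * l powr \<alpha> / (freq l)\<^sup>2"

text \<open>With \<open>w = sqrt (\<sigma> * l) *\<^sub>R u\<close>, the slow and fast parts are
  \<open>(w, \<theta>)\<close> in rotated coordinates with cosine
  \<open>l powr \<alpha> / freq l\<close> and sine \<open>sqrt (\<sigma> * l) / freq l\<close>. The
  fast direction is the normalised force on \<open>v\<close>; the slow one is orthogonal to it and
  exerts no force.\<close>

definition slow_part :: "real \<Rightarrow> 'h \<Rightarrow> 'h \<Rightarrow> 'h" where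
  "slow_part l u \<theta> = (1 / freq l) *\<^sub>R ((l powr \<alpha> * sqrt (\<sigma> * l)) *\<^sub>R u + sqrt (\<sigma> * l) *\<^sub>R \<theta>)"

definition fast_part :: "real \<Rightarrow> 'h \<Rightarrow> 'h \<Rightarrow> 'h" where
  "fast_part l u \<theta> = (1 / freq l) *\<^sub>R (l powr \<alpha> *\<^sub>R \<theta> - (\<sigma> * l) *\<^sub>R u)"

lemma freq_pos: "l > 0 \<Longrightarrow> freq l > 0"
  using sigma by (simp add: freq_def add_pos_pos)

lemma freq_sq: "l > 0 \<Longrightarrow> (freq l)\<^sup>2 = \<sigma> * l + (l powr \<alpha>)\<^sup>2"
  using sigma by (simp add: freq_def powr_power mult.commute)

lemma mode_energy_rot:
  assumes "l > 0"
  shows "rot_energy \<tau> (slow_part l u \<theta>) v (fast_part l u \<theta>) q = mode_energy l u v \<theta> q"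
proof -
  define r n o' where "r = freq l" and "n = l powr \<alpha>" and "o' = sqrt (\<sigma> * l)"
  have r: "r > 0" using freq_pos[OF assms] by (simp add: r_def)
  have o': "o' > 0" using assms sigma by (simp add: o'_def)
  have o2: "\<sigma> * l = o'\<^sup>2" using assms sigma by (simp add: o'_def)
  have r2: "r\<^sup>2 = o'\<^sup>2 + n\<^sup>2" using freq_sq[OF assms] by (simp add: r_def n_def o2)
  have "(norm ((n * o') *\<^sub>R u + o' *\<^sub>R \<theta>))\<^sup>2 + (norm (n *\<^sub>R \<theta> - o'\<^sup>2 *\<^sub>R u))\<^sup>2
      = r\<^sup>2 * (o'\<^sup>2 * (norm u)\<^sup>2 + (norm \<theta>)\<^sup>2)"
    unfolding r2 rinner_self[symmetric] rinner_add_left rinner_add_right rinner_diff_left rinner_diff_right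
      rinner_scaleR_left rinner_scaleR_right rinner_commute[of \<theta> u]
    by (simp add: algebra_simps power2_eq_square)
  moreover have "(norm (slow_part l u \<theta>))\<^sup>2 + (norm (fast_part l u \<theta>))\<^sup>2
      = ((norm ((n * o') *\<^sub>R u + o' *\<^sub>R \<theta>))\<^sup>2 + (norm (n *\<^sub>R \<theta> - o'\<^sup>2 *\<^sub>R u))\<^sup>2) / r\<^sup>2"
    unfolding slow_part_def fast_part_def r_def[symmetric] n_def[symmetric] o'_def[symmetric] o2 norm_scaleR
    using o' by (simp add: power_divide add_divide_distrib)
  ultimately have "(norm (slow_part l u \<theta>))\<^sup>2 + (norm (fast_part l u \<theta>))\<^sup>2 = \<sigma> * l * (norm u)\<^sup>2 + (norm \<theta>)\<^sup>2"
    using r by (simp add: o2)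
  then show ?thesis by (simp add: rot_energy_def mode_energy_def)
qed

text \<open>The contributions of \<open>v\<close> to the slow part cancel, while those to the fast
  part add up to \<open>(freq l)^2\<close>. The temperature in the flux equation is recovered by the
  inverse rotation.\<close>

lemma system_rot:
  assumes "l > 0"
  shows "slow_part l v (l powr (\<beta>/2) *\<^sub>R q - l powr \<alpha> *\<^sub>R v) = slow_coupling l *\<^sub>R q"
    and "l powr \<alpha> *\<^sub>R \<theta> - (\<sigma> * l) *\<^sub>R u = freq l *\<^sub>R fast_part l u \<theta>"
    and "fast_part l v (l powr (\<beta>/2) *\<^sub>R q - l powr \<alpha> *\<^sub>R v) = freq l *\<^sub>R (fast_coupling l *\<^sub>R q - v)"
    and "q + l powr (\<beta>/2) *\<^sub>R \<theta> =
      q + (freq l * fast_coupling l) *\<^sub>R fast_part l u \<theta> + slow_coupling l *\<^sub>R slow_part l u \<theta>"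
proof -
  define r n o' \<rho> where "r = freq l" and "n = l powr \<alpha>" and "o' = sqrt (\<sigma> * l)" and "\<rho> = l powr (\<beta>/2)"
  have r: "r > 0" using freq_pos[OF assms] by (simp add: r_def)
  have o': "o' > 0" using assms sigma by (simp add: o'_def)
  have o2: "\<sigma> * l = o'\<^sup>2" using assms sigma by (simp add: o'_def)
  have r2: "r\<^sup>2 = o'\<^sup>2 + n\<^sup>2" using freq_sq[OF assms] by (simp add: r_def n_def o2)
  note defs = slow_part_def fast_part_def slow_coupling_def fast_coupling_def
    r_def[symmetric] n_def[symmetric] \<rho>_def[symmetric] o'_def[symmetric] o2
  show "slow_part l v (l powr (\<beta>/2) *\<^sub>R q - l powr \<alpha> *\<^sub>R v) = slow_coupling l *\<^sub>R q"
    unfolding defs by (simp add: algebra_simps)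
  show "l powr \<alpha> *\<^sub>R \<theta> - (\<sigma> * l) *\<^sub>R u = freq l *\<^sub>R fast_part l u \<theta>"
    unfolding defs using r by simp
  have "fast_part l v (l powr (\<beta>/2) *\<^sub>R q - l powr \<alpha> *\<^sub>R v) = (n * \<rho> / r) *\<^sub>R q - (r\<^sup>2 / r) *\<^sub>R v"
    unfolding defs r2 by (simp add: algebra_simps power2_eq_square add_divide_distrib)
  also have "\<dots> = freq l *\<^sub>R (fast_coupling l *\<^sub>R q - v)"
    unfolding defs using r by (simp add: scaleR_diff_right power2_eq_square mult.commute)
  finally show "fast_part l v (l powr (\<beta>/2) *\<^sub>R q - l powr \<alpha> *\<^sub>R v) = freq l *\<^sub>R (fast_coupling l *\<^sub>R q - v)" .
  have "(r * fast_coupling l) *\<^sub>R fast_part l u \<theta> + slow_coupling l *\<^sub>R slow_part l u \<theta>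
      = (r * (\<rho> * n / r\<^sup>2) * (1 / r) * n + \<rho> * o' / r * (1 / r) * o') *\<^sub>R \<theta>
       + (\<rho> * o' / r * (1 / r) * (n * o') - r * (\<rho> * n / r\<^sup>2) * (1 / r) * o'\<^sup>2) *\<^sub>R u"
    unfolding defs by (simp only: scaleR_add_right scaleR_diff_right scaleR_scaleR scaleR_add_left
        scaleR_diff_left) (use o' in \<open>simp add: mult_ac\<close>)
  also have "\<rho> * o' / r * (1 / r) * (n * o') - r * (\<rho> * n / r\<^sup>2) * (1 / r) * o'\<^sup>2 = 0"
    using r by (simp add: field_simps power2_eq_square)
  also have "r * (\<rho> * n / r\<^sup>2) * (1 / r) * n + \<rho> * o' / r * (1 / r) * o' = \<rho> * (o'\<^sup>2 + n\<^sup>2) / r\<^sup>2"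
    using r by (simp add: field_simps power2_eq_square)
  also have "\<dots> = \<rho>" using r by (simp flip: r2)
  finally show "q + l powr (\<beta>/2) *\<^sub>R \<theta> =
      q + (freq l * fast_coupling l) *\<^sub>R fast_part l u \<theta> + slow_coupling l *\<^sub>R slow_part l u \<theta>"
    by (simp add: r_def \<rho>_def add.assoc)
qed

lemma mode_energy_rot1:
  assumes "l > 0"
  shows "rot_energy1 \<tau> (slow_coupling l) (freq l) (fast_coupling l) (slow_part l u \<theta>) v (fast_part l u \<theta>) q
    = mode_energy l v (l powr \<alpha> *\<^sub>R \<theta> - (\<sigma> * l) *\<^sub>R u) (l powr (\<beta>/2) *\<^sub>R q - l powr \<alpha> *\<^sub>R v)
        ((- (1 / \<tau>)) *\<^sub>R (q + l powr (\<beta>/2) *\<^sub>R \<theta>))"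
  unfolding rot_energy1_def mode_energy_rot[OF assms, symmetric] system_rot(1,3)[OF assms]
    system_rot(2)[OF assms, of \<theta> u] system_rot(4)[OF assms, of q \<theta> u] ..

lemma fast_coupling_sq: "l > 0 \<Longrightarrow> (fast_coupling l)\<^sup>2 = l powr (\<beta> + 2 * \<alpha>) / ((freq l)\<^sup>2)\<^sup>2"
  by (simp add: fast_coupling_def power_divide power_mult_distrib powr_power powr_add mult.commute)

text \<open>The square of the slow coupling is
  \<open>\<sigma> * l powr (1 + \<beta>) / (freq l)^2\<close>, so its lower bound requires
  \<open>l powr (2 * \<alpha>)\<close> not to outgrow \<open>l powr (1 + \<beta>)\<close>. The upper
  bounds follow once \<open>l powr \<beta>\<close> is dominated by
  \<open>(freq l)^2\<close>.\<close>

lemma coupling_bounds: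
  obtains a0 r0 C where "a0 > 0" "r0 > 0" "C > 0"
    "\<And>l. l \<in> ev \<Longrightarrow> a0 \<le> slow_coupling l \<and> r0 \<le> freq l \<and> slow_coupling l \<le> C * freq l \<and>
       0 \<le> fast_coupling l \<and> fast_coupling l \<le> C"
proof -
  obtain m where m: "m > 0" and ml: "\<And>l. l \<in> ev \<Longrightarrow> m \<le> l"
    using eigenvalues_bounded_below by blast
  \<comment> \<open>\<open>C1\<close> bounds \<open>(freq l)^2\<close> by a multiple of
    \<open>l powr (1 + \<beta>)\<close>, its two summands treating \<open>\<sigma> * l\<close> and
    \<open>l powr (2 * \<alpha>)\<close>; the square of \<open>C\<close> bounds
    \<open>l powr \<beta>\<close> by a multiple of \<open>(freq l)^2\<close>.\<close>
  define C1 where "C1 = \<sigma> * m powr (- \<beta>) + m powr (2 * \<alpha> - (1 + \<beta>))"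
  define C where "C = sqrt (m powr (\<beta> - 1) / \<sigma>)"
  have C1: "C1 > 0" unfolding C1_def using m sigma by (intro add_pos_pos) auto
  show ?thesis
  proof (rule that)
    show "sqrt (\<sigma> / C1) > 0" "sqrt (\<sigma> * m) > 0" "C > 0"
      using C1 sigma m by (auto simp: C_def)
    fix l assume "l \<in> ev"
    then have l: "m \<le> l" "l > 0" using ml eigenvalue_pos by auto
    have r: "freq l > 0" by (rule freq_pos[OF l(2)])
    have r2: "(freq l)\<^sup>2 = \<sigma> * l + l powr (2 * \<alpha>)"
      using l sigma by (simp add: freq_def)
    have rho2: "(l powr (\<beta>/2))\<^sup>2 = l powr \<beta>"
      using l by (simp add: powr_power)
    have r_le: "(freq l)\<^sup>2 \<le> C1 * l powr (1 + \<beta>)"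
    proof -
      have "l powr 1 \<le> m powr (1 - (1 + \<beta>)) * l powr (1 + \<beta>)"
        by (rule powr_le_powr_const) (use l m beta in auto)
      then have "\<sigma> * l \<le> \<sigma> * (m powr (- \<beta>) * l powr (1 + \<beta>))"
        using sigma l by (intro mult_left_mono) auto
      moreover have "l powr (2 * \<alpha>) \<le> m powr (2 * \<alpha> - (1 + \<beta>)) * l powr (1 + \<beta>)"
        by (rule powr_le_powr_const) (use l m ab in auto)
      ultimately show ?thesis unfolding r2 C1_def by (simp add: algebra_simps)
    qed
    have a2: "(slow_coupling l)\<^sup>2 = \<sigma> * l powr (1 + \<beta>) / (freq l)\<^sup>2"
      using l sigma by (simp add: slow_coupling_def power_divide power_mult_distrib rho2 powr_add)
    have a_nn: "slow_coupling l \<ge> 0" using r l sigma by (simp add: slow_coupling_def)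
    have a0: "sqrt (\<sigma> / C1) \<le> slow_coupling l"
    proof (rule real_le_lsqrt[THEN order_trans])
      have "\<sigma> / C1 * (freq l)\<^sup>2 \<le> \<sigma> / C1 * (C1 * l powr (1 + \<beta>))"
        using r_le sigma C1 by (intro mult_left_mono) auto
      then show "\<sigma> / C1 \<le> (slow_coupling l)\<^sup>2"
        unfolding a2 using C1 r by (simp add: field_simps)
    qed (use a_nn in auto)
    have r0: "sqrt (\<sigma> * m) \<le> freq l"
      unfolding freq_def using l sigma by (intro real_sqrt_le_mono) (simp add: add_increasing2)
    have rho_le: "l powr \<beta> \<le> C\<^sup>2 * (freq l)\<^sup>2"
    proof -
      have "l powr \<beta> \<le> m powr (\<beta> - 1) * l powr 1"
        by (rule powr_le_powr_const) (use l m beta in auto)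
      also have "\<dots> = C\<^sup>2 * (\<sigma> * l)"
        using l sigma by (simp add: C_def)
      also have "\<dots> \<le> C\<^sup>2 * (freq l)\<^sup>2"
        unfolding r2 by (intro mult_left_mono) auto
      finally show ?thesis .
    qed
    have aC: "slow_coupling l \<le> C * freq l"
    proof (rule power2_le_imp_le)
      have "(slow_coupling l)\<^sup>2 = l powr \<beta> * (\<sigma> * l / (freq l)\<^sup>2)"
        using l by (simp add: a2 powr_add)
      also have "\<dots> \<le> l powr \<beta> * 1"
      proof (intro mult_left_mono)
        have "\<sigma> * l \<le> (freq l)\<^sup>2" unfolding r2 by simp
        then show "\<sigma> * l / (freq l)\<^sup>2 \<le> 1" using r by (simp add: divide_le_eq_1)
      qed simp
      finally show "(slow_coupling l)\<^sup>2 \<le> (C * freq l)\<^sup>2"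
        using rho_le by (simp add: power_mult_distrib)
      show "0 \<le> C * freq l" using r sigma by (simp add: C_def)
    qed
    have y0: "0 \<le> fast_coupling l" by (simp add: fast_coupling_def)
    have yC: "fast_coupling l \<le> C"
    proof (rule power2_le_imp_le)
      have "(fast_coupling l)\<^sup>2 = (l powr \<beta> / (freq l)\<^sup>2) * ((l powr \<alpha>)\<^sup>2 / (freq l)\<^sup>2)"
        by (simp add: fast_coupling_def power_divide power_mult_distrib rho2)
      also have "\<dots> \<le> C\<^sup>2 * 1"
      proof (rule mult_mono)
        show "l powr \<beta> / (freq l)\<^sup>2 \<le> C\<^sup>2" using rho_le r by (simp add: field_simps)
        have "(l powr \<alpha>)\<^sup>2 \<le> (freq l)\<^sup>2" unfolding freq_sq[OF l(2)] using l sigma by simp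
        then show "(l powr \<alpha>)\<^sup>2 / (freq l)\<^sup>2 \<le> 1" using r by (simp add: divide_le_eq_1)
      qed auto
      finally show "(fast_coupling l)\<^sup>2 \<le> C\<^sup>2" by simp
    qed (use sigma in \<open>simp add: C_def\<close>)
    show "sqrt (\<sigma> / C1) \<le> slow_coupling l \<and> sqrt (\<sigma> * m) \<le> freq l \<and> slow_coupling l \<le> C * freq l \<and>
       0 \<le> fast_coupling l \<and> fast_coupling l \<le> C"
      using a0 r0 aC y0 yC by simp
  qed
qed

section \<open>Bounded invertibility of the generator\<close>

lemma mode_resolvent_bound:
  "\<exists>K>0. \<forall>l\<in>ev. \<forall>u v \<theta> q. mode_energy l u v \<theta> q \<le>
    K * mode_energy l v (l powr \<alpha> *\<^sub>R \<theta> - (\<sigma> * l) *\<^sub>R u) (l powr (\<beta>/2) *\<^sub>R q - l powr \<alpha> *\<^sub>R v)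
        ((- (1 / \<tau>)) *\<^sub>R (q + l powr (\<beta>/2) *\<^sub>R \<theta>))"
proof -
  obtain a0 r0 C where c: "a0 > 0" "r0 > 0" "C > 0"
    and b: "\<And>l. l \<in> ev \<Longrightarrow> a0 \<le> slow_coupling l \<and> r0 \<le> freq l \<and> slow_coupling l \<le> C * freq l \<and>
       0 \<le> fast_coupling l \<and> fast_coupling l \<le> C"
    using coupling_bounds by blast
  obtain K where K: "K > 0" "\<And>a r y. \<And>p v z q :: 'h. a0 \<le> a \<Longrightarrow> r0 \<le> r \<Longrightarrow> 0 \<le> y \<Longrightarrow> y \<le> C \<Longrightarrow>
      rot_energy \<tau> p v z q \<le> K * rot_energy1 \<tau> a r y p v z q"
    using rot_energy_le_energy1[OF tau c] by blast
  show ?thesis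
  proof (intro exI[of _ K] conjI K(1) ballI allI)
    fix l u v \<theta> q assume l: "l \<in> ev"
    show "mode_energy l u v \<theta> q \<le>
    K * mode_energy l v (l powr \<alpha> *\<^sub>R \<theta> - (\<sigma> * l) *\<^sub>R u) (l powr (\<beta>/2) *\<^sub>R q - l powr \<alpha> *\<^sub>R v)
        ((- (1 / \<tau>)) *\<^sub>R (q + l powr (\<beta>/2) *\<^sub>R \<theta>))"
      using K(2)[of "slow_coupling l" "freq l" "fast_coupling l" "slow_part l u \<theta>" v "fast_part l u \<theta>" q] b[OF l]
      unfolding mode_energy_rot1[OF eigenvalue_pos[OF l]] mode_energy_rot[OF eigenvalue_pos[OF l]]
      by blast
  qed
qed

lemma system_op_state_energy:
  assumes "U \<in> Gd" "l \<in> ev" "U = (u, v, \<theta>, q)"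
  shows "state_energy l (G U) = mode_energy l (P l v) (l powr \<alpha> *\<^sub>R P l \<theta> - (\<sigma> * l) *\<^sub>R P l u)
     (l powr (\<beta>/2) *\<^sub>R P l q - l powr \<alpha> *\<^sub>R P l v) ((- (1 / \<tau>)) *\<^sub>R (P l q + l powr (\<beta>/2) *\<^sub>R P l \<theta>))"
proof -
  obtain u' v' \<theta>' q' where G: "G U = (u', v', \<theta>', q')" by (cases "G U")
  show ?thesis
    using system_op_modes[of u v \<theta> q u' v' \<theta>' q' l] assms G eigenvalue_pos[OF assms(2)]
    by (simp add: state_energy_def)
qed

text \<open>In each mode the equations are triangular: \<open>v\<close>, then \<open>q\<close>, then
  \<open>\<theta>\<close>, then \<open>u\<close>. The solution formulas carry powers of
  \<open>l\<close> that may be unbounded, so square summability of the solved components comes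
  instead from the mode-uniform energy bound.\<close>

lemma system_op_bij: "bij_betw G Gd S"
  unfolding bij_betw_def
proof
  show "inj_on G Gd"
  proof (rule inj_onI)
    fix U1 U2 assume U: "U1 \<in> Gd" "U2 \<in> Gd" "G U1 = G U2"
    obtain u1 v1 \<theta>1 q1 where U1: "U1 = (u1, v1, \<theta>1, q1)" by (cases U1)
    obtain u2 v2 \<theta>2 q2 where U2: "U2 = (u2, v2, \<theta>2, q2)" by (cases U2)
    obtain u' v' \<theta>' q' where G: "G U1 = (u', v', \<theta>', q')" by (cases "G U1")
    note m1 = system_op_modes[OF U(1)[unfolded U1] G[unfolded U1]]
    note m2 = system_op_modes[OF U(2)[unfolded U2] G[unfolded U(3) U2]]
    have "P l u1 = P l u2 \<and> P l v1 = P l v2 \<and> P l \<theta>1 = P l \<theta>2 \<and> P l q1 = P l q2" if "l \<in> ev" for l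
    proof -
      have l: "l > 0" by (rule eigenvalue_pos[OF that])
      have v: "P l v1 = P l v2" using m1(1)[of l] m2(1)[of l] by simp
      then have q: "P l q1 = P l q2" using m1(3)[of l] m2(3)[of l] l by simp
      then have \<theta>: "P l \<theta>1 = P l \<theta>2" using m1(4)[of l] m2(4)[of l] l tau by simp
      then have "P l u1 = P l u2" using m1(2)[of l] m2(2)[of l] l sigma by simp
      with v q \<theta> show ?thesis by simp
    qed
    then have "u1 = u2" "v1 = v2" "\<theta>1 = \<theta>2" "q1 = q2"
      by (auto intro: eq_from_components)
    then show "U1 = U2" by (simp add: U1 U2)
  qed
  show "G ` Gd = S"
  proof (intro equalityI subsetI)
    fix F assume F: "F \<in> S"
    obtain f g h j where F_eq: "F = (f, g, h, j)" by (cases F)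
    have fdom: "f \<in> pow_dom D A (1/2)" using F by (simp add: F_eq state_space_def)
    \<comment> \<open>The velocity is \<open>f\<close> itself. The heat equation then gives
      \<open>q\<close>, the flux equation \<open>\<theta>\<close>, and the momentum equation
      \<open>u\<close>.\<close>
    define cq where "cq l = (1 / l powr (\<beta>/2)) *\<^sub>R (P l h + l powr \<alpha> *\<^sub>R P l f)" for l
    define c\<theta> where "c\<theta> l = (- (1 / l powr (\<beta>/2))) *\<^sub>R (cq l + \<tau> *\<^sub>R P l j)" for l
    define cu where "cu l = (1 / (\<sigma> * l)) *\<^sub>R (l powr \<alpha> *\<^sub>R c\<theta> l - P l g)" for l
    have in_E: "cq l \<in> E l" "c\<theta> l \<in> E l" "cu l \<in> E l" for l
      unfolding cq_def c\<theta>_def cu_def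
      by (intro csubspace_scaleR csubspace_add csubspace_diff eigenspace_csubspace spectral_proj_in)+
    have solve: "l powr \<alpha> *\<^sub>R c\<theta> l - (\<sigma> * l) *\<^sub>R cu l = P l g"
      "l powr (\<beta>/2) *\<^sub>R cq l - l powr \<alpha> *\<^sub>R P l f = P l h"
      "cq l + l powr (\<beta>/2) *\<^sub>R c\<theta> l = (- \<tau>) *\<^sub>R P l j" if "l \<in> ev" for l
      using eigenvalue_pos[OF that] sigma by (simp_all add: cu_def c\<theta>_def cq_def)
    obtain K where K: "K > 0" and Kb: "\<And>l u v \<theta> q. l \<in> ev \<Longrightarrow> mode_energy l u v \<theta> q \<le>
       K * mode_energy l v (l powr \<alpha> *\<^sub>R \<theta> - (\<sigma> * l) *\<^sub>R u) (l powr (\<beta>/2) *\<^sub>R q - l powr \<alpha> *\<^sub>R v)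
        ((- (1 / \<tau>)) *\<^sub>R (q + l powr (\<beta>/2) *\<^sub>R \<theta>))"
      using mode_resolvent_bound by blast
    have bound: "mode_energy l (cu l) (P l f) (c\<theta> l) (cq l) \<le> K * state_energy l F" if "l \<in> ev" for l
      using Kb[OF that, of "cu l" "P l f" "c\<theta> l" "cq l"] tau
      by (simp add: solve[OF that] F_eq state_energy_def)
    have "(\<lambda>l. mode_energy l (cu l) (P l f) (c\<theta> l) (cq l)) summable_on ev"
    proof (rule summable_on_nonneg_comparison)
      show "(\<lambda>l. K * state_energy l F) summable_on ev"
        by (intro summable_on_cmult_right has_sum_imp_summable[OF state_energy_has_sum[OF F]])
    qed (use bound mode_energy_nonneg in auto)
    note comp = summable_on_nonneg_comparison[OF this]
    have "(\<lambda>l. \<sigma> * (l * (norm (cu l))\<^sup>2)) summable_on ev"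
      by (rule comp) (use sigma tau in \<open>auto simp: mode_energy_def mult.assoc less_imp_le[OF eigenvalue_pos]\<close>)
    then have sum_u: "(\<lambda>l. l * (norm (cu l))\<^sup>2) summable_on ev"
      using summable_on_cmult_right[of _ ev "1 / \<sigma>"] sigma by fastforce
    \<comment> \<open>The energy bound controls the weighted sum belonging to
      \<open>\<D>(A^(1/2))\<close>; the lower bound on the spectrum gives the unweighted one, needed
      to form the vector \<open>u\<close>.\<close>
    have sum_u0: "(\<lambda>l. (norm (cu l))\<^sup>2) summable_on ev"
    proof -
      obtain m where m: "m > 0" "\<And>l. l \<in> ev \<Longrightarrow> m \<le> l"
        using eigenvalues_bounded_below by blast
      show ?thesis
      proof (rule summable_on_nonneg_comparison)
        show "(\<lambda>l. (1 / m) * (l * (norm (cu l))\<^sup>2)) summable_on ev"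
          by (intro summable_on_cmult_right sum_u)
        fix l assume "l \<in> ev"
        then have "m * (norm (cu l))\<^sup>2 \<le> l * (norm (cu l))\<^sup>2" using m by (intro mult_right_mono) auto
        then show "(norm (cu l))\<^sup>2 \<le> (1 / m) * (l * (norm (cu l))\<^sup>2)" using m(1) by (simp add: field_simps)
      qed simp
    qed
    have sum_\<theta>: "(\<lambda>l. (norm (c\<theta> l))\<^sup>2) summable_on ev"
      by (rule comp) (use sigma tau in \<open>auto simp: mode_energy_def less_imp_le[OF eigenvalue_pos]\<close>)
    have "(\<lambda>l. \<tau> * (norm (cq l))\<^sup>2) summable_on ev"
      by (rule comp) (use sigma tau in \<open>auto simp: mode_energy_def less_imp_le[OF eigenvalue_pos]\<close>)
    then have sum_q: "(\<lambda>l. (norm (cq l))\<^sup>2) summable_on ev"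
      using summable_on_cmult_right[of _ ev "1 / \<tau>"] tau by fastforce
    define u \<theta> q where "u = infsum cu ev" and "\<theta> = infsum c\<theta> ev" and "q = infsum cq ev"
    have modes: "P l u = cu l" "P l \<theta> = c\<theta> l" "P l q = cq l" for l
      unfolding u_def \<theta>_def q_def by (intro riesz_fischer(1) in_E sum_u0 sum_\<theta> sum_q)+
    \<comment> \<open>Equality of families is required at every real \<open>l\<close>. Outside the
      spectrum both sides vanish because the eigenspaces are trivial.\<close>
    have zero: "cu l = 0" "c\<theta> l = 0" "cq l = 0" "P l x = 0" if "l \<notin> ev" for l x
      using not_eigenvalue[OF that] in_E spectral_proj_in by auto
    have mom: "momentum_part D A \<sigma> \<alpha> u \<theta> = components D A g"
    proof
      fix l
      show "momentum_part D A \<sigma> \<alpha> u \<theta> l = components D A g l"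
      proof (cases "l \<in> ev")
        case True
        then show ?thesis
          using solve(1)[OF True] eigenvalue_pos[OF True]
          by (simp add: momentum_part_def components_def scale_pow_def modes)
      qed (simp add: momentum_part_def components_def scale_pow_def zero)
    qed
    have heat: "heat_part D A \<alpha> \<beta> f q = components D A h"
    proof
      fix l
      show "heat_part D A \<alpha> \<beta> f q l = components D A h l"
      proof (cases "l \<in> ev")
        case True
        then show ?thesis
          using solve(2)[OF True] by (simp add: heat_part_def components_def scale_pow_def modes)
      qed (simp add: heat_part_def components_def scale_pow_def zero)
    qed
    have flux: "flux_part D A \<beta> \<theta> q = components D A (\<tau> *\<^sub>R j)"
    proof
      fix l
      show "flux_part D A \<beta> \<theta> q l = components D A (\<tau> *\<^sub>R j) l"
      proof (cases "l \<in> ev")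
        case True
        have "- cq l - l powr (\<beta>/2) *\<^sub>R c\<theta> l = - (cq l + l powr (\<beta>/2) *\<^sub>R c\<theta> l)" by simp
        then show ?thesis
          by (simp only: flux_part_def components_def scale_pow_def modes spectral_proj_scaleR solve(3)[OF True]) simp
      qed (simp add: flux_part_def components_def scale_pow_def zero)
    qed
    have inH: "scale_in_H D A (components D A w)" for w
      by (auto simp: scale_in_H_def)
    have "u \<in> pow_dom D A (1/2)" using sum_u by (simp add: pow_dom_half_iff modes)
    then have "(u, f, \<theta>, q) \<in> Gd"
      using fdom by (simp add: system_dom_def state_space_def mom heat flux inH)
    moreover have "G (u, f, \<theta>, q) = F"
      using tau by (simp add: system_op_def mom heat flux scale_to_H_components F_eq)
    ultimately show "F \<in> G ` Gd" by (metis imageI)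
  qed (use system_op_in in auto)
qed

lemma resolvent_state_energy:
  "\<exists>K>0. \<forall>U\<in>Gd. \<forall>l\<in>ev. state_energy l U \<le> K * state_energy l (G U)"
proof -
  obtain K where K: "K > 0" and Kb: "\<And>l u v \<theta> q. l \<in> ev \<Longrightarrow> mode_energy l u v \<theta> q \<le>
       K * mode_energy l v (l powr \<alpha> *\<^sub>R \<theta> - (\<sigma> * l) *\<^sub>R u) (l powr (\<beta>/2) *\<^sub>R q - l powr \<alpha> *\<^sub>R v)
        ((- (1 / \<tau>)) *\<^sub>R (q + l powr (\<beta>/2) *\<^sub>R \<theta>))"
    using mode_resolvent_bound by blast
  show ?thesis
  proof (intro exI[of _ K] conjI K ballI)
    fix U l assume U: "U \<in> Gd" and l: "l \<in> ev"
    obtain u v \<theta> q where U_eq: "U = (u, v, \<theta>, q)" by (cases U)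
    show "state_energy l U \<le> K * state_energy l (G U)"
      unfolding system_op_state_energy[OF U l U_eq]
      using Kb[OF l, of "P l u" "P l v" "P l \<theta>" "P l q"] by (simp add: state_energy_def U_eq)
  qed
qed

text \<open>Writing \<open>F = G U\<close> removes the inverse, so a comparison with
  \<open>G U\<close> in every mode is enough. The map \<open>L\<close> is left open to cover both
  the resolvent itself and \<open>T t\<close> composed with it.\<close>

lemma operator_norm_inverse_le:
  assumes "K \<ge> 0" and L: "\<And>U. U \<in> Gd \<Longrightarrow> L U \<in> S"
    and le: "\<And>U l. U \<in> Gd \<Longrightarrow> l \<in> ev \<Longrightarrow> state_energy l (L U) \<le> K * state_energy l (G U)"
  shows "operator_norm_on S N (L \<circ> inv_into Gd G) \<le> ennreal (sqrt K)"
  unfolding operator_norm_on_def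
proof (rule SUP_least)
  fix F assume "F \<in> {F \<in> S. N F \<le> 1}"
  then have F: "F \<in> S" "N F \<le> 1" by auto
  define U where "U = inv_into Gd G F"
  have U: "U \<in> Gd" "G U = F"
    using F(1) system_op_bij unfolding U_def
    by (auto simp: bij_betw_def intro: inv_into_into f_inv_into_f)
  have "N (L U) \<le> sqrt K * N (G U)"
    by (intro state_norm_le L U system_op_in assms(1) le)
  also have "\<dots> \<le> sqrt K * 1"
    using F assms(1) U by (intro mult_left_mono) auto
  finally show "ennreal (N ((L \<circ> inv_into Gd G) F)) \<le> ennreal (sqrt K)"
    by (simp add: U_def ennreal_leI)
qed

lemma zero_in_resolvent: "zero_in_resolvent_set S N Gd G"
proof -
  obtain K where K: "K > 0" "\<And>U l. U \<in> Gd \<Longrightarrow> l \<in> ev \<Longrightarrow> state_energy l U \<le> K * state_energy l (G U)"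
    using resolvent_state_energy by blast
  have "operator_norm_on S N ((\<lambda>U. U) \<circ> inv_into Gd G) \<le> ennreal (sqrt K)"
    by (rule operator_norm_inverse_le) (use K system_dom_subset in auto)
  then have "operator_norm_on S N (inv_into Gd G) < \<infinity>"
    by (simp add: o_def le_less_trans)
  then show ?thesis by (simp add: zero_in_resolvent_set_def system_op_bij)
qed

section \<open>Modal dynamics of the orbits and polynomial stability\<close>

lemma orbit_rot_flow:
  assumes sg: "C0_contraction_semigroup S N T" and gen: "has_generator S N T Gd G"
    and U0: "U0 \<in> Gd" and l: "l \<in> ev"
  shows "rot_flow \<tau> (slow_coupling l) (freq l) (fast_coupling l)
    (\<lambda>t. case T t U0 of (u, v, \<theta>, q) \<Rightarrow> slow_part l (P l u) (P l \<theta>))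
    (\<lambda>t. case T t U0 of (u, v, \<theta>, q) \<Rightarrow> P l v)
    (\<lambda>t. case T t U0 of (u, v, \<theta>, q) \<Rightarrow> fast_part l (P l u) (P l \<theta>))
    (\<lambda>t. case T t U0 of (u, v, \<theta>, q) \<Rightarrow> P l q)"
proof -
  interpret contraction_semigroup_generator S N T Gd G
    by unfold_locales
      (use state_space_csubspace state_norm_nonneg sg gen system_dom_subset system_op_in in auto)
  have l0: "l > 0" by (rule eigenvalue_pos[OF l])
  \<comment> \<open>\<open>N\<close> is not the norm of the product type, so the orbit is
    differentiated through these four real-linear observables, each bounded with respect to
    \<open>N\<close>.\<close>
  define Jp Jv Jz Jq :: "'h state \<Rightarrow> 'h" where "Jp = (\<lambda>(u, v, \<theta>, q). slow_part l (P l u) (P l \<theta>))"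
    and "Jv = (\<lambda>(u, v, \<theta>, q). P l v)" and "Jz = (\<lambda>(u, v, \<theta>, q). fast_part l (P l u) (P l \<theta>))"
    and "Jq = (\<lambda>(u, v, \<theta>, q). P l q)"
  have lin: "J (X - Y) = J X - J Y" "J (c *\<^sub>R X) = c *\<^sub>R J X"
    if "J = Jp \<or> J = Jv \<or> J = Jz \<or> J = Jq" for J c X Y
    using that
    by (cases X, cases Y, auto simp: Jp_def Jv_def Jz_def Jq_def spectral_proj_diff spectral_proj_scaleR
        slow_part_def fast_part_def algebra_simps)+
  have energy: "(norm (Jp X))\<^sup>2 + (norm (Jv X))\<^sup>2 + (norm (Jz X))\<^sup>2 + \<tau> * (norm (Jq X))\<^sup>2 \<le> (N X)\<^sup>2" if "X \<in> S" for X
  proof -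
    obtain u v \<theta> q where X: "X = (u, v, \<theta>, q)" by (cases X)
    have "rot_energy \<tau> (Jp X) (Jv X) (Jz X) (Jq X) = state_energy l X"
      by (simp add: X Jp_def Jv_def Jz_def Jq_def mode_energy_rot[OF l0] state_energy_def)
    then show ?thesis using state_energy_le_norm[OF that l] by (simp add: rot_energy_def)
  qed
  \<comment> \<open>The constant 1 would do for the first three observables; the flux enters the
    energy with weight \<open>\<tau>\<close> and costs \<open>1 / sqrt \<tau>\<close>.\<close>
  have bnd: "norm (J X) \<le> (1 + 1 / sqrt \<tau>) * N X"
    if J: "J = Jp \<or> J = Jv \<or> J = Jz \<or> J = Jq" and X: "X \<in> S" for J X
  proof -
    have nn: "0 \<le> (norm (Jp X))\<^sup>2" "0 \<le> (norm (Jv X))\<^sup>2" "0 \<le> (norm (Jz X))\<^sup>2" "0 \<le> \<tau> * (norm (Jq X))\<^sup>2"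
      using tau by auto
    have "(norm (Jp X))\<^sup>2 \<le> (N X)\<^sup>2" "(norm (Jv X))\<^sup>2 \<le> (N X)\<^sup>2" "(norm (Jz X))\<^sup>2 \<le> (N X)\<^sup>2"
      "\<tau> * (norm (Jq X))\<^sup>2 \<le> (N X)\<^sup>2"
      using energy[OF X] nn by linarith+
    then have "norm (Jp X) \<le> N X" "norm (Jv X) \<le> N X" "norm (Jz X) \<le> N X" "sqrt \<tau> * norm (Jq X) \<le> N X"
      using state_norm_nonneg[of X] tau
      by (auto intro: power2_le_imp_le simp: power_mult_distrib)
    then have "norm (J X) \<le> N X \<or> norm (J X) \<le> 1 / sqrt \<tau> * N X"
      using J tau by (auto simp: field_simps)
    moreover have "0 \<le> 1 / sqrt \<tau> * N X" "0 \<le> N X" using tau state_norm_nonneg[of X] by auto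
    ultimately show ?thesis by (auto simp: distrib_right)
  qed
  have der: "((\<lambda>t. J (T t U0)) has_vector_derivative J (G (T t U0))) (at t within {0..})"
    if "J = Jp \<or> J = Jv \<or> J = Jz \<or> J = Jq" "t \<ge> 0" for J t
    by (rule orbit_has_vector_derivative[OF lin[OF that(1)] bnd[OF that(1)] U0 that(2)])
  have gen_modes: "Jp (G V) = slow_coupling l *\<^sub>R Jq V" "Jv (G V) = freq l *\<^sub>R Jz V"
    "Jz (G V) = freq l *\<^sub>R (fast_coupling l *\<^sub>R Jq V - Jv V)"
    "Jq (G V) = (- (1 / \<tau>)) *\<^sub>R (Jq V + (freq l * fast_coupling l) *\<^sub>R Jz V + slow_coupling l *\<^sub>R Jp V)"
    if "V \<in> Gd" for V
  proof -
    obtain u v \<theta> q where V: "V = (u, v, \<theta>, q)" by (cases V)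
    obtain u' v' \<theta>' q' where GV: "G V = (u', v', \<theta>', q')" by (cases "G V")
    note m = system_op_modes[OF that[unfolded V] GV[unfolded V], of l]
    show "Jp (G V) = slow_coupling l *\<^sub>R Jq V"
      unfolding V GV[unfolded V] Jp_def Jq_def prod.case m by (rule system_rot(1)[OF l0])
    show "Jv (G V) = freq l *\<^sub>R Jz V"
      unfolding V GV[unfolded V] Jv_def Jz_def prod.case m using system_rot(2)[OF l0] l0 by simp
    show "Jz (G V) = freq l *\<^sub>R (fast_coupling l *\<^sub>R Jq V - Jv V)"
      unfolding V GV[unfolded V] Jz_def Jq_def Jv_def prod.case m by (rule system_rot(3)[OF l0])
    show "Jq (G V) = (- (1 / \<tau>)) *\<^sub>R (Jq V + (freq l * fast_coupling l) *\<^sub>R Jz V + slow_coupling l *\<^sub>R Jp V)"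
      unfolding V GV[unfolded V] Jz_def Jq_def Jp_def prod.case m
      by (rule arg_cong[OF system_rot(4)[OF l0]])
  qed
  have "rot_flow \<tau> (slow_coupling l) (freq l) (fast_coupling l)
      (\<lambda>t. Jp (T t U0)) (\<lambda>t. Jv (T t U0)) (\<lambda>t. Jz (T t U0)) (\<lambda>t. Jq (T t U0))"
    unfolding rot_flow_def
  proof (intro allI impI)
    fix t :: real assume t: "t \<ge> 0"
    note gm = gen_modes[OF generator_commute(1)[OF U0 t]]
    show "((\<lambda>t. Jp (T t U0)) has_vector_derivative slow_coupling l *\<^sub>R Jq (T t U0)) (at t within {0..}) \<and>
      ((\<lambda>t. Jv (T t U0)) has_vector_derivative freq l *\<^sub>R Jz (T t U0)) (at t within {0..}) \<and>
      ((\<lambda>t. Jz (T t U0)) has_vector_derivative freq l *\<^sub>R (fast_coupling l *\<^sub>R Jq (T t U0) - Jv (T t U0))) (at t within {0..}) \<and>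
      ((\<lambda>t. Jq (T t U0)) has_vector_derivative (- (1 / \<tau>)) *\<^sub>R (Jq (T t U0) + (freq l * fast_coupling l) *\<^sub>R Jz (T t U0)
         + slow_coupling l *\<^sub>R Jp (T t U0))) (at t within {0..})"
      using der[OF _ t, of Jp] der[OF _ t, of Jv] der[OF _ t, of Jz] der[OF _ t, of Jq]
      unfolding gm by blast
  qed
  then show ?thesis
    by (simp only: Jp_def Jv_def Jz_def Jq_def)
qed

text \<open>The modal decay exponent \<open>1 / s\<close> concerns energies, which are squares of
  norms; hence the order \<open>1 / (2 * s)\<close> for the semigroup.\<close>

proposition polynomial_stability:
  assumes sg: "C0_contraction_semigroup S N T" and gen: "has_generator S N T Gd G"
    and "s > 0" "c > 0" and cy: "\<And>l. l \<in> ev \<Longrightarrow> c * ((freq l)\<^sup>2) powr (- s) \<le> (fast_coupling l)\<^sup>2"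
  shows "polynomially_stable S N T Gd G (1 / (2 * s))"
proof -
  obtain a0 r0 C where bc: "a0 > 0" "r0 > 0" "C > 0"
    and b: "\<And>l. l \<in> ev \<Longrightarrow> a0 \<le> slow_coupling l \<and> r0 \<le> freq l \<and> slow_coupling l \<le> C * freq l \<and>
       0 \<le> fast_coupling l \<and> fast_coupling l \<le> C"
    using coupling_bounds by blast
  obtain M where M: "M > 0" and decay: "\<And>a r y. \<And>p v z q :: real \<Rightarrow> 'h. \<And>t. t > 0 \<Longrightarrow>
     rot_flow \<tau> a r y p v z q \<Longrightarrow> a0 \<le> a \<Longrightarrow> r0 \<le> r \<Longrightarrow> a \<le> C * r \<Longrightarrow> 0 \<le> y \<Longrightarrow> y \<le> C \<Longrightarrow>
     c * (r\<^sup>2) powr (- s) \<le> y\<^sup>2 \<Longrightarrow>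
     rot_energy \<tau> (p t) (v t) (z t) (q t)
       \<le> M * t powr (- (1 / s)) * rot_energy1 \<tau> a r y (p 0) (v 0) (z 0) (q 0)"
    using rot_flow_decay[OF tau \<open>s > 0\<close> bc \<open>c > 0\<close>] by blast
  interpret contraction_semigroup_generator S N T Gd G
    by unfold_locales
      (use state_space_csubspace state_norm_nonneg sg gen system_dom_subset system_op_in in auto)
  have mode: "state_energy l (T t U) \<le> M * t powr (- (1 / s)) * state_energy l (G U)"
    if U: "U \<in> Gd" and l: "l \<in> ev" and t: "t > 0" for U l t
  proof -
    have l0: "l > 0" by (rule eigenvalue_pos[OF l])
    obtain u v \<theta> q where U_eq: "U = (u, v, \<theta>, q)" by (cases U)
    obtain u' v' \<theta>' q' where Ut: "T t U = (u', v', \<theta>', q')" by (cases "T t U")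
    have "T 0 U = (u, v, \<theta>, q)"
      using T_0 U system_dom_subset U_eq by auto
    with decay[OF t orbit_rot_flow[OF sg gen U l]] b[OF l] cy[OF l]
    show ?thesis
      by (simp add: Ut mode_energy_rot[OF l0] mode_energy_rot1[OF l0] system_op_state_energy[OF U l U_eq])
         (simp add: state_energy_def)
  qed
  have bound: "operator_norm_on S N (T t \<circ> inv_into Gd G) \<le> ennreal (sqrt M * t powr (- (1 / (2 * s))))"
    if t: "t > 0" for t
  proof -
    have "operator_norm_on S N (T t \<circ> inv_into Gd G) \<le> ennreal (sqrt (M * t powr (- (1 / s))))"
    proof (rule operator_norm_inverse_le)
      show "T t U \<in> S" if "U \<in> Gd" for U
        using T_in[of t U] t that system_dom_subset by auto
    qed (use M mode t in auto)
    also have "sqrt (M * t powr (- (1 / s))) = sqrt M * t powr (- (1 / (2 * s)))"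
      using t by (simp add: real_sqrt_mult powr_powr mult.commute flip: powr_half_sqrt)
    finally show ?thesis .
  qed
  have "sqrt M > 0" "1 / (2 * s) > 0" using M \<open>s > 0\<close> by auto
  then show ?thesis
    using zero_in_resolvent bound unfolding polynomially_stable_def by blast
qed

text \<open>Here \<open>l powr (2 * \<alpha>)\<close> dominates \<open>\<sigma> * l\<close> on the
  spectrum. Bounding \<open>(freq l)^2\<close> by it from above controls the denominator of the fast
  coupling, and from below the negative power on the other side; \<open>s\<close> is chosen so that
  both become \<open>l powr (\<beta> - 2 * \<alpha>)\<close>.\<close>

lemma stable_V1:
  assumes "1 \<le> 2 * \<alpha>" "\<beta> < 2 * \<alpha>"
    and sg: "C0_contraction_semigroup S N T" and gen: "has_generator S N T Gd G"
  shows "polynomially_stable S N T Gd G (\<alpha> / (2 * \<alpha> - \<beta>))"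
proof -
  obtain m where m: "m > 0" and ml: "\<And>l. l \<in> ev \<Longrightarrow> m \<le> l"
    using eigenvalues_bounded_below by blast
  define s where "s = (2 * \<alpha> - \<beta>) / (2 * \<alpha>)"
  \<comment> \<open>The constant in \<open>(freq l)^2 \<le> C2 * l powr (2 * \<alpha>)\<close>.
    Since \<open>freq l\<close> occurs to the fourth power in the squared fast coupling, the
    admissible \<open>c\<close> is \<open>1 / C2^2\<close>.\<close>
  define C2 where "C2 = \<sigma> * m powr (1 - 2 * \<alpha>) + 1"
  have s: "s > 0" using assms by (simp add: s_def)
  have C2: "C2 > 0" unfolding C2_def using sigma by (simp add: add_nonneg_pos)
  have "1 / C2\<^sup>2 * ((freq l)\<^sup>2) powr (- s) \<le> (fast_coupling l)\<^sup>2" if "l \<in> ev" for l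
  proof -
    have l: "m \<le> l" "l > 0" using that ml eigenvalue_pos by auto
    have r: "freq l > 0" by (rule freq_pos[OF l(2)])
    have r2: "(freq l)\<^sup>2 = \<sigma> * l + l powr (2 * \<alpha>)" using l sigma by (simp add: freq_def)
    have "l powr 1 \<le> m powr (1 - 2 * \<alpha>) * l powr (2 * \<alpha>)"
      by (rule powr_le_powr_const) (use l m assms in auto)
    then have "\<sigma> * l \<le> \<sigma> * (m powr (1 - 2 * \<alpha>) * l powr (2 * \<alpha>))"
      using sigma l by (intro mult_left_mono) auto
    then have r_le: "(freq l)\<^sup>2 \<le> C2 * l powr (2 * \<alpha>)" by (simp add: r2 C2_def algebra_simps)
    have "((freq l)\<^sup>2) powr (- s) \<le> (l powr (2 * \<alpha>)) powr (- s)"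
      using s l sigma by (intro powr_mono2') (auto simp: r2)
    also have "\<dots> = l powr (\<beta> - 2 * \<alpha>)"
      using assms by (simp add: powr_powr s_def)
    finally have "1 / C2\<^sup>2 * ((freq l)\<^sup>2) powr (- s) \<le> 1 / C2\<^sup>2 * l powr (\<beta> - 2 * \<alpha>)"
      by (intro mult_left_mono) auto
    also have "\<dots> = l powr (\<beta> + 2 * \<alpha>) / (C2 * l powr (2 * \<alpha>))\<^sup>2"
      using l by (simp add: power_mult_distrib power2_eq_square powr_diff powr_add)
    also have "\<dots> \<le> l powr (\<beta> + 2 * \<alpha>) / ((freq l)\<^sup>2)\<^sup>2"
      using r_le r C2 l by (intro divide_left_mono power_mono) auto
    also have "\<dots> = (fast_coupling l)\<^sup>2"
      using l by (simp add: fast_coupling_sq)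
    finally show ?thesis .
  qed
  then have "polynomially_stable S N T Gd G (1 / (2 * s))"
    by (intro polynomial_stability[OF sg gen s, where c = "1 / C2\<^sup>2"]) (use C2 in auto)
  moreover have "1 / (2 * s) = \<alpha> / (2 * \<alpha> - \<beta>)"
    using assms by (simp add: s_def field_simps)
  ultimately show ?thesis by simp
qed

text \<open>Now \<open>\<sigma> * l\<close> is the dominant term, so \<open>(freq l)^2\<close> lies
  between \<open>\<sigma> * l\<close> and \<open>C2 * l\<close>, and the exponent of
  \<open>l\<close> on both sides is \<open>\<beta> + 2 * \<alpha> - 2\<close>. The factor
  \<open>\<sigma> powr s\<close> compensates for the \<open>\<sigma>\<close> in the lower
  bound.\<close>

lemma stable_V2:
  assumes "2 * \<alpha> < 1"
    and sg: "C0_contraction_semigroup S N T" and gen: "has_generator S N T Gd G"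
  shows "polynomially_stable S N T Gd G (1 / (2 * (2 - 2 * \<alpha> - \<beta>)))"
proof -
  obtain m where m: "m > 0" and ml: "\<And>l. l \<in> ev \<Longrightarrow> m \<le> l"
    using eigenvalues_bounded_below by blast
  define s where "s = 2 - 2 * \<alpha> - \<beta>"
  define C2 where "C2 = \<sigma> + m powr (2 * \<alpha> - 1)"
  have s: "s > 0" using assms beta by (simp add: s_def)
  have C2: "C2 > 0" unfolding C2_def using sigma by (simp add: add_pos_nonneg)
  have "\<sigma> powr s / C2\<^sup>2 * ((freq l)\<^sup>2) powr (- s) \<le> (fast_coupling l)\<^sup>2" if "l \<in> ev" for l
  proof -
    have l: "m \<le> l" "l > 0" using that ml eigenvalue_pos by auto
    have r: "freq l > 0" by (rule freq_pos[OF l(2)])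
    have r2: "(freq l)\<^sup>2 = \<sigma> * l + l powr (2 * \<alpha>)" using l sigma by (simp add: freq_def)
    have "l powr (2 * \<alpha>) \<le> m powr (2 * \<alpha> - 1) * l powr 1"
      by (rule powr_le_powr_const) (use l m assms in auto)
    then have r_le: "(freq l)\<^sup>2 \<le> C2 * l" using l by (simp add: r2 C2_def algebra_simps)
    have "((freq l)\<^sup>2) powr (- s) \<le> (\<sigma> * l) powr (- s)"
      using s l sigma by (intro powr_mono2') (auto simp: r2)
    then have "\<sigma> powr s / C2\<^sup>2 * ((freq l)\<^sup>2) powr (- s) \<le> \<sigma> powr s / C2\<^sup>2 * (\<sigma> * l) powr (- s)"
      by (intro mult_left_mono) auto
    also have "\<dots> = l powr (- s) / C2\<^sup>2"
      using l sigma by (simp add: powr_mult powr_minus_divide)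
    also have "\<dots> = l powr (\<beta> + 2 * \<alpha>) / (C2 * l)\<^sup>2"
    proof -
      have "l powr (- s) = l powr (\<beta> + 2 * \<alpha>) / l powr 2"
        by (simp add: s_def algebra_simps flip: powr_diff)
      then show ?thesis using l by (simp add: power_mult_distrib)
    qed
    also have "\<dots> \<le> l powr (\<beta> + 2 * \<alpha>) / ((freq l)\<^sup>2)\<^sup>2"
      using r_le r C2 l by (intro divide_left_mono power_mono) auto
    also have "\<dots> = (fast_coupling l)\<^sup>2"
      using l by (simp add: fast_coupling_sq)
    finally show ?thesis .
  qed
  then have "polynomially_stable S N T Gd G (1 / (2 * s))"
    by (intro polynomial_stability[OF sg gen s, where c = "\<sigma> powr s / C2\<^sup>2"]) (use C2 sigma in auto)
  then show ?thesis by (simp add: s_def)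
qed

end

theorem theorem2p7:
  fixes D :: "'h::chilbert_space set"
    and A :: "'h \<Rightarrow> 'h"
    and \<sigma> \<tau> \<alpha> \<beta> :: real
    and T :: "real \<Rightarrow> 'h state \<Rightarrow> 'h state"
  assumes "\<sigma> > 0" and "\<tau> > 0"
    and "\<alpha> \<in> {0..1}" and "\<beta> \<in> {0..1}"
    and "self_adjoint D A" and "positive_definite D A" and "compact_resolvent D A"
    and "C0_contraction_semigroup (state_space D A) (state_norm D A \<sigma> \<tau>) T"
    and "has_generator (state_space D A) (state_norm D A \<sigma> \<tau>) T
           (system_dom D A \<sigma> \<alpha> \<beta>) (system_op D A \<sigma> \<tau> \<alpha> \<beta>)"
  shows "((\<alpha>, \<beta>) \<in> V1_star \<longrightarrow>
            polynomially_stable (state_space D A) (state_norm D A \<sigma> \<tau>) T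
              (system_dom D A \<sigma> \<alpha> \<beta>) (system_op D A \<sigma> \<tau> \<alpha> \<beta>)
              (\<alpha> / (2 * \<alpha> - \<beta>))) \<and>
         ((\<alpha>, \<beta>) \<in> V2_star \<longrightarrow>
            polynomially_stable (state_space D A) (state_norm D A \<sigma> \<tau>) T
              (system_dom D A \<sigma> \<alpha> \<beta>) (system_op D A \<sigma> \<tau> \<alpha> \<beta>)
              (1 / (2 * (2 - 2 * \<alpha> - \<beta>))))"
proof (intro conjI impI)
  \<comment> \<open>The inequality \<open>2 * \<alpha> \<le> 1 + \<beta>\<close> fails on part of
    the unit square, so the locale becomes available only once membership in a region is
    assumed.\<close>
  have sys: "cattaneo_system D A \<sigma> \<tau> \<alpha> \<beta>" if "2 * \<alpha> \<le> 1 + \<beta>"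
    using assms that by unfold_locales auto
  show "polynomially_stable (state_space D A) (state_norm D A \<sigma> \<tau>) T
      (system_dom D A \<sigma> \<alpha> \<beta>) (system_op D A \<sigma> \<tau> \<alpha> \<beta>) (\<alpha> / (2 * \<alpha> - \<beta>))"
    if "(\<alpha>, \<beta>) \<in> V1_star"
  proof -
    \<comment> \<open>The strict inequality keeps the exponent positive; it holds because the corner
      with \<open>\<alpha> = 1/2\<close> and \<open>\<beta> = 1\<close> is not in the
      region.\<close>
    have "2 * \<alpha> \<le> 1 + \<beta>" "1 \<le> 2 * \<alpha>" "\<beta> < 2 * \<alpha>"
      using that by (auto simp: V1_star_def T1_star_def F12_star_def F14_star_def L124_star_def)
    then show ?thesis
      by (intro cattaneo_system.stable_V1[OF sys] assms(8,9))
  qed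
  show "polynomially_stable (state_space D A) (state_norm D A \<sigma> \<tau>) T
      (system_dom D A \<sigma> \<alpha> \<beta>) (system_op D A \<sigma> \<tau> \<alpha> \<beta>) (1 / (2 * (2 - 2 * \<alpha> - \<beta>)))"
    if "(\<alpha>, \<beta>) \<in> V2_star"
  proof -
    have "2 * \<alpha> \<le> 1 + \<beta>" "2 * \<alpha> < 1"
      using that by (auto simp: V2_star_def T2_star_def F2_star_def L23_star_def)
    then show ?thesis
      by (intro cattaneo_system.stable_V2[OF sys] assms(8,9))
  qed
qed

end
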